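(* Let $\mathbb K$ be a commutative unital ring, $V$ and $W$ $\mathbb K$-modules, and $P:V\to W$ a polynomial law. Then $P$ induces a homogeneous $C^\infty$-law between $V$ and $W$ with base map $P_{\mathbb K}:V\to W$: the maps $\mathsf G^{\overline{\mathsf k}}P:\mathsf G^{\overline{\mathsf k}}V\to\mathsf G^{\overline{\mathsf k}}W$, $k\ge0$, obtained by iterated derivation of $P$, form a homogeneous $C^\infty$-law.
   Context: **Polynomial laws.** A linear set is a pair $(U,V)$ with $V$ a $\mathbb K$-module and $U\subset V$ (here $U=V$). A polynomial law $P:V\to W$ (Roby) is a family of maps $P_A:V\otimes A\to W\otimes A$, natural in the commutative $\mathbb K$-algebra $A$. There is a unique polynomial law $P^{[1]}:V\times V\times\mathbb K\to W$ with $P_{A[T]}(x+Tv)=P_A(x)+T F$, $F\in W\otimes A[T]$, $P^{[1]}_A(x,v,t)=F|_{T=t}$. Put $P^{\{1\}}(x,v,t)=(P(x),P^{[1]}(x,v,t),t)$ and $P^{\overline{\{1\}}}(x,v,s,t)=(P(x),P^{[1]}(x,v,st),s,t)$. **$m$-fold categories.** A small category has source $\pi_0$, target $\pi_1$, unit section, product $g'*g$ defined iff $\pi_1(g)=\pi_0(g')$. A small $m$-fold category indexed by a finite set $N$ ($|N|=m$) is a family of sets $(C_\alpha)_{\alpha\subset N}$ with a small category (morphisms $C_\alpha$, objects $C_\beta$) for each edge $(\beta,\alpha=\beta\cup\{i\})$, $i\notin\beta$, such that on each face the four edge categories form a double category. Morphisms are families of maps of vertex sets that are functors on each edge category. **First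 order.** For a linear set $(X,E)$, $\mathsf G^{\overline{\{k\}}}X$ is the double category indexed by $\{k,k'\}$ with vertex sets $C_\emptyset=X\times\mathbb K$, $C_{\{k\}}=X^{\{k\}}=\{(x,v,t):x\in X,\ x+tv\in X\}$, $C_{\{k'\}}=X\times\mathbb K^2$, $C_{\{k,k'\}}=\{(x,v,s,t):x\in X,\ x+stv\in X\}$ ($v\in E$, $s,t\in\mathbb K$). Direction $k$: $\pi_0(x,v,t)=(x,t)$, $\pi_1(x,v,t)=(x+tv,t)$, unit $(x,0,t)$, $(x',v',t)*(x,v,t)=(x,v+v',t)$; $\pi_0(x,v,s,t)=(x,s,t)$, $\pi_1(x,v,s,t)=(x+stv,s,t)$, unit $(x,0,s,t)$, $(x',v',s,t)*(x,v,s,t)=(x,v+v',s,t)$. Direction $k'$: source $\partial_0(x,s,t)=(x,st)$, target $\partial_1(x,s,t)=(x,t)$, unit $(x,1,t)$, $(x,s',t')\bullet(x,s,t)=(x,ss',t')$; $\partial_0(x,v,s,t)=(x,v,st)$, $\partial_1(x,v,s,t)=(x,sv,t)$, unit $(x,v,1,t)$, $(x,v',s',t')\bullet(x,v,s,t)=(x,v,ss',t')$. **Recursion.** $\mathsf G^{\overline{\mathsf 0}}U=U$, and $\mathsf G^{\overline{\mathsf n}}U$ is the $2n$-fold category indexed by $\{1,1',\dots,n,n'\}$ obtained from $\mathsf G^{\overline{\mathsf{n-1}}}U$ (vertex sets $X_\alpha$) by taking at $\alpha,\alpha\cup\{n\},\alpha\cup\{n'\},\alpha\cup\{n,n'\}$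 the four vertex sets of $\mathsf G^{\overline{\{n\}}}X_\alpha$, with its structure maps in directions $n,n'$, and, in old directions, replacing each structure map $f$ (a polynomial law) by $f\times\mathrm{id}_{\mathbb K}$, $f^{\{1\}}$, $f\times\mathrm{id}_{\mathbb K^2}$, $f^{\overline{\{1\}}}$ respectively (products restricted to pairs composable for the derived projections). For a polynomial law $P$, $\mathsf G^{\overline{\mathsf 0}}P=P_{\mathbb K}$, and the vertex maps of $\mathsf G^{\overline{\mathsf n}}P$ arise from each vertex map $f$ of $\mathsf G^{\overline{\mathsf{n-1}}}P$ by the same four replacements. **Homogeneous $C^\infty$-law between $U$ and $U'$.** A family $(\mathbf f^{\overline{\mathsf k}})_{k\ge0}$ of morphisms of $2k$-fold categories $\mathbf f^{\overline{\mathsf k}}:\mathsf G^{\overline{\mathsf k}}U\to\mathsf G^{\overline{\mathsf k}}U'$, compatible with each other: for $k\ge1$, on vertices $\alpha$ containing neither $k$ nor $k'$, the vertex map of $\mathbf f^{\overline{\mathsf k}}$ is (that of $\mathbf f^{\overline{\mathsf{k-1}}}$)$\times\mathrm{id}_{\mathbb K}$; moreover the scalar variables $s,t$ added at step $k$ are preserved. The base map is $\mathbf f^{\overline{\mathsf 0}}:U\to U'$. *)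

theory Defs
  imports "HOL-Algebra.UnivPoly" "HOL-Algebra.Free_Abelian_Groups"
begin

section \<open>A universe of commutative algebras\<close>

text \<open>
  HOL cannot quantify over all \<open>K\<close>-algebras of all types, so algebras take their carriers in the type
  \<open>'k uelem\<close>, which contains the elements of \<open>K\<close> and is closed under \<open>A \<mapsto> A[T]\<close>.  Every finitely
  generated commutative \<open>K\<close>-algebra, being a quotient of some \<open>K[T1,...,Tn]\<close>, is isomorphic
  to one with carrier in this type.
  As every algebra is the filtered colimit of its finitely generated subalgebras, and the functors
  \<open>A \<mapsto> V \<otimes> A\<close> commute with filtered colimits, a polynomial law on these algebras
  extends uniquely to a polynomial law on all commutative \<open>K\<close>-algebras.
\<close>

datatype 'k uelem = Scal (unScal: 'k) | Poly (unPoly: "nat \<Rightarrow> 'k uelem")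

type_synonym 'k alg = "('k, 'k uelem) module"

text \<open>Commutative \<open>K\<close>-algebras are the models of the library locale \<^locale>\<open>algebra\<close>.\<close>

definition alg_hom :: "'k alg \<Rightarrow> 'k alg \<Rightarrow> 'k ring \<Rightarrow> ('k uelem \<Rightarrow> 'k uelem) set" where
  "alg_hom A B K = {h \<in> ring_hom A B.
     \<forall>c\<in>carrier K. \<forall>a\<in>carrier A. h (c \<odot>\<^bsub>A\<^esub> a) = c \<odot>\<^bsub>B\<^esub> h a}"

definition scal_alg :: "'k ring \<Rightarrow> 'k alg" where
  "scal_alg K = \<lparr>carrier = Scal ` carrier K,
     mult = (\<lambda>a b. Scal (unScal a \<otimes>\<^bsub>K\<^esub> unScal b)), one = Scal \<one>\<^bsub>K\<^esub>,
     ring.zero = Scal \<zero>\<^bsub>K\<^esub>, ring.add = (\<lambda>a b. Scal (unScal a \<oplus>\<^bsub>K\<^esub> unScal b)),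
     module.smult = (\<lambda>c a. Scal (c \<otimes>\<^bsub>K\<^esub> unScal a))\<rparr>"

text \<open>The \<open>K\<close>-algebra \<open>A[T]\<close>: the library's \<^term>\<open>UP A\<close>, transported along \<^const>\<open>Poly\<close>.\<close>

definition poly_alg :: "'k alg \<Rightarrow> 'k alg" where
  "poly_alg A = \<lparr>carrier = Poly ` carrier (UP A),
     mult = (\<lambda>p q. Poly (unPoly p \<otimes>\<^bsub>UP A\<^esub> unPoly q)), one = Poly \<one>\<^bsub>UP A\<^esub>,
     ring.zero = Poly \<zero>\<^bsub>UP A\<^esub>, ring.add = (\<lambda>p q. Poly (unPoly p \<oplus>\<^bsub>UP A\<^esub> unPoly q)),
     module.smult = (\<lambda>c p. Poly (\<lambda>n. c \<odot>\<^bsub>A\<^esub> unPoly p n))\<rparr>"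

definition poly_const :: "'k alg \<Rightarrow> 'k uelem \<Rightarrow> 'k uelem" where
  "poly_const A a = Poly (monom (UP A) a 0)"

definition poly_var :: "'k alg \<Rightarrow> 'k uelem" where
  "poly_var A = Poly (monom (UP A) \<one>\<^bsub>A\<^esub> 1)"

definition poly_eval :: "'k alg \<Rightarrow> 'k uelem \<Rightarrow> 'k uelem \<Rightarrow> 'k uelem" where
  "poly_eval A t p = eval A A (\<lambda>a. a) t (unPoly p)"


section \<open>Scalar extension and polynomial laws\<close>

text \<open>\<open>V \<otimes>\<^sub>K A\<close> is the free abelian group on \<open>V \<times> A\<close> modulo the usual relations.\<close>

type_synonym ('v, 'k) tns = "('v \<times> 'k uelem \<Rightarrow>\<^sub>0 int) set"

definition tensor_free :: "('k, 'v) module \<Rightarrow> 'k alg \<Rightarrow> ('v \<times> 'k uelem \<Rightarrow>\<^sub>0 int) monoid" where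
  "tensor_free V A = free_Abelian_group (carrier V \<times> carrier A)"

definition tensor_relators ::
    "'k ring \<Rightarrow> ('k, 'v) module \<Rightarrow> 'k alg \<Rightarrow> ('v \<times> 'k uelem \<Rightarrow>\<^sub>0 int) set" where
  "tensor_relators K V A =
     {frag_of (x \<oplus>\<^bsub>V\<^esub> y, a) - frag_of (x, a) - frag_of (y, a) | x y a.
        x \<in> carrier V \<and> y \<in> carrier V \<and> a \<in> carrier A} \<union>
     {frag_of (x, a \<oplus>\<^bsub>A\<^esub> b) - frag_of (x, a) - frag_of (x, b) | x a b.
        x \<in> carrier V \<and> a \<in> carrier A \<and> b \<in> carrier A} \<union>
     {frag_of (c \<odot>\<^bsub>V\<^esub> x, a) - frag_of (x, c \<odot>\<^bsub>A\<^esub> a) | c x a.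
        c \<in> carrier K \<and> x \<in> carrier V \<and> a \<in> carrier A}"

definition tensor_kernel ::
    "'k ring \<Rightarrow> ('k, 'v) module \<Rightarrow> 'k alg \<Rightarrow> ('v \<times> 'k uelem \<Rightarrow>\<^sub>0 int) set" where
  "tensor_kernel K V A = generate (tensor_free V A) (tensor_relators K V A)"

definition tensor_class ::
    "'k ring \<Rightarrow> ('k, 'v) module \<Rightarrow> 'k alg \<Rightarrow> ('v \<times> 'k uelem \<Rightarrow>\<^sub>0 int) \<Rightarrow> ('v, 'k) tns" where
  "tensor_class K V A p = tensor_kernel K V A #>\<^bsub>tensor_free V A\<^esub> p"

definition pure_tensor ::
    "'k ring \<Rightarrow> ('k, 'v) module \<Rightarrow> 'k alg \<Rightarrow> 'v \<Rightarrow> 'k uelem \<Rightarrow> ('v, 'k) tns" where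
  "pure_tensor K V A v a = tensor_class K V A (frag_of (v, a))"

text \<open>
  The map \<open>id \<otimes> h : V \<otimes> A \<rightarrow> V \<otimes> B\<close>, for a \<open>K\<close>-linear \<open>h : A \<rightarrow> B\<close>; the result does not depend
  on the chosen representative.
\<close>

definition tensor_map ::
    "'k ring \<Rightarrow> ('k, 'v) module \<Rightarrow> 'k alg \<Rightarrow> ('k uelem \<Rightarrow> 'k uelem) \<Rightarrow> ('v, 'k) tns \<Rightarrow> ('v, 'k) tns" where
  "tensor_map K V B h z =
     tensor_class K V B (frag_extend (\<lambda>(v, a). frag_of (v, h a)) (SOME p. p \<in> z))"

text \<open>\<open>V \<otimes>\<^sub>K A\<close> as an \<open>A\<close>-module (the ring multiplication of the record is irrelevant).\<close>

definition tensor ::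
    "'k ring \<Rightarrow> ('k, 'v) module \<Rightarrow> 'k alg \<Rightarrow> ('k uelem, ('v, 'k) tns) module" where
  "tensor K V A = (let Q = tensor_free V A Mod tensor_kernel K V A in
     \<lparr>carrier = carrier Q, mult = undefined, one = undefined,
      ring.zero = \<one>\<^bsub>Q\<^esub>, ring.add = (\<lambda>y z. y \<otimes>\<^bsub>Q\<^esub> z),
      module.smult = (\<lambda>a. tensor_map K V A (\<lambda>b. a \<otimes>\<^bsub>A\<^esub> b))\<rparr>)"

definition polynomial_law ::
    "'k ring \<Rightarrow> ('k, 'v) module \<Rightarrow> ('k, 'w) module \<Rightarrow>
     ('k alg \<Rightarrow> ('v, 'k) tns \<Rightarrow> ('w, 'k) tns) \<Rightarrow> bool" where
  "polynomial_law K V W P \<longleftrightarrow>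
     (\<forall>A. algebra K A \<longrightarrow> P A \<in> carrier (tensor K V A) \<rightarrow> carrier (tensor K W A)) \<and>
     (\<forall>A B h. algebra K A \<and> algebra K B \<and> h \<in> alg_hom A B K \<longrightarrow>
        (\<forall>z\<in>carrier (tensor K V A).
           P B (tensor_map K V B h z) = tensor_map K W B h (P A z)))"

text \<open>The underlying map \<open>P\<^sub>K : V \<rightarrow> W\<close>, using \<open>V = V \<otimes> K\<close> and \<open>W = W \<otimes> K\<close>.\<close>

definition underlying_map ::
    "'k ring \<Rightarrow> ('k, 'v) module \<Rightarrow> ('k, 'w) module \<Rightarrow>
     ('k alg \<Rightarrow> ('v, 'k) tns \<Rightarrow> ('w, 'k) tns) \<Rightarrow> 'v \<Rightarrow> 'w" where
  "underlying_map K V W P v =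
     inv_into (carrier W) (\<lambda>w. pure_tensor K W (scal_alg K) w (Scal \<one>\<^bsub>K\<^esub>))
       (P (scal_alg K) (pure_tensor K V (scal_alg K) v (Scal \<one>\<^bsub>K\<^esub>)))"


section \<open>Points of the iterated vertex sets\<close>

text \<open>
  All modules that occur are finite products of copies of \<open>V\<close> and \<open>K\<close>; a shape records how such
  a product \<open>X\<close> is built: from \<open>X\<close> one forms \<open>X \<times> K\<close>, \<open>X \<times> X \<times> K\<close>, \<open>X \<times> K\<^sup>2\<close>, \<open>X \<times> X \<times> K\<^sup>2\<close> and,
  for the domains of the products of the edge categories, \<open>X \<times> X\<close>.
  For a module \<open>M\<close> over a ring \<open>R\<close>, the points of a shape are obtained by putting \<open>M\<close> for \<open>V\<close> and
  \<open>R\<close> for \<open>K\<close>.  With \<open>M = V\<close> and \<open>R = K\<close> this gives \<open>X\<close>; with \<open>M = V \<otimes> A\<close> and \<open>R = A\<close> it gives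
  \<open>X \<otimes> A\<close>, up to the canonical isomorphism.
\<close>

datatype shape =
    SBase
  | SXt shape
  | SXvt shape
  | SXst shape
  | SXvst shape
  | SDuo shape shape

datatype ('m, 'r) pt =
    Vec 'm
  | Xt "('m, 'r) pt" 'r
  | Xvt "('m, 'r) pt" "('m, 'r) pt" 'r
  | Xst "('m, 'r) pt" 'r 'r
  | Xvst "('m, 'r) pt" "('m, 'r) pt" 'r 'r
  | Duo "('m, 'r) pt" "('m, 'r) pt"

primrec pt_carrier :: "('r, 'l) ring_scheme \<Rightarrow> ('r, 'm) module \<Rightarrow> shape \<Rightarrow> ('m, 'r) pt set" where
  "pt_carrier R M SBase = Vec ` carrier M"
| "pt_carrier R M (SXt S) = {Xt x t | x t. x \<in> pt_carrier R M S \<and> t \<in> carrier R}"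
| "pt_carrier R M (SXvt S) =
     {Xvt x v t | x v t. x \<in> pt_carrier R M S \<and> v \<in> pt_carrier R M S \<and> t \<in> carrier R}"
| "pt_carrier R M (SXst S) =
     {Xst x s t | x s t. x \<in> pt_carrier R M S \<and> s \<in> carrier R \<and> t \<in> carrier R}"
| "pt_carrier R M (SXvst S) =
     {Xvst x v s t | x v s t. x \<in> pt_carrier R M S \<and> v \<in> pt_carrier R M S \<and>
        s \<in> carrier R \<and> t \<in> carrier R}"
| "pt_carrier R M (SDuo S S') = {Duo x y | x y. x \<in> pt_carrier R M S \<and> y \<in> pt_carrier R M S'}"

primrec pt_zero :: "('r, 'l) ring_scheme \<Rightarrow> ('r, 'm) module \<Rightarrow> shape \<Rightarrow> ('m, 'r) pt" where
  "pt_zero R M SBase = Vec \<zero>\<^bsub>M\<^esub>"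
| "pt_zero R M (SXt S) = Xt (pt_zero R M S) \<zero>\<^bsub>R\<^esub>"
| "pt_zero R M (SXvt S) = Xvt (pt_zero R M S) (pt_zero R M S) \<zero>\<^bsub>R\<^esub>"
| "pt_zero R M (SXst S) = Xst (pt_zero R M S) \<zero>\<^bsub>R\<^esub> \<zero>\<^bsub>R\<^esub>"
| "pt_zero R M (SXvst S) = Xvst (pt_zero R M S) (pt_zero R M S) \<zero>\<^bsub>R\<^esub> \<zero>\<^bsub>R\<^esub>"
| "pt_zero R M (SDuo S S') = Duo (pt_zero R M S) (pt_zero R M S')"

fun pt_add :: "('r, 'l) ring_scheme \<Rightarrow> ('r, 'm) module \<Rightarrow>
    ('m, 'r) pt \<Rightarrow> ('m, 'r) pt \<Rightarrow> ('m, 'r) pt" where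
  "pt_add R M (Vec x) (Vec y) = Vec (x \<oplus>\<^bsub>M\<^esub> y)"
| "pt_add R M (Xt x t) (Xt x' t') = Xt (pt_add R M x x') (t \<oplus>\<^bsub>R\<^esub> t')"
| "pt_add R M (Xvt x v t) (Xvt x' v' t') =
     Xvt (pt_add R M x x') (pt_add R M v v') (t \<oplus>\<^bsub>R\<^esub> t')"
| "pt_add R M (Xst x s t) (Xst x' s' t') = Xst (pt_add R M x x') (s \<oplus>\<^bsub>R\<^esub> s') (t \<oplus>\<^bsub>R\<^esub> t')"
| "pt_add R M (Xvst x v s t) (Xvst x' v' s' t') =
     Xvst (pt_add R M x x') (pt_add R M v v') (s \<oplus>\<^bsub>R\<^esub> s') (t \<oplus>\<^bsub>R\<^esub> t')"
| "pt_add R M (Duo x y) (Duo x' y') = Duo (pt_add R M x x') (pt_add R M y y')"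

primrec pt_smult :: "('r, 'l) ring_scheme \<Rightarrow> ('r, 'm) module \<Rightarrow>
    'r \<Rightarrow> ('m, 'r) pt \<Rightarrow> ('m, 'r) pt" where
  "pt_smult R M a (Vec x) = Vec (a \<odot>\<^bsub>M\<^esub> x)"
| "pt_smult R M a (Xt x t) = Xt (pt_smult R M a x) (a \<otimes>\<^bsub>R\<^esub> t)"
| "pt_smult R M a (Xvt x v t) = Xvt (pt_smult R M a x) (pt_smult R M a v) (a \<otimes>\<^bsub>R\<^esub> t)"
| "pt_smult R M a (Xst x s t) = Xst (pt_smult R M a x) (a \<otimes>\<^bsub>R\<^esub> s) (a \<otimes>\<^bsub>R\<^esub> t)"
| "pt_smult R M a (Xvst x v s t) =
     Xvst (pt_smult R M a x) (pt_smult R M a v) (a \<otimes>\<^bsub>R\<^esub> s) (a \<otimes>\<^bsub>R\<^esub> t)"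
| "pt_smult R M a (Duo x y) = Duo (pt_smult R M a x) (pt_smult R M a y)"


section \<open>Derivation of polynomial laws\<close>

type_synonym ('v, 'w, 'k) law =
  "'k alg \<Rightarrow> (('v, 'k) tns, 'k uelem) pt \<Rightarrow> (('w, 'k) tns, 'k uelem) pt"

definition pt_map :: "'k ring \<Rightarrow> ('k, 'v) module \<Rightarrow> 'k alg \<Rightarrow> ('k uelem \<Rightarrow> 'k uelem) \<Rightarrow>
    (('v, 'k) tns, 'k uelem) pt \<Rightarrow> (('v, 'k) tns, 'k uelem) pt" where
  "pt_map K V B h = map_pt (tensor_map K V B h) h"

text \<open>
  \<open>f\<^sup>[\<^sup>1\<^sup>]\<^sub>A(x, v, t) = F|\<^sub>T\<^sub>=\<^sub>t\<close>, where \<open>f\<^sub>A\<^sub>[\<^sub>T\<^sub>](x + T v) = f\<^sub>A(x) + T F\<close>.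
  The domain of \<open>f\<close> is built from \<open>V\<close>, and its codomain is built from \<open>W\<close> with shape \<open>Y\<close>.
\<close>

definition diff_quot :: "'k ring \<Rightarrow> ('k, 'v) module \<Rightarrow> ('k, 'w) module \<Rightarrow> shape \<Rightarrow>
    ('v, 'w, 'k) law \<Rightarrow> 'k alg \<Rightarrow> (('v, 'k) tns, 'k uelem) pt \<Rightarrow> (('v, 'k) tns, 'k uelem) pt \<Rightarrow>
    'k uelem \<Rightarrow> (('w, 'k) tns, 'k uelem) pt" where
  "diff_quot K V W Y f A x v t =
    (let B = poly_alg A; T = poly_var A; VB = tensor K V B; WB = tensor K W B;
         F = (THE F. F \<in> pt_carrier B WB Y \<and>
               f B (pt_add B VB (pt_map K V B (poly_const A) x)
                      (pt_smult B VB T (pt_map K V B (poly_const A) v)))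
               = pt_add B WB (pt_map K W B (poly_const A) (f A x)) (pt_smult B WB T F))
     in pt_map K W A (poly_eval A t) F)"

text \<open>
  The four replacements \<open>f \<times> id\<^sub>K\<close>, \<open>f\<^sup>{\<^sup>1\<^sup>}\<close>, \<open>f \<times> id\<close> on \<open>K\<^sup>2\<close>, and
  \<open>(x, v, s, t) \<mapsto> (f(x), f\<^sup>[\<^sup>1\<^sup>](x, v, st), s, t)\<close>, at once:
  the constructor of the argument tells which of the four vertices the point belongs to.
\<close>

fun derived :: "'k ring \<Rightarrow> ('k, 'v) module \<Rightarrow> ('k, 'w) module \<Rightarrow> shape \<Rightarrow>
    ('v, 'w, 'k) law \<Rightarrow> ('v, 'w, 'k) law" where
  "derived K V W Y f A (Xt x t) = Xt (f A x) t"
| "derived K V W Y f A (Xvt x v t) = Xvt (f A x) (diff_quot K V W Y f A x v t) t"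
| "derived K V W Y f A (Xst x s t) = Xst (f A x) s t"
| "derived K V W Y f A (Xvst x v s t) =
     Xvst (f A x) (diff_quot K V W Y f A x v (s \<otimes>\<^bsub>A\<^esub> t)) s t"

text \<open>
  \<open>X\<^sup>{\<^sup>1\<^sup>} \<times> X\<^sup>{\<^sup>1\<^sup>}\<close>, restricted to pairs with equal scalars, is identified with \<open>(X \<times> X)\<^sup>{\<^sup>1\<^sup>}\<close>,
  and likewise for the other vertices.  Composable pairs have equal scalars.
\<close>

fun zip_pt :: "('m, 'r) pt \<Rightarrow> ('m, 'r) pt" where
  "zip_pt (Duo (Xt x' t') (Xt x t)) = Xt (Duo x' x) t"
| "zip_pt (Duo (Xvt x' v' t') (Xvt x v t)) = Xvt (Duo x' x) (Duo v' v) t"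
| "zip_pt (Duo (Xst x' s' t') (Xst x s t)) = Xst (Duo x' x) s t"
| "zip_pt (Duo (Xvst x' v' s' t') (Xvst x v s t)) = Xvst (Duo x' x) (Duo v' v) s t"


section \<open>First order structure maps\<close>

text \<open>
  \<open>k\<close> and \<open>k'\<close> refer to the two new directions.  Products are laws on \<open>X \<times> X\<close>, given
  there by the formulas valid for composable pairs.  The set of composable pairs is the image
  of an idempotent law on \<open>X \<times> X\<close>, so by the chain rule the restriction of a derived product to
  composable pairs does not depend on the extension chosen.
\<close>

fun k_src :: "'k ring \<Rightarrow> ('k, 'v) module \<Rightarrow> ('v, 'v, 'k) law" where
  "k_src K V A (Xvt x v t) = Xt x t"
| "k_src K V A (Xvst x v s t) = Xst x s t"

fun k_tgt :: "'k ring \<Rightarrow> ('k, 'v) module \<Rightarrow> ('v, 'v, 'k) law" where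
  "k_tgt K V A (Xvt x v t) =
     Xt (pt_add A (tensor K V A) x (pt_smult A (tensor K V A) t v)) t"
| "k_tgt K V A (Xvst x v s t) =
     Xst (pt_add A (tensor K V A) x (pt_smult A (tensor K V A) (s \<otimes>\<^bsub>A\<^esub> t) v)) s t"

fun k_unit :: "'k ring \<Rightarrow> ('k, 'v) module \<Rightarrow> shape \<Rightarrow> ('v, 'v, 'k) law" where
  "k_unit K V X A (Xt x t) = Xvt x (pt_zero A (tensor K V A) X) t"
| "k_unit K V X A (Xst x s t) = Xvst x (pt_zero A (tensor K V A) X) s t"

fun k_prod :: "'k ring \<Rightarrow> ('k, 'v) module \<Rightarrow> ('v, 'v, 'k) law" where
  "k_prod K V A (Duo (Xvt x' v' t') (Xvt x v t)) = Xvt x (pt_add A (tensor K V A) v v') t"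
| "k_prod K V A (Duo (Xvst x' v' s' t') (Xvst x v s t)) =
     Xvst x (pt_add A (tensor K V A) v v') s t"

fun k'_src :: "'k ring \<Rightarrow> ('k, 'v) module \<Rightarrow> ('v, 'v, 'k) law" where
  "k'_src K V A (Xst x s t) = Xt x (s \<otimes>\<^bsub>A\<^esub> t)"
| "k'_src K V A (Xvst x v s t) = Xvt x v (s \<otimes>\<^bsub>A\<^esub> t)"

fun k'_tgt :: "'k ring \<Rightarrow> ('k, 'v) module \<Rightarrow> ('v, 'v, 'k) law" where
  "k'_tgt K V A (Xst x s t) = Xt x t"
| "k'_tgt K V A (Xvst x v s t) = Xvt x (pt_smult A (tensor K V A) s v) t"

fun k'_unit :: "'k ring \<Rightarrow> ('k, 'v) module \<Rightarrow> ('v, 'v, 'k) law" where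
  "k'_unit K V A (Xt x t) = Xst x \<one>\<^bsub>A\<^esub> t"
| "k'_unit K V A (Xvt x v t) = Xvst x v \<one>\<^bsub>A\<^esub> t"

fun k'_prod :: "'k ring \<Rightarrow> ('k, 'v) module \<Rightarrow> ('v, 'v, 'k) law" where
  "k'_prod K V A (Duo (Xst x' s' t') (Xst x s t)) = Xst x (s \<otimes>\<^bsub>A\<^esub> s') t'"
| "k'_prod K V A (Duo (Xvst x' v' s' t') (Xvst x v s t)) = Xvst x v (s \<otimes>\<^bsub>A\<^esub> s') t'"


section \<open>The recursion, on the level of polynomial laws\<close>

datatype dir = Unprimed nat | Primed nat

definition dirs :: "nat \<Rightarrow> dir set" where
  "dirs n = Unprimed ` {1..n} \<union> Primed ` {1..n}"

primrec G_shape :: "nat \<Rightarrow> dir set \<Rightarrow> shape" where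
  "G_shape 0 \<alpha> = SBase"
| "G_shape (Suc n) \<alpha> =
    (if Unprimed (Suc n) \<in> \<alpha>
     then if Primed (Suc n) \<in> \<alpha> then SXvst (G_shape n \<alpha>) else SXvt (G_shape n \<alpha>)
     else if Primed (Suc n) \<in> \<alpha> then SXst (G_shape n \<alpha>) else SXt (G_shape n \<alpha>))"

text \<open>
  Structure maps for the edge \<open>(\<beta>, \<beta> \<union> {i})\<close>; there is no edge for \<open>n = 0\<close>.
\<close>

primrec G_src :: "'k ring \<Rightarrow> ('k, 'v) module \<Rightarrow> nat \<Rightarrow> dir set \<Rightarrow> dir \<Rightarrow> ('v, 'v, 'k) law" where
  "G_src K V 0 \<beta> i = undefined"
| "G_src K V (Suc n) \<beta> i =
    (if i = Unprimed (Suc n) then k_src K V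
     else if i = Primed (Suc n) then k'_src K V
     else derived K V V (G_shape n \<beta>) (G_src K V n \<beta> i))"

primrec G_tgt :: "'k ring \<Rightarrow> ('k, 'v) module \<Rightarrow> nat \<Rightarrow> dir set \<Rightarrow> dir \<Rightarrow> ('v, 'v, 'k) law" where
  "G_tgt K V 0 \<beta> i = undefined"
| "G_tgt K V (Suc n) \<beta> i =
    (if i = Unprimed (Suc n) then k_tgt K V
     else if i = Primed (Suc n) then k'_tgt K V
     else derived K V V (G_shape n \<beta>) (G_tgt K V n \<beta> i))"

primrec G_unit :: "'k ring \<Rightarrow> ('k, 'v) module \<Rightarrow> nat \<Rightarrow> dir set \<Rightarrow> dir \<Rightarrow> ('v, 'v, 'k) law" where
  "G_unit K V 0 \<beta> i = undefined"
| "G_unit K V (Suc n) \<beta> i =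
    (if i = Unprimed (Suc n) then k_unit K V (G_shape n \<beta>)
     else if i = Primed (Suc n) then k'_unit K V
     else derived K V V (G_shape n (insert i \<beta>)) (G_unit K V n \<beta> i))"

primrec G_prod :: "'k ring \<Rightarrow> ('k, 'v) module \<Rightarrow> nat \<Rightarrow> dir set \<Rightarrow> dir \<Rightarrow> ('v, 'v, 'k) law" where
  "G_prod K V 0 \<beta> i = undefined"
| "G_prod K V (Suc n) \<beta> i =
    (if i = Unprimed (Suc n) then k_prod K V
     else if i = Primed (Suc n) then k'_prod K V
     else (\<lambda>A p. derived K V V (G_shape n (insert i \<beta>)) (G_prod K V n \<beta> i) A (zip_pt p)))"

fun base_law :: "('k alg \<Rightarrow> ('v, 'k) tns \<Rightarrow> ('w, 'k) tns) \<Rightarrow> ('v, 'w, 'k) law" where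
  "base_law P A (Vec z) = Vec (P A z)"

primrec G_law :: "'k ring \<Rightarrow> ('k, 'v) module \<Rightarrow> ('k, 'w) module \<Rightarrow>
    ('k alg \<Rightarrow> ('v, 'k) tns \<Rightarrow> ('w, 'k) tns) \<Rightarrow> nat \<Rightarrow> dir set \<Rightarrow> ('v, 'w, 'k) law" where
  "G_law K V W P 0 \<alpha> = base_law P"
| "G_law K V W P (Suc n) \<alpha> = derived K V W (G_shape n \<alpha>) (G_law K V W P n \<alpha>)"

text \<open>
  The map of sets \<open>f\<^sub>K : X \<rightarrow> Y\<close> underlying a polynomial law, using \<open>X = X \<otimes> K\<close> and \<open>Y = Y \<otimes> K\<close>.
\<close>

definition pt_embed :: "'k ring \<Rightarrow> ('k, 'v) module \<Rightarrow> ('v, 'k) pt \<Rightarrow> (('v, 'k) tns, 'k uelem) pt" where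
  "pt_embed K V = map_pt (\<lambda>v. pure_tensor K V (scal_alg K) v (Scal \<one>\<^bsub>K\<^esub>)) Scal"

definition law_at_K :: "'k ring \<Rightarrow> ('k, 'v) module \<Rightarrow> ('k, 'w) module \<Rightarrow> shape \<Rightarrow>
    ('v, 'w, 'k) law \<Rightarrow> ('v, 'k) pt \<Rightarrow> ('w, 'k) pt" where
  "law_at_K K V W Y f x =
     inv_into (pt_carrier K W Y) (pt_embed K W) (f (scal_alg K) (pt_embed K V x))"


section \<open>Small \<open>m\<close>-fold categories\<close>

text \<open>The product \<^term>\<open>cmp C g' g\<close> is only meaningful if \<^term>\<open>tgt C g = src C g'\<close>.\<close>

record ('o, 'm) cat =
  Obj :: "'o set"
  Mor :: "'m set"
  src :: "'m \<Rightarrow> 'o"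
  tgt :: "'m \<Rightarrow> 'o"
  unt :: "'o \<Rightarrow> 'm"
  cmp :: "'m \<Rightarrow> 'm \<Rightarrow> 'm"

definition small_category :: "('o, 'm) cat \<Rightarrow> bool" where
  "small_category C \<longleftrightarrow>
     src C \<in> Mor C \<rightarrow> Obj C \<and> tgt C \<in> Mor C \<rightarrow> Obj C \<and> unt C \<in> Obj C \<rightarrow> Mor C \<and>
     (\<forall>x\<in>Obj C. src C (unt C x) = x \<and> tgt C (unt C x) = x) \<and>
     (\<forall>g\<in>Mor C. \<forall>g'\<in>Mor C. tgt C g = src C g' \<longrightarrow>
        cmp C g' g \<in> Mor C \<and> src C (cmp C g' g) = src C g \<and> tgt C (cmp C g' g) = tgt C g') \<and>
     (\<forall>g\<in>Mor C. cmp C g (unt C (src C g)) = g \<and> cmp C (unt C (tgt C g)) g = g) \<and>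
     (\<forall>g\<in>Mor C. \<forall>g'\<in>Mor C. \<forall>g''\<in>Mor C. tgt C g = src C g' \<and> tgt C g' = src C g'' \<longrightarrow>
        cmp C g'' (cmp C g' g) = cmp C (cmp C g'' g') g)"

definition is_functor ::
    "('o, 'm) cat \<Rightarrow> ('p, 'n) cat \<Rightarrow> ('o \<Rightarrow> 'p) \<Rightarrow> ('m \<Rightarrow> 'n) \<Rightarrow> bool" where
  "is_functor C D f0 f1 \<longleftrightarrow>
     f0 \<in> Obj C \<rightarrow> Obj D \<and> f1 \<in> Mor C \<rightarrow> Mor D \<and>
     (\<forall>g\<in>Mor C. src D (f1 g) = f0 (src C g) \<and> tgt D (f1 g) = f0 (tgt C g)) \<and>
     (\<forall>x\<in>Obj C. unt D (f0 x) = f1 (unt C x)) \<and>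
     (\<forall>g\<in>Mor C. \<forall>g'\<in>Mor C. tgt C g = src C g' \<longrightarrow> f1 (cmp C g' g) = cmp D (f1 g') (f1 g))"

text \<open>
  A double category is a category object in the category of small categories:
\<close>
(*
            D1
     Mor C0 <-- Mor C1
       |          |
    C0 |          | C1
       v    D0    v
     Obj C0 <-- Obj C1
*)

definition composable_pairs ::
    "('b, 'd) cat \<Rightarrow> ('a, 'b) cat \<Rightarrow> ('c, 'd) cat \<Rightarrow> ('b \<times> 'b, 'd \<times> 'd) cat" where
  "composable_pairs C1 D0 D1 =
     \<lparr>Obj = {(b', b). b' \<in> Obj C1 \<and> b \<in> Obj C1 \<and> tgt D0 b = src D0 b'},
      Mor = {(d', d). d' \<in> Mor C1 \<and> d \<in> Mor C1 \<and> tgt D1 d = src D1 d'},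
      src = map_prod (src C1) (src C1),
      tgt = map_prod (tgt C1) (tgt C1),
      unt = map_prod (unt C1) (unt C1),
      cmp = (\<lambda>(g', g) (h', h). (cmp C1 g' h', cmp C1 g h))\<rparr>"

definition double_category ::
    "('a, 'c) cat \<Rightarrow> ('b, 'd) cat \<Rightarrow> ('a, 'b) cat \<Rightarrow> ('c, 'd) cat \<Rightarrow> bool" where
  "double_category C0 C1 D0 D1 \<longleftrightarrow>
     small_category C0 \<and> small_category C1 \<and> small_category D0 \<and> small_category D1 \<and>
     Obj D0 = Obj C0 \<and> Mor D0 = Obj C1 \<and> Obj D1 = Mor C0 \<and> Mor D1 = Mor C1 \<and>
     is_functor C1 C0 (src D0) (src D1) \<and>
     is_functor C1 C0 (tgt D0) (tgt D1) \<and>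
     is_functor C0 C1 (unt D0) (unt D1) \<and>
     is_functor (composable_pairs C1 D0 D1) C1 (case_prod (cmp D0)) (case_prod (cmp D1))"

record ('i, 'x) mfold =
  vert :: "'i set \<Rightarrow> 'x set"
  esrc :: "'i set \<Rightarrow> 'i \<Rightarrow> 'x \<Rightarrow> 'x"
  etgt :: "'i set \<Rightarrow> 'i \<Rightarrow> 'x \<Rightarrow> 'x"
  eunt :: "'i set \<Rightarrow> 'i \<Rightarrow> 'x \<Rightarrow> 'x"
  ecmp :: "'i set \<Rightarrow> 'i \<Rightarrow> 'x \<Rightarrow> 'x \<Rightarrow> 'x"

definition edge :: "('i, 'x) mfold \<Rightarrow> 'i set \<Rightarrow> 'i \<Rightarrow> ('x, 'x) cat" where
  "edge C \<beta> i = \<lparr>Obj = vert C \<beta>, Mor = vert C (insert i \<beta>),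
     src = esrc C \<beta> i, tgt = etgt C \<beta> i, unt = eunt C \<beta> i, cmp = ecmp C \<beta> i\<rparr>"

definition mfold_category :: "'i set \<Rightarrow> ('i, 'x) mfold \<Rightarrow> bool" where
  "mfold_category N C \<longleftrightarrow> finite N \<and>
     (\<forall>\<beta> i. \<beta> \<subseteq> N \<and> i \<in> N - \<beta> \<longrightarrow> small_category (edge C \<beta> i)) \<and>
     (\<forall>\<beta> i j. \<beta> \<subseteq> N \<and> i \<in> N - \<beta> \<and> j \<in> N - \<beta> \<and> i \<noteq> j \<longrightarrow>
        double_category (edge C \<beta> i) (edge C (insert j \<beta>) i)
                        (edge C \<beta> j) (edge C (insert i \<beta>) j))"

definition mfold_morphism ::
    "'i set \<Rightarrow> ('i, 'x) mfold \<Rightarrow> ('i, 'y) mfold \<Rightarrow> ('i set \<Rightarrow> 'x \<Rightarrow> 'y) \<Rightarrow> bool" where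
  "mfold_morphism N C D f \<longleftrightarrow> mfold_category N C \<and> mfold_category N D \<and>
     (\<forall>\<alpha>. \<alpha> \<subseteq> N \<longrightarrow> f \<alpha> \<in> vert C \<alpha> \<rightarrow> vert D \<alpha>) \<and>
     (\<forall>\<beta> i. \<beta> \<subseteq> N \<and> i \<in> N - \<beta> \<longrightarrow>
        is_functor (edge C \<beta> i) (edge D \<beta> i) (f \<beta>) (f (insert i \<beta>)))"


section \<open>The \<open>2n\<close>-fold categories and homogeneous smooth laws\<close>

text \<open>
  Since the domain is the whole module, the condition \<open>x + t v \<in> X\<close> on the points
  of \<open>X\<^sup>{\<^sup>k\<^sup>}\<close> holds automatically.
\<close>

definition G :: "'k ring \<Rightarrow> ('k, 'v) module \<Rightarrow> nat \<Rightarrow> (dir, ('v, 'k) pt) mfold" where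
  "G K V n =
     \<lparr>vert = (\<lambda>\<alpha>. pt_carrier K V (G_shape n \<alpha>)),
      esrc = (\<lambda>\<beta> i. law_at_K K V V (G_shape n \<beta>) (G_src K V n \<beta> i)),
      etgt = (\<lambda>\<beta> i. law_at_K K V V (G_shape n \<beta>) (G_tgt K V n \<beta> i)),
      eunt = (\<lambda>\<beta> i. law_at_K K V V (G_shape n (insert i \<beta>)) (G_unit K V n \<beta> i)),
      ecmp = (\<lambda>\<beta> i g' g.
        law_at_K K V V (G_shape n (insert i \<beta>)) (G_prod K V n \<beta> i) (Duo g' g))\<rparr>"

definition G_map :: "'k ring \<Rightarrow> ('k, 'v) module \<Rightarrow> ('k, 'w) module \<Rightarrow>
    ('k alg \<Rightarrow> ('v, 'k) tns \<Rightarrow> ('w, 'k) tns) \<Rightarrow> nat \<Rightarrow> dir set \<Rightarrow> ('v, 'k) pt \<Rightarrow> ('w, 'k) pt" where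
  "G_map K V W P n \<alpha> = law_at_K K V W (G_shape n \<alpha>) (G_law K V W P n \<alpha>)"

fun added_scalars :: "('m, 'r) pt \<Rightarrow> 'r list" where
  "added_scalars (Xt x t) = [t]"
| "added_scalars (Xvt x v t) = [t]"
| "added_scalars (Xst x s t) = [s, t]"
| "added_scalars (Xvst x v s t) = [s, t]"

definition homogeneous_smooth_law :: "'k ring \<Rightarrow> ('k, 'v) module \<Rightarrow> ('k, 'w) module \<Rightarrow>
    (nat \<Rightarrow> dir set \<Rightarrow> ('v, 'k) pt \<Rightarrow> ('w, 'k) pt) \<Rightarrow> bool" where
  "homogeneous_smooth_law K V W f \<longleftrightarrow>
     (\<forall>k. mfold_morphism (dirs k) (G K V k) (G K W k) (f k)) \<and>
     (\<forall>k\<ge>1. \<forall>\<alpha>. \<alpha> \<subseteq> dirs k \<and> Unprimed k \<notin> \<alpha> \<and> Primed k \<notin> \<alpha> \<longrightarrow>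
        (\<forall>x t. Xt x t \<in> vert (G K V k) \<alpha> \<longrightarrow> f k \<alpha> (Xt x t) = Xt (f (k - 1) \<alpha> x) t)) \<and>
     (\<forall>k\<ge>1. \<forall>\<alpha>. \<alpha> \<subseteq> dirs k \<longrightarrow>
        (\<forall>p\<in>vert (G K V k) \<alpha>. added_scalars (f k \<alpha> p) = added_scalars p))"

text \<open>\<open>V\<close> itself is the only vertex set of \<^term>\<open>G K V 0\<close>, with \<open>v\<close> written \<^term>\<open>Vec v\<close>.\<close>

definition has_base_map :: "('k, 'v) module \<Rightarrow>
    (nat \<Rightarrow> dir set \<Rightarrow> ('v, 'k) pt \<Rightarrow> ('w, 'k) pt) \<Rightarrow> ('v \<Rightarrow> 'w) \<Rightarrow> bool" where
  "has_base_map V f p \<longleftrightarrow> (\<forall>v\<in>carrier V. f 0 {} (Vec v) = Vec (p v))"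

end

theory Submission
  imports Defs
begin

text \<open>
  For an algebra \<open>A\<close> and \<open>t \<in> A\<close>, the points of a module \<open>X\<close> over \<open>A\<^sub>t = A[T]/(T\<^sup>2 - tT)\<close> are the
  sums \<open>x + Tv\<close> with \<open>x, v\<close> points over \<open>A\<close>, and a polynomial law \<open>f\<close> sends \<open>x + Tv\<close> to
  \<open>f(x) + T f\<^sup>[\<^sup>1\<^sup>](x, v, t)\<close>.  So the derived law \<open>f\<^sup>{\<^sup>1\<^sup>}\<close> over \<open>A\<close>, for a fixed \<open>t\<close>, is the law
  \<open>f\<close> over \<open>A\<^sub>t\<close>, and \<open>(x, v, s, t) \<mapsto> (f(x), f\<^sup>[\<^sup>1\<^sup>](x, v, st), s, t)\<close> is \<open>f\<close> over \<open>A\<^sub>s\<^sub>t\<close>.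
  Every axiom between old structure maps at step \<open>n + 1\<close> is therefore the same axiom at step \<open>n\<close>
  over other algebras, which is why the induction treats all algebras at once.  The axioms for a new
  direction say that laws commute with \<open>x + tv\<close>, with the addition of increments, and with the
  rescaling of \<open>v\<close>; they reduce to the case \<open>t = T\<close> over \<open>A[T]\<close>, where \<open>T\<close> acts injectively.
\<close>

section \<open>Scalar extension as a functor of linear maps\<close>

text \<open>Two obstacles shape the proof. First, splitting a point over \<open>A[T]\<close> or
  \<open>A[T]/(T^2 - tT)\<close> into its coordinates uses maps such as \<open>pshift\<close> and
  \<open>dsnd\<close>, which are linear over \<open>K\<close> but not multiplicative. So
  \<open>V \<otimes> A\<close> is treated as a functor of linear maps in \<open>A\<close>:
  identities between points become identities between such maps, and multiplicativity enters only
  where a law has to be natural or a scalar has to be moved. Second, the algebra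
  \<open>A[T]/(T^2 - tT)\<close> varies with the scalar \<open>t\<close> of the point. So an old
  edge category of step \<open>n + 1\<close> over \<open>A\<close> does not sit inside one category
  of step \<open>n\<close>, but inside a disjoint union of them, one part for each choice of algebra
  and scalars. Old structure maps leave the scalars alone, so the axioms can be checked part by
  part. The same transport, with one part only, leads at the end from points over
  \<open>scal_alg K\<close> to points with entries in \<open>V\<close> and \<open>K\<close>.
  Products need extra care: a composable pair of points becomes a point of a derived shape only
  after the regrouping \<open>zip_pt\<close>.\<close>

definition lin_maps :: "'k ring \<Rightarrow> 'k alg \<Rightarrow> 'k alg \<Rightarrow> ('k uelem \<Rightarrow> 'k uelem) set" where
  "lin_maps K A B = {h \<in> carrier A \<rightarrow> carrier B.
     (\<forall>a\<in>carrier A. \<forall>b\<in>carrier A. h (a \<oplus>\<^bsub>A\<^esub> b) = h a \<oplus>\<^bsub>B\<^esub> h b) \<and>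
     (\<forall>c\<in>carrier K. \<forall>a\<in>carrier A. h (c \<odot>\<^bsub>A\<^esub> a) = c \<odot>\<^bsub>B\<^esub> h a)}"

lemma lin_mapsI:
  assumes "\<And>a. a \<in> carrier A \<Longrightarrow> h a \<in> carrier B"
    and "\<And>a b. a \<in> carrier A \<Longrightarrow> b \<in> carrier A \<Longrightarrow> h (a \<oplus>\<^bsub>A\<^esub> b) = h a \<oplus>\<^bsub>B\<^esub> h b"
    and "\<And>c a. c \<in> carrier K \<Longrightarrow> a \<in> carrier A \<Longrightarrow> h (c \<odot>\<^bsub>A\<^esub> a) = c \<odot>\<^bsub>B\<^esub> h a"
  shows "h \<in> lin_maps K A B"
  using assms by (auto simp: lin_maps_def)

lemma lin_mapsD:
  assumes "h \<in> lin_maps K A B"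
  shows "a \<in> carrier A \<Longrightarrow> h a \<in> carrier B"
    and "a \<in> carrier A \<Longrightarrow> b \<in> carrier A \<Longrightarrow> h (a \<oplus>\<^bsub>A\<^esub> b) = h a \<oplus>\<^bsub>B\<^esub> h b"
    and "c \<in> carrier K \<Longrightarrow> a \<in> carrier A \<Longrightarrow> h (c \<odot>\<^bsub>A\<^esub> a) = c \<odot>\<^bsub>B\<^esub> h a"
  using assms by (auto simp: lin_maps_def)

lemma alg_hom_lin_maps: "h \<in> alg_hom A B K \<Longrightarrow> h \<in> lin_maps K A B"
  by (auto simp: lin_maps_def alg_hom_def ring_hom_def)

lemma lin_maps_id: "(\<lambda>a. a) \<in> lin_maps K A A"
  by (auto simp: lin_maps_def)

lemma lin_maps_comp:
  "h \<in> lin_maps K A B \<Longrightarrow> g \<in> lin_maps K B C \<Longrightarrow> (\<lambda>a. g (h a)) \<in> lin_maps K A C"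
  by (auto simp: lin_maps_def Pi_def)

lemma lin_maps_plus:
  assumes "algebra K B" "h \<in> lin_maps K A B" "g \<in> lin_maps K A B"
  shows "(\<lambda>a. h a \<oplus>\<^bsub>B\<^esub> g a) \<in> lin_maps K A B"
proof -
  interpret B: algebra K B by fact
  show ?thesis
    by (rule lin_mapsI)
      (auto simp: lin_mapsD[OF assms(2)] lin_mapsD[OF assms(3)] B.a_ac B.smult_r_distr)
qed

lemma lin_maps_zero:
  assumes "algebra K B"
  shows "(\<lambda>a. \<zero>\<^bsub>B\<^esub>) \<in> lin_maps K A B"
proof -
  interpret B: algebra K B by fact
  show ?thesis
    by (rule lin_mapsI) auto
qed

text \<open>The action of \<open>a\<close> on \<open>V \<otimes> A\<close> is by definition the
  image under \<open>tensor_map\<close> of multiplication by \<open>a\<close>, so its properties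
  come from functoriality once this map is linear over \<open>K\<close>. Commutativity of
  \<open>A\<close> moves \<open>c\<close> out of the second factor.\<close>

lemma lin_maps_mult:
  assumes "algebra K A" "a \<in> carrier A"
  shows "(\<lambda>b. a \<otimes>\<^bsub>A\<^esub> b) \<in> lin_maps K A A"
proof -
  interpret A: algebra K A by fact
  show ?thesis
  proof (rule lin_mapsI)
    fix c b assume cb: "c \<in> carrier K" "b \<in> carrier A"
    have "a \<otimes>\<^bsub>A\<^esub> (c \<odot>\<^bsub>A\<^esub> b) = (c \<odot>\<^bsub>A\<^esub> b) \<otimes>\<^bsub>A\<^esub> a"
      using assms cb by (intro A.m_comm) auto
    also have "\<dots> = c \<odot>\<^bsub>A\<^esub> (b \<otimes>\<^bsub>A\<^esub> a)"
      using assms cb by (intro A.smult_assoc2) auto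
    also have "b \<otimes>\<^bsub>A\<^esub> a = a \<otimes>\<^bsub>A\<^esub> b"
      using assms cb by (intro A.m_comm) auto
    finally show "a \<otimes>\<^bsub>A\<^esub> (c \<odot>\<^bsub>A\<^esub> b) = c \<odot>\<^bsub>A\<^esub> (a \<otimes>\<^bsub>A\<^esub> b)" .
  qed (use assms in \<open>auto simp: A.r_distr\<close>)
qed

abbreviation frag_map :: "('k uelem \<Rightarrow> 'k uelem) \<Rightarrow> ('v \<times> 'k uelem \<Rightarrow>\<^sub>0 int) \<Rightarrow> ('v \<times> 'k uelem \<Rightarrow>\<^sub>0 int)"
  where "frag_map h \<equiv> frag_extend (\<lambda>(v, a). frag_of (v, h a))"

lemma frag_map_closed:
  assumes "Poly_Mapping.keys p \<subseteq> X \<times> Y" "h \<in> Y \<rightarrow> Z"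
  shows "Poly_Mapping.keys (frag_map h p) \<subseteq> X \<times> Z"
proof -
  have "Poly_Mapping.keys (frag_map h p) \<subseteq>
      (\<Union>x\<in>Poly_Mapping.keys p. Poly_Mapping.keys (case x of (v, a) \<Rightarrow> frag_of (v, h a)))"
    by (rule keys_frag_extend)
  also have "\<dots> \<subseteq> X \<times> Z"
    using assms by (fastforce simp: keys_frag_of)
  finally show ?thesis .
qed

section \<open>Tensor products as quotients of free abelian groups\<close>

locale coeff_module = module K V for K :: "'k ring" and V :: "('k, 'v) module"
begin

lemma group_tensor_free: "group (tensor_free V A)"
  by (simp add: tensor_free_def)

lemma tensor_relators_closed:
  assumes "algebra K A"
  shows "tensor_relators K V A \<subseteq> carrier (tensor_free V A)"
proof -
  interpret A: algebra K A by fact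
  define F where "F = carrier (tensor_free V A)"
  have d: "p - q \<in> F" if "p \<in> F" "q \<in> F" for p q
    using that keys_diff[of p q] by (auto simp: F_def tensor_free_def)
  have f: "frag_of (v, a) \<in> F" if "v \<in> carrier V" "a \<in> carrier A" for v a
    using that by (simp add: F_def tensor_free_def keys_frag_of)
  have "tensor_relators K V A \<subseteq> F"
    unfolding tensor_relators_def by (auto intro!: d f)
  then show ?thesis
    by (simp add: F_def)
qed

lemma tensor_kernel_subgroup:
  assumes "algebra K A"
  shows "subgroup (tensor_kernel K V A) (tensor_free V A)"
  unfolding tensor_kernel_def
  using group.generate_is_subgroup[OF group_tensor_free tensor_relators_closed[OF assms]] .

lemma tensor_kernel_closed:
  "algebra K A \<Longrightarrow> p \<in> tensor_kernel K V A \<Longrightarrow> Poly_Mapping.keys p \<subseteq> carrier V \<times> carrier A"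
  using subgroup.mem_carrier[OF tensor_kernel_subgroup] by (fastforce simp: tensor_free_def)

lemma tensor_kernel_ops:
  assumes "algebra K A"
  shows "0 \<in> tensor_kernel K V A"
    and "p \<in> tensor_kernel K V A \<Longrightarrow> q \<in> tensor_kernel K V A \<Longrightarrow> p + q \<in> tensor_kernel K V A"
    and "p \<in> tensor_kernel K V A \<Longrightarrow> - p \<in> tensor_kernel K V A"
    and "p \<in> tensor_kernel K V A \<Longrightarrow> q \<in> tensor_kernel K V A \<Longrightarrow> p - q \<in> tensor_kernel K V A"
proof -
  note sg = tensor_kernel_subgroup[OF assms]
  show "0 \<in> tensor_kernel K V A"
    using subgroup.one_closed[OF sg] by (simp add: tensor_free_def)
  show add: "p + q \<in> tensor_kernel K V A"
    if "p \<in> tensor_kernel K V A" "q \<in> tensor_kernel K V A" for p q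
    using subgroup.m_closed[OF sg that] by (simp add: tensor_free_def)
  show neg: "- p \<in> tensor_kernel K V A" if "p \<in> tensor_kernel K V A" for p
    using subgroup.m_inv_closed[OF sg that] tensor_kernel_closed[OF assms that]
    by (simp add: tensor_free_def)
  show "p - q \<in> tensor_kernel K V A"
    if "p \<in> tensor_kernel K V A" "q \<in> tensor_kernel K V A"
    using add[OF that(1) neg[OF that(2)]] by simp
qed

lemma tensor_class_altdef: "tensor_class K V A p = (\<lambda>n. n + p) ` tensor_kernel K V A"
  by (auto simp: tensor_class_def r_coset_def tensor_free_def)

lemma tensor_class_eq_iff:
  assumes "algebra K A"
  shows "tensor_class K V A p = tensor_class K V A q \<longleftrightarrow> p - q \<in> tensor_kernel K V A"
proof
  assume "tensor_class K V A p = tensor_class K V A q"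
  moreover have "p \<in> tensor_class K V A p"
    unfolding tensor_class_altdef using tensor_kernel_ops(1)[OF assms] by force
  ultimately show "p - q \<in> tensor_kernel K V A"
    unfolding tensor_class_altdef by auto
next
  assume pq: "p - q \<in> tensor_kernel K V A"
  have "n + p \<in> (\<lambda>n. n + q) ` tensor_kernel K V A" if "n \<in> tensor_kernel K V A" for n
    using tensor_kernel_ops(2)[OF assms that pq] by (force simp: algebra_simps)
  moreover have "n + q \<in> (\<lambda>n. n + p) ` tensor_kernel K V A" if "n \<in> tensor_kernel K V A" for n
    using tensor_kernel_ops(4)[OF assms that pq] by (force simp: algebra_simps)
  ultimately show "tensor_class K V A p = tensor_class K V A q"
    unfolding tensor_class_altdef by blast
qed

lemma carrier_tensor:
  "carrier (tensor K V A) =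
     tensor_class K V A ` {p. Poly_Mapping.keys p \<subseteq> carrier V \<times> carrier A}"
  unfolding tensor_def Let_def by (simp add: carrier_FactGroup tensor_class_def tensor_free_def
      free_Abelian_group_def)

lemma tensor_class_closed:
  "Poly_Mapping.keys p \<subseteq> carrier V \<times> carrier A \<Longrightarrow> tensor_class K V A p \<in> carrier (tensor K V A)"
  by (auto simp: carrier_tensor)

lemma tensor_carrierE:
  assumes "z \<in> carrier (tensor K V A)"
  obtains p where "Poly_Mapping.keys p \<subseteq> carrier V \<times> carrier A" "z = tensor_class K V A p"
  using assms by (auto simp: carrier_tensor)

lemma zero_tensor:
  "\<zero>\<^bsub>tensor K V A\<^esub> = tensor_class K V A 0"
  by (simp add: tensor_def Let_def tensor_class_altdef)

lemma add_tensor: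
  assumes "algebra K A"
  shows "tensor_class K V A p \<oplus>\<^bsub>tensor K V A\<^esub> tensor_class K V A q = tensor_class K V A (p + q)"
proof -
  have "tensor_class K V A p \<oplus>\<^bsub>tensor K V A\<^esub> tensor_class K V A q =
      {m + p + (n + q) | m n. m \<in> tensor_kernel K V A \<and> n \<in> tensor_kernel K V A}"
    by (auto simp: tensor_def Let_def set_mult_def tensor_class_altdef tensor_free_def)
  also have "\<dots> = tensor_class K V A (p + q)"
  proof (intro subset_antisym subsetI)
    fix z assume "z \<in> {m + p + (n + q) | m n. m \<in> tensor_kernel K V A \<and> n \<in> tensor_kernel K V A}"
    then obtain m n where "m \<in> tensor_kernel K V A" "n \<in> tensor_kernel K V A" "z = (m + n) + (p + q)"
      by (auto simp: algebra_simps)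
    then show "z \<in> tensor_class K V A (p + q)"
      unfolding tensor_class_altdef using tensor_kernel_ops(2)[OF assms] by blast
  next
    fix z assume "z \<in> tensor_class K V A (p + q)"
    then obtain m where "m \<in> tensor_kernel K V A" "z = m + p + (0 + q)"
      by (auto simp: tensor_class_altdef algebra_simps)
    then show "z \<in> {m + p + (n + q) | m n. m \<in> tensor_kernel K V A \<and> n \<in> tensor_kernel K V A}"
      using tensor_kernel_ops(1)[OF assms] by blast
  qed
  finally show ?thesis .
qed

lemma tensor_abelian_group:
  assumes "algebra K A"
  shows "abelian_group (tensor K V A)"
proof (rule abelian_groupI)
  have keys_plus: "Poly_Mapping.keys (p + q) \<subseteq> S"
    if "Poly_Mapping.keys p \<subseteq> S" "Poly_Mapping.keys q \<subseteq> S" for p q :: "'v \<times> 'k uelem \<Rightarrow>\<^sub>0 int" and S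
    using that Poly_Mapping.keys_add[of p q] by blast
  fix x y assume x: "x \<in> carrier (tensor K V A)" and y: "y \<in> carrier (tensor K V A)"
  then obtain p q where pq: "Poly_Mapping.keys p \<subseteq> carrier V \<times> carrier A" "x = tensor_class K V A p"
    "Poly_Mapping.keys q \<subseteq> carrier V \<times> carrier A" "y = tensor_class K V A q"
    by (metis tensor_carrierE)
  show "x \<oplus>\<^bsub>tensor K V A\<^esub> y \<in> carrier (tensor K V A)"
    unfolding pq add_tensor[OF assms] by (intro tensor_class_closed keys_plus pq)
  show "x \<oplus>\<^bsub>tensor K V A\<^esub> y = y \<oplus>\<^bsub>tensor K V A\<^esub> x"
    using pq by (auto simp: add_tensor[OF assms] add.commute)
  fix z assume "z \<in> carrier (tensor K V A)"
  then obtain r where "z = tensor_class K V A r"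
    by (metis tensor_carrierE)
  then show "x \<oplus>\<^bsub>tensor K V A\<^esub> y \<oplus>\<^bsub>tensor K V A\<^esub> z =
      x \<oplus>\<^bsub>tensor K V A\<^esub> (y \<oplus>\<^bsub>tensor K V A\<^esub> z)"
    using pq by (auto simp: add_tensor[OF assms] add.assoc)
next
  show "\<zero>\<^bsub>tensor K V A\<^esub> \<in> carrier (tensor K V A)"
    by (auto simp: zero_tensor intro!: tensor_class_closed)
next
  fix x assume "x \<in> carrier (tensor K V A)"
  then obtain p where p: "Poly_Mapping.keys p \<subseteq> carrier V \<times> carrier A" "x = tensor_class K V A p"
    by (metis tensor_carrierE)
  then show "\<zero>\<^bsub>tensor K V A\<^esub> \<oplus>\<^bsub>tensor K V A\<^esub> x = x"
    by (auto simp: add_tensor[OF assms] zero_tensor)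
  show "\<exists>y\<in>carrier (tensor K V A). y \<oplus>\<^bsub>tensor K V A\<^esub> x = \<zero>\<^bsub>tensor K V A\<^esub>"
    using p by (intro bexI[of _ "tensor_class K V A (- p)"])
      (auto simp: add_tensor[OF assms] zero_tensor intro!: tensor_class_closed)
qed

text \<open>A linear \<open>h\<close> carries each kind of relator to a relator of the same kind,
  and \<open>frag_map h\<close> is additive, so it suffices to look at the generators of the
  kernel.\<close>

lemma frag_map_kernel:
  assumes A: "algebra K A" and B: "algebra K B" and h: "h \<in> lin_maps K A B"
    and p: "p \<in> tensor_kernel K V A"
  shows "frag_map h p \<in> tensor_kernel K V B"
proof -
  have rel: "frag_map h r \<in> tensor_kernel K V B" if "r \<in> tensor_relators K V A" for r
  proof -
    have "frag_map h r \<in> tensor_relators K V B"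
      using that unfolding tensor_relators_def Un_iff mem_Collect_eq
      by (elim disjE exE conjE)
        (simp_all add: frag_extend_diff lin_mapsD[OF h],
          (metis lin_mapsD(1)[OF h])+)
    then show ?thesis
      unfolding tensor_kernel_def by (rule generate.incl)
  qed
  show ?thesis
    using p[unfolded tensor_kernel_def]
  proof induction
    case one
    then show ?case by (simp add: tensor_free_def tensor_kernel_ops(1)[OF B])
  next
    case (incl r)
    then show ?case by (rule rel)
  next
    case (inv r)
    then have "r \<in> carrier (tensor_free V A)"
      using tensor_relators_closed[OF A] by blast
    then have "inv\<^bsub>tensor_free V A\<^esub> r = - r"
      by (auto simp: tensor_free_def)
    then show ?case
      using rel[OF inv] by (simp add: frag_extend_minus tensor_kernel_ops(3)[OF B])
  next
    case (eng p q)
    then show ?case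
      by (simp add: tensor_free_def frag_extend_add tensor_kernel_ops(2)[OF B])
  qed
qed

text \<open>The representative picked by \<open>SOME\<close> differs from \<open>p\<close> by an
  element of the kernel, which \<open>frag_map_kernel\<close> keeps in the kernel. Later facts on
  \<open>tensor_map\<close> start from this form, where the choice has disappeared.\<close>

lemma tensor_map_class:
  assumes A: "algebra K A" and B: "algebra K B" and h: "h \<in> lin_maps K A B"
  shows "tensor_map K V B h (tensor_class K V A p) = tensor_class K V B (frag_map h p)"
proof -
  define r where "r = (SOME r. r \<in> tensor_class K V A p)"
  have "r \<in> tensor_class K V A p"
    unfolding r_def by (rule someI[of _ p])
      (use tensor_kernel_ops(1)[OF A] in \<open>force simp: tensor_class_altdef\<close>)
  then have "r - p \<in> tensor_kernel K V A"
    by (auto simp: tensor_class_altdef)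
  from frag_map_kernel[OF A B h this] show ?thesis
    unfolding tensor_map_def r_def[symmetric] by (simp add: tensor_class_eq_iff[OF B] frag_extend_diff)
qed

lemma tensor_map_closed:
  assumes "algebra K A" "algebra K B" "h \<in> lin_maps K A B" "z \<in> carrier (tensor K V A)"
  shows "tensor_map K V B h z \<in> carrier (tensor K V B)"
proof -
  obtain p where "Poly_Mapping.keys p \<subseteq> carrier V \<times> carrier A" "z = tensor_class K V A p"
    using assms by (metis tensor_carrierE)
  then show ?thesis
    using frag_map_closed[of p "carrier V" "carrier A" h "carrier B"] lin_mapsD(1)[OF assms(3)]
    by (auto simp: tensor_map_class[OF assms(1-3)] intro!: tensor_class_closed)
qed

lemma tensor_map_add:
  assumes "algebra K A" "algebra K B" "h \<in> lin_maps K A B"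
    "x \<in> carrier (tensor K V A)" "y \<in> carrier (tensor K V A)"
  shows "tensor_map K V B h (x \<oplus>\<^bsub>tensor K V A\<^esub> y) =
    tensor_map K V B h x \<oplus>\<^bsub>tensor K V B\<^esub> tensor_map K V B h y"
proof -
  obtain p q where "x = tensor_class K V A p" "y = tensor_class K V A q"
    using assms by (metis tensor_carrierE)
  then show ?thesis
    by (simp add: tensor_map_class[OF assms(1-3)] add_tensor[OF assms(1)] add_tensor[OF assms(2)]
        frag_extend_add)
qed

lemma tensor_map_comp:
  assumes "algebra K A" "algebra K B" "algebra K C" "h \<in> lin_maps K A B" "g \<in> lin_maps K B C"
    "z \<in> carrier (tensor K V A)"
  shows "tensor_map K V C g (tensor_map K V B h z) = tensor_map K V C (\<lambda>a. g (h a)) z"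
proof -
  obtain p where p: "Poly_Mapping.keys p \<subseteq> carrier V \<times> carrier A" "z = tensor_class K V A p"
    using assms by (metis tensor_carrierE)
  have "frag_map g (frag_map h p) = frag_map (\<lambda>a. g (h a)) p"
    using subset_UNIV[of "Poly_Mapping.keys p"]
    by (induction p rule: frag_induction) (auto simp: frag_extend_diff)
  then show ?thesis
    by (simp add: p tensor_map_class assms lin_maps_comp[of h K A B g C])
qed

text \<open>Linear maps are total functions on \<open>uelem\<close> of which only the values on the
  carrier matter; agreement there also makes \<open>h'\<close> linear.\<close>

lemma tensor_map_cong:
  assumes "algebra K A" "algebra K B" "h \<in> lin_maps K A B"
    "z \<in> carrier (tensor K V A)" "\<And>a. a \<in> carrier A \<Longrightarrow> h a = h' a"
  shows "tensor_map K V B h z = tensor_map K V B h' z"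
proof -
  have h': "h' \<in> lin_maps K A B"
  proof -
    interpret A: algebra K A by fact
    show ?thesis
    proof (rule lin_mapsI)
      show "h' a \<in> carrier B" if "a \<in> carrier A" for a
        using lin_mapsD(1)[OF assms(3) that] assms(5)[OF that] by simp
      show "h' (a \<oplus>\<^bsub>A\<^esub> b) = h' a \<oplus>\<^bsub>B\<^esub> h' b" if "a \<in> carrier A" "b \<in> carrier A" for a b
        using lin_mapsD(2)[OF assms(3) that] that by (simp add: assms(5))
      show "h' (c \<odot>\<^bsub>A\<^esub> a) = c \<odot>\<^bsub>B\<^esub> h' a" if "c \<in> carrier K" "a \<in> carrier A" for a c
        using lin_mapsD(3)[OF assms(3) that] that by (simp add: assms(5))
    qed
  qed
  obtain p where p: "Poly_Mapping.keys p \<subseteq> carrier V \<times> carrier A" "z = tensor_class K V A p"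
    using assms by (metis tensor_carrierE)
  have "frag_map h p = frag_map h' p"
    using p(1) assms(5) by (intro frag_extend_eq) auto
  then show ?thesis
    by (simp add: p tensor_map_class assms h')
qed

lemma tensor_map_id:
  assumes "algebra K A" "z \<in> carrier (tensor K V A)"
  shows "tensor_map K V A (\<lambda>a. a) z = z"
proof -
  obtain p where p: "z = tensor_class K V A p"
    using assms by (metis tensor_carrierE)
  have "frag_map (\<lambda>a. a) p = p"
    by (metis (mono_tags, lifting) case_prod_beta frag_expansion frag_extend_eq surjective_pairing)
  then show ?thesis
    by (simp add: p tensor_map_class assms lin_maps_id)
qed

text \<open>On a generator the difference of the two sides is a relator of the second kind. This
  additivity in the map is what later splits a point into coordinates: the identity of the algebra
  is written as a sum of two linear maps.\<close>

lemma tensor_map_plus: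
  assumes "algebra K A" "algebra K B" "h \<in> lin_maps K A B" "g \<in> lin_maps K A B"
    "z \<in> carrier (tensor K V A)"
  shows "tensor_map K V B (\<lambda>a. h a \<oplus>\<^bsub>B\<^esub> g a) z =
    tensor_map K V B h z \<oplus>\<^bsub>tensor K V B\<^esub> tensor_map K V B g z"
proof -
  obtain p where p: "Poly_Mapping.keys p \<subseteq> carrier V \<times> carrier A" "z = tensor_class K V A p"
    using assms by (metis tensor_carrierE)
  have "frag_map (\<lambda>a. h a \<oplus>\<^bsub>B\<^esub> g a) p - (frag_map h p + frag_map g p) \<in> tensor_kernel K V B"
    using p(1)
  proof (induction p rule: frag_induction)
    case zero
    then show ?case by (simp add: tensor_kernel_ops[OF assms(2)])
  next
    case (one x)
    then obtain v a where x: "x = (v, a)" "v \<in> carrier V" "a \<in> carrier A"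
      by auto
    then have "frag_of (v, h a \<oplus>\<^bsub>B\<^esub> g a) - frag_of (v, h a) - frag_of (v, g a) \<in> tensor_relators K V B"
      unfolding tensor_relators_def
      using lin_mapsD(1)[OF assms(3)] lin_mapsD(1)[OF assms(4)] by blast
    then show ?case
      unfolding tensor_kernel_def by (auto simp: x diff_diff_add intro: generate.incl)
  next
    case (diff p q)
    from tensor_kernel_ops(4)[OF assms(2) diff] show ?case
      by (simp add: frag_extend_diff algebra_simps)
  qed
  then show ?thesis
    by (simp add: p tensor_map_class assms lin_maps_plus add_tensor tensor_class_eq_iff)
qed

lemma smult_tensor: "a \<odot>\<^bsub>tensor K V A\<^esub> z = tensor_map K V A (\<lambda>b. a \<otimes>\<^bsub>A\<^esub> b) z"
  by (simp add: tensor_def Let_def)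

end

section \<open>The identification of \<open>V\<close> with \<open>V \<otimes> K\<close>\<close>

lemma scal_alg_algebra:
  assumes "cring K"
  shows "algebra K (scal_alg K)"
proof -
  interpret K: cring K by fact
  have "ring (scal_alg K)"
  proof (rule ringI)
    show "abelian_group (scal_alg K)"
    proof (rule abelian_groupI)
      fix x assume "x \<in> carrier (scal_alg K)"
      then show "\<exists>y\<in>carrier (scal_alg K). y \<oplus>\<^bsub>scal_alg K\<^esub> x = \<zero>\<^bsub>scal_alg K\<^esub>"
        by (auto simp: scal_alg_def intro!: bexI[of _ "Scal (\<ominus>\<^bsub>K\<^esub> unScal x)"] K.l_neg)
    qed (auto simp: scal_alg_def K.a_ac)
    show "Group.monoid (scal_alg K)"
      by (rule monoidI) (auto simp: scal_alg_def K.m_assoc)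
  qed (auto simp: scal_alg_def K.l_distr K.r_distr)
  then interpret S: ring "scal_alg K" .
  have "cring (scal_alg K)"
    by unfold_locales (auto simp: scal_alg_def K.m_comm)
  then interpret S: cring "scal_alg K" .
  show ?thesis
    by (rule algebraI)
      (auto simp: S.abelian_group_axioms K.cring_axioms S.cring_axioms,
       auto simp: scal_alg_def K.l_distr K.r_distr K.m_assoc)
qed

context coeff_module
begin

lemma pure_tensor_closed:
  "v \<in> carrier V \<Longrightarrow> a \<in> carrier A \<Longrightarrow> pure_tensor K V A v a \<in> carrier (tensor K V A)"
  unfolding pure_tensor_def by (intro tensor_class_closed) (simp add: keys_frag_of)

text \<open>The multiplication \<open>v \<otimes> a \<mapsto> a v\<close> is a left inverse:
  extended to the free abelian group it kills the relators, hence the kernel, and it sends the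
  difference of the two generators to \<open>v - w\<close>.\<close>

lemma pure_tensor_scal_inj:
  assumes "v \<in> carrier V" "w \<in> carrier V"
    and "pure_tensor K V (scal_alg K) v (Scal \<one>\<^bsub>K\<^esub>) = pure_tensor K V (scal_alg K) w (Scal \<one>\<^bsub>K\<^esub>)"
  shows "v = w"
proof -
  let ?A = "scal_alg K" and ?G = "add_monoid V"
  let ?S = "carrier V \<times> carrier ?A"
  have alg: "algebra K ?A"
    by (rule scal_alg_algebra) (rule R.cring_axioms)
  have "(\<lambda>(v, a). unScal a \<odot>\<^bsub>V\<^esub> v) ` ?S \<subseteq> carrier ?G"
    by (auto simp: scal_alg_def)
  \<comment> \<open>The additive extension of \<open>(v, a) \<mapsto> a v\<close>, from the
    universal property of the free abelian group.\<close>
  then obtain f where f: "f \<in> hom (free_Abelian_group ?S) ?G"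
    and fr: "\<And>x. x \<in> ?S \<Longrightarrow> f (frag_of x) = (case x of (v, a) \<Rightarrow> unScal a \<odot>\<^bsub>V\<^esub> v)"
    by (rule comm_group.free_Abelian_group_universal[OF M.a_comm_group]) blast
  interpret f: group_hom "free_Abelian_group ?S" ?G f
    using f by (auto simp: group_hom_def group_hom_axioms_def M.a_group)
  have fdiff: "f (p - q) = f p \<ominus>\<^bsub>V\<^esub> f q" if "Poly_Mapping.keys p \<subseteq> ?S" "Poly_Mapping.keys q \<subseteq> ?S" for p q
  proof -
    have "f (p \<otimes>\<^bsub>free_Abelian_group ?S\<^esub> inv\<^bsub>free_Abelian_group ?S\<^esub> q) = f p \<oplus>\<^bsub>V\<^esub> (inv\<^bsub>?G\<^esub> f q)"
      using that f.hom_inv[of q] by (subst f.hom_mult) auto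
    then show ?thesis
      using that by (simp add: a_minus_def a_inv_def)
  qed
  have keys: "Poly_Mapping.keys (p - q) \<subseteq> ?S"
    if "Poly_Mapping.keys p \<subseteq> ?S" "Poly_Mapping.keys q \<subseteq> ?S" for p q
    using that keys_diff[of p q] by blast
  have fcl: "f p \<in> carrier V" if "Poly_Mapping.keys p \<subseteq> ?S" for p
    using f.hom_closed[of p] that by simp
  have cancel: "x \<oplus>\<^bsub>V\<^esub> y \<ominus>\<^bsub>V\<^esub> x \<ominus>\<^bsub>V\<^esub> y = \<zero>\<^bsub>V\<^esub>" if "x \<in> carrier V" "y \<in> carrier V" for x y
  proof -
    have "x \<oplus>\<^bsub>V\<^esub> y \<ominus>\<^bsub>V\<^esub> x \<ominus>\<^bsub>V\<^esub> y = (x \<oplus>\<^bsub>V\<^esub> y) \<oplus>\<^bsub>V\<^esub> (\<ominus>\<^bsub>V\<^esub> x \<oplus>\<^bsub>V\<^esub> \<ominus>\<^bsub>V\<^esub> y)"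
      unfolding M.minus_eq using that by (intro M.a_assoc) auto
    also have "\<ominus>\<^bsub>V\<^esub> x \<oplus>\<^bsub>V\<^esub> \<ominus>\<^bsub>V\<^esub> y = \<ominus>\<^bsub>V\<^esub> (x \<oplus>\<^bsub>V\<^esub> y)"
      using that by (rule M.minus_add[symmetric])
    also have "(x \<oplus>\<^bsub>V\<^esub> y) \<oplus>\<^bsub>V\<^esub> \<ominus>\<^bsub>V\<^esub> (x \<oplus>\<^bsub>V\<^esub> y) = \<zero>\<^bsub>V\<^esub>"
      using that by (intro M.r_neg) auto
    finally show ?thesis .
  qed
  have keyF: "Poly_Mapping.keys (frag_of x) \<subseteq> ?S" if "x \<in> ?S" for x
    using that by (simp add: keys_frag_of)
  have rel: "f r = \<zero>\<^bsub>V\<^esub>" if r: "r \<in> tensor_relators K V ?A" for r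
  proof -
    interpret A: algebra K ?A by (rule alg)
    have scal: "unScal a \<in> carrier K" if "a \<in> carrier ?A" for a
      using that by (auto simp: scal_alg_def)
    consider (1) x y a where "x \<in> carrier V" "y \<in> carrier V" "a \<in> carrier ?A"
        "r = frag_of (x \<oplus>\<^bsub>V\<^esub> y, a) - frag_of (x, a) - frag_of (y, a)"
      | (2) x a b where "x \<in> carrier V" "a \<in> carrier ?A" "b \<in> carrier ?A"
        "r = frag_of (x, a \<oplus>\<^bsub>?A\<^esub> b) - frag_of (x, a) - frag_of (x, b)"
      | (3) c x a where "c \<in> carrier K" "x \<in> carrier V" "a \<in> carrier ?A"
        "r = frag_of (c \<odot>\<^bsub>V\<^esub> x, a) - frag_of (x, c \<odot>\<^bsub>?A\<^esub> a)"
      using r unfolding tensor_relators_def Un_iff mem_Collect_eq by (elim disjE exE conjE) auto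
    then show ?thesis
    proof cases
      case 1
      then have k: "(x \<oplus>\<^bsub>V\<^esub> y, a) \<in> ?S" "(x, a) \<in> ?S" "(y, a) \<in> ?S"
        by auto
      have "f r = unScal a \<odot>\<^bsub>V\<^esub> (x \<oplus>\<^bsub>V\<^esub> y) \<ominus>\<^bsub>V\<^esub> unScal a \<odot>\<^bsub>V\<^esub> x \<ominus>\<^bsub>V\<^esub> unScal a \<odot>\<^bsub>V\<^esub> y"
        unfolding 1(4) fdiff[OF keys[OF keyF keyF] keyF, OF k] fdiff[OF keyF keyF, OF k(1,2)]
          fr[OF k(1)] fr[OF k(2)] fr[OF k(3)] by simp
      then show ?thesis
        using 1 scal by (simp add: smult_r_distr cancel)
    next
      case 2
      then have k: "(x, a \<oplus>\<^bsub>?A\<^esub> b) \<in> ?S" "(x, a) \<in> ?S" "(x, b) \<in> ?S"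
        by auto
      have "f r = unScal (a \<oplus>\<^bsub>?A\<^esub> b) \<odot>\<^bsub>V\<^esub> x \<ominus>\<^bsub>V\<^esub> unScal a \<odot>\<^bsub>V\<^esub> x \<ominus>\<^bsub>V\<^esub> unScal b \<odot>\<^bsub>V\<^esub> x"
        unfolding 2(4) fdiff[OF keys[OF keyF keyF] keyF, OF k] fdiff[OF keyF keyF, OF k(1,2)]
          fr[OF k(1)] fr[OF k(2)] fr[OF k(3)] by simp
      then show ?thesis
        using 2 scal by (simp add: scal_alg_def smult_l_distr cancel)
    next
      case 3
      then have k: "(c \<odot>\<^bsub>V\<^esub> x, a) \<in> ?S" "(x, c \<odot>\<^bsub>?A\<^esub> a) \<in> ?S"
        by auto
      have "f r = unScal a \<odot>\<^bsub>V\<^esub> (c \<odot>\<^bsub>V\<^esub> x) \<ominus>\<^bsub>V\<^esub> (c \<otimes>\<^bsub>K\<^esub> unScal a) \<odot>\<^bsub>V\<^esub> x"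
        unfolding 3(4) fdiff[OF keyF keyF, OF k] fr[OF k(1)] fr[OF k(2)] by (simp add: scal_alg_def)
      then show ?thesis
        using 3 scal by (simp add: smult_assoc1[symmetric] R.m_comm M.r_neg M.minus_eq)
    qed
  qed
  have ker: "f p = \<zero>\<^bsub>V\<^esub>" if "p \<in> tensor_kernel K V ?A" for p
  proof -
    \<comment> \<open>The bound on the keys is carried through the induction because
      \<open>f\<close> is known to be additive only on the carrier of the free group.\<close>
    have "Poly_Mapping.keys p \<subseteq> ?S \<and> f p = \<zero>\<^bsub>V\<^esub>"
      using that unfolding tensor_kernel_def
    proof induction
      case one
      then show ?case using f.hom_one by (simp add: tensor_free_def)
    next
      case (incl r)
      then have "r \<in> carrier (tensor_free V ?A)"
        using tensor_relators_closed[OF alg] by blast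
      then show ?case using rel[OF incl] by (simp add: tensor_free_def)
    next
      case (inv r)
      then have "r \<in> carrier (tensor_free V ?A)"
        using tensor_relators_closed[OF alg] by blast
      then have r: "Poly_Mapping.keys r \<subseteq> ?S"
        by (simp add: tensor_free_def)
      then show ?case
        using rel[OF inv] f.hom_inv[of r] monoid.inv_one[OF group.is_monoid[OF M.a_group]] by (simp add: tensor_free_def)
    next
      case (eng p q)
      then show ?case
        using Poly_Mapping.keys_add[of p q] f.hom_mult[of p q] by (auto simp: tensor_free_def)
    qed
    then show ?thesis ..
  qed
  have scal_one: "Scal \<one>\<^bsub>K\<^esub> \<in> carrier ?A"
    by (simp add: scal_alg_def)
  have "frag_of (v, Scal \<one>\<^bsub>K\<^esub>) - frag_of (w, Scal \<one>\<^bsub>K\<^esub>) \<in> tensor_kernel K V ?A"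
    using assms(3) by (simp add: pure_tensor_def tensor_class_eq_iff[OF alg])
  from ker[OF this] have "v \<ominus>\<^bsub>V\<^esub> w = \<zero>\<^bsub>V\<^esub>"
    using assms(1,2) scal_one by (subst (asm) fdiff) (auto simp: keys_frag_of fr)
  then show ?thesis
    using assms(1,2) M.minus_equality[of v "\<ominus>\<^bsub>V\<^esub> w"] M.minus_minus[of w]
    by (simp add: M.minus_eq)
qed

text \<open>Every generator \<open>v \<otimes> c\<close> equals \<open>c v \<otimes> 1\<close>, and
  differences of tensors of the form \<open>v \<otimes> 1\<close> are again of this form.\<close>

lemma pure_tensor_scal_surj:
  assumes "z \<in> carrier (tensor K V (scal_alg K))"
  obtains v where "v \<in> carrier V" "z = pure_tensor K V (scal_alg K) v (Scal \<one>\<^bsub>K\<^esub>)"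
proof -
  let ?A = "scal_alg K"
  have alg: "algebra K ?A"
    by (rule scal_alg_algebra) (rule R.cring_axioms)
  obtain p where p: "Poly_Mapping.keys p \<subseteq> carrier V \<times> carrier ?A" "z = tensor_class K V ?A p"
    using assms by (rule tensor_carrierE)
  have scal_one: "Scal \<one>\<^bsub>K\<^esub> \<in> carrier ?A"
    by (simp add: scal_alg_def)
  have "\<exists>v\<in>carrier V. p - frag_of (v, Scal \<one>\<^bsub>K\<^esub>) \<in> tensor_kernel K V ?A"
    using p(1)
  proof (induction p rule: frag_induction)
    case zero
    \<comment> \<open>Since \<open>0 + 0 = 0\<close> in \<open>V\<close>, this relator is minus the
      generator for \<open>(0, 1)\<close>, which is the difference required for the element
      0.\<close>
    have "frag_of (\<zero>\<^bsub>V\<^esub> \<oplus>\<^bsub>V\<^esub> \<zero>\<^bsub>V\<^esub>, Scal \<one>\<^bsub>K\<^esub>) - frag_of (\<zero>\<^bsub>V\<^esub>, Scal \<one>\<^bsub>K\<^esub>) - frag_of (\<zero>\<^bsub>V\<^esub>, Scal \<one>\<^bsub>K\<^esub>)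
        \<in> tensor_kernel K V ?A"
      unfolding tensor_kernel_def
      unfolding tensor_relators_def
      by (intro generate.incl UnI1) (use scal_one in blast)
    then show ?case
      by (intro bexI[of _ "\<zero>\<^bsub>V\<^esub>"]) auto
  next
    case (one x)
    then obtain v c where x: "x = (v, Scal c)" "v \<in> carrier V" "c \<in> carrier K"
      by (auto simp: scal_alg_def)
    from scal_one have "frag_of (c \<odot>\<^bsub>V\<^esub> v, Scal \<one>\<^bsub>K\<^esub>) - frag_of (v, c \<odot>\<^bsub>?A\<^esub> Scal \<one>\<^bsub>K\<^esub>) \<in> tensor_kernel K V ?A"
      unfolding tensor_kernel_def tensor_relators_def using x(2,3)
      by (intro generate.incl UnI2) blast
    from tensor_kernel_ops(3)[OF alg this] show ?case
      using x by (intro bexI[of _ "c \<odot>\<^bsub>V\<^esub> v"]) (auto simp: scal_alg_def)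
  next
    case (diff p q)
    then obtain v w where vw: "v \<in> carrier V" "w \<in> carrier V"
      "p - frag_of (v, Scal \<one>\<^bsub>K\<^esub>) \<in> tensor_kernel K V ?A"
      "q - frag_of (w, Scal \<one>\<^bsub>K\<^esub>) \<in> tensor_kernel K V ?A"
      by blast
    \<comment> \<open>Write \<open>[v]\<close> for the generator of \<open>(v, 1)\<close>. Then
      \<open>p - q - [v - w]\<close> is \<open>(p - [v]) - (q - [w])\<close> plus this relator
      \<open>[v] - [v - w] - [w]\<close>.\<close>
    have "frag_of ((v \<ominus>\<^bsub>V\<^esub> w) \<oplus>\<^bsub>V\<^esub> w, Scal \<one>\<^bsub>K\<^esub>) - frag_of (v \<ominus>\<^bsub>V\<^esub> w, Scal \<one>\<^bsub>K\<^esub>) - frag_of (w, Scal \<one>\<^bsub>K\<^esub>)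
        \<in> tensor_kernel K V ?A"
      unfolding tensor_kernel_def tensor_relators_def using vw(1,2)
      by (intro generate.incl UnI1) (use scal_one in blast)
    moreover have "(v \<ominus>\<^bsub>V\<^esub> w) \<oplus>\<^bsub>V\<^esub> w = v"
      using vw(1,2) by (simp add: M.minus_eq M.a_assoc M.l_neg)
    ultimately have "frag_of (v, Scal \<one>\<^bsub>K\<^esub>) - frag_of (v \<ominus>\<^bsub>V\<^esub> w, Scal \<one>\<^bsub>K\<^esub>) - frag_of (w, Scal \<one>\<^bsub>K\<^esub>)
        \<in> tensor_kernel K V ?A"
      by simp
    from tensor_kernel_ops(2)[OF alg tensor_kernel_ops(4)[OF alg vw(3,4)] this]
    show ?case
      using vw(1,2) by (intro bexI[of _ "v \<ominus>\<^bsub>V\<^esub> w"]) (auto simp: algebra_simps)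
  qed
  then show ?thesis
    using that p(2) by (auto simp: pure_tensor_def tensor_class_eq_iff[OF alg])
qed

end


section \<open>Points of a shape as a functor of linear maps\<close>

abbreviation pts :: "'k ring \<Rightarrow> ('k, 'v) module \<Rightarrow> 'k alg \<Rightarrow> shape \<Rightarrow> (('v, 'k) tns, 'k uelem) pt set"
  where "pts K V A S \<equiv> pt_carrier A (tensor K V A) S"

abbreviation padd :: "'k ring \<Rightarrow> ('k, 'v) module \<Rightarrow> 'k alg \<Rightarrow>
    (('v, 'k) tns, 'k uelem) pt \<Rightarrow> (('v, 'k) tns, 'k uelem) pt \<Rightarrow> (('v, 'k) tns, 'k uelem) pt"
  where "padd K V A \<equiv> pt_add A (tensor K V A)"

abbreviation psmult :: "'k ring \<Rightarrow> ('k, 'v) module \<Rightarrow> 'k alg \<Rightarrow>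
    'k uelem \<Rightarrow> (('v, 'k) tns, 'k uelem) pt \<Rightarrow> (('v, 'k) tns, 'k uelem) pt"
  where "psmult K V A \<equiv> pt_smult A (tensor K V A)"

abbreviation pzero :: "'k ring \<Rightarrow> ('k, 'v) module \<Rightarrow> 'k alg \<Rightarrow> shape \<Rightarrow> (('v, 'k) tns, 'k uelem) pt"
  where "pzero K V A \<equiv> pt_zero A (tensor K V A)"

lemma pt_map_simps [simp]:
  "pt_map K V B h (Vec z) = Vec (tensor_map K V B h z)"
  "pt_map K V B h (Xt x t) = Xt (pt_map K V B h x) (h t)"
  "pt_map K V B h (Xvt x v t) = Xvt (pt_map K V B h x) (pt_map K V B h v) (h t)"
  "pt_map K V B h (Xst x s t) = Xst (pt_map K V B h x) (h s) (h t)"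
  "pt_map K V B h (Xvst x v s t) = Xvst (pt_map K V B h x) (pt_map K V B h v) (h s) (h t)"
  "pt_map K V B h (Duo x y) = Duo (pt_map K V B h x) (pt_map K V B h y)"
  by (simp_all add: pt_map_def)

context coeff_module
begin

text \<open>In each entry of a point, scalar multiplication is the image of one linear map,
  multiplication by \<open>a\<close>. The module axioms for points thus follow from functoriality of
  \<open>pt_map\<close>.\<close>

lemma pt_smult_eq_pt_map: "psmult K V A a p = pt_map K V A (\<lambda>b. a \<otimes>\<^bsub>A\<^esub> b) p"
  by (induction p) (simp_all add: smult_tensor)

lemma pt_map_closed:
  assumes "algebra K A" "algebra K B" "h \<in> lin_maps K A B" "p \<in> pts K V A S"
  shows "pt_map K V B h p \<in> pts K V B S"
  using assms(4)
  by (induction S arbitrary: p)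
    (auto simp: tensor_map_closed[OF assms(1-3)] lin_mapsD[OF assms(3)])

lemma pt_map_add:
  assumes "algebra K A" "algebra K B" "h \<in> lin_maps K A B" "p \<in> pts K V A S" "q \<in> pts K V A S"
  shows "pt_map K V B h (padd K V A p q) = padd K V B (pt_map K V B h p) (pt_map K V B h q)"
  using assms(4,5)
  by (induction S arbitrary: p q)
    (auto simp: tensor_map_add[OF assms(1-3)] lin_mapsD[OF assms(3)])

lemma pt_map_comp:
  assumes "algebra K A" "algebra K B" "algebra K C" "h \<in> lin_maps K A B" "g \<in> lin_maps K B C"
    "p \<in> pts K V A S"
  shows "pt_map K V C g (pt_map K V B h p) = pt_map K V C (\<lambda>a. g (h a)) p"
  using assms(6) by (induction S arbitrary: p) (auto simp: tensor_map_comp[OF assms(1-5)])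

lemma pt_map_cong:
  assumes "algebra K A" "algebra K B" "h \<in> lin_maps K A B"
    "p \<in> pts K V A S" "\<And>a. a \<in> carrier A \<Longrightarrow> h a = h' a"
  shows "pt_map K V B h p = pt_map K V B h' p"
  using assms(4)
  by (induction S arbitrary: p) (auto simp: tensor_map_cong[OF assms(1-3) _ assms(5)] assms(5))

lemma pt_map_id:
  assumes "algebra K A" "p \<in> pts K V A S"
  shows "pt_map K V A (\<lambda>a. a) p = p"
  using assms(2) by (induction S arbitrary: p) (auto simp: tensor_map_id[OF assms(1)])

lemma pt_map_plus:
  assumes "algebra K A" "algebra K B" "h \<in> lin_maps K A B" "g \<in> lin_maps K A B" "p \<in> pts K V A S"
  shows "pt_map K V B (\<lambda>a. h a \<oplus>\<^bsub>B\<^esub> g a) p = padd K V B (pt_map K V B h p) (pt_map K V B g p)"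
  using assms(5) by (induction S arbitrary: p) (auto simp: tensor_map_plus[OF assms(1-4)])

lemma pt_zero_closed:
  assumes "algebra K A"
  shows "pzero K V A S \<in> pts K V A S"
proof -
  interpret A: algebra K A by fact
  interpret T: abelian_group "tensor K V A" by (rule tensor_abelian_group) fact
  show ?thesis by (induction S) auto
qed

lemma pt_add_closed:
  assumes "algebra K A" "p \<in> pts K V A S" "q \<in> pts K V A S"
  shows "padd K V A p q \<in> pts K V A S"
proof -
  interpret A: algebra K A by fact
  interpret T: abelian_group "tensor K V A" by (rule tensor_abelian_group) fact
  show ?thesis using assms(2,3) by (induction S arbitrary: p q) auto
qed

lemma pt_add_assoc:
  assumes "algebra K A" "p \<in> pts K V A S" "q \<in> pts K V A S" "r \<in> pts K V A S"
  shows "padd K V A (padd K V A p q) r = padd K V A p (padd K V A q r)"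
proof -
  interpret A: algebra K A by fact
  interpret T: abelian_group "tensor K V A" by (rule tensor_abelian_group) fact
  show ?thesis using assms(2-)
    by (induction S arbitrary: p q r) (auto simp: A.a_assoc T.a_assoc)
qed

lemma pt_add_zero:
  assumes "algebra K A" "p \<in> pts K V A S"
  shows "padd K V A (pzero K V A S) p = p" "padd K V A p (pzero K V A S) = p"
proof -
  interpret A: algebra K A by fact
  interpret T: abelian_group "tensor K V A" by (rule tensor_abelian_group) fact
  show "padd K V A (pzero K V A S) p = p"
    using assms(2) by (induction S arbitrary: p) auto
  show "padd K V A p (pzero K V A S) = p"
    using assms(2) by (induction S arbitrary: p) auto
qed

lemma pt_add_cancel:
  assumes "algebra K A" "p \<in> pts K V A S" "q \<in> pts K V A S" "r \<in> pts K V A S"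
  shows "padd K V A p q = padd K V A p r \<longleftrightarrow> q = r"
proof -
  interpret A: algebra K A by fact
  interpret T: abelian_group "tensor K V A" by (rule tensor_abelian_group) fact
  show ?thesis using assms(2-)
    by (induction S arbitrary: p q r) auto
qed

text \<open>The zero map is the sum of two copies of itself, so its image \<open>?q\<close>
  satisfies \<open>?q + ?q = ?q + 0\<close>, and \<open>?q\<close> cancels.\<close>

lemma pt_map_zero:
  assumes "algebra K A" "algebra K B" "p \<in> pts K V A S"
  shows "pt_map K V B (\<lambda>a. \<zero>\<^bsub>B\<^esub>) p = pzero K V B S"
proof -
  interpret B: algebra K B by fact
  let ?q = "pt_map K V B (\<lambda>a. \<zero>\<^bsub>B\<^esub>) p"
  note z = lin_maps_zero[OF assms(2)]
  have q: "?q \<in> pts K V B S"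
    using assms z by (intro pt_map_closed)
  have "padd K V B ?q ?q = pt_map K V B (\<lambda>a. \<zero>\<^bsub>B\<^esub> \<oplus>\<^bsub>B\<^esub> \<zero>\<^bsub>B\<^esub>) p"
    using assms z by (intro pt_map_plus[symmetric])
  also have "\<dots> = padd K V B ?q (pzero K V B S)"
    using q assms by (simp add: pt_add_zero)
  finally show ?thesis
    using q assms pt_zero_closed by (simp add: pt_add_cancel)
qed

lemma pt_map_pt_zero:
  assumes "algebra K A" "algebra K B" "h \<in> lin_maps K A B"
  shows "pt_map K V B h (pzero K V A S) = pzero K V B S"
proof -
  let ?z = "pzero K V A S"
  have z: "?z \<in> pts K V A S" using assms by (intro pt_zero_closed)
  then have q: "pt_map K V B h ?z \<in> pts K V B S" using assms by (intro pt_map_closed)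
  have "padd K V B (pt_map K V B h ?z) (pt_map K V B h ?z) = pt_map K V B h (padd K V A ?z ?z)"
    using assms z by (intro pt_map_add[symmetric])
  also have "\<dots> = padd K V B (pt_map K V B h ?z) (pzero K V B S)"
    using q z assms by (simp add: pt_add_zero)
  finally show ?thesis
    using q assms pt_zero_closed by (simp add: pt_add_cancel)
qed

lemma pt_smult_closed:
  assumes "algebra K A" "a \<in> carrier A" "p \<in> pts K V A S"
  shows "psmult K V A a p \<in> pts K V A S"
  unfolding pt_smult_eq_pt_map
  by (rule pt_map_closed[OF assms(1,1) lin_maps_mult[OF assms(1,2)] assms(3)])

lemma pt_smult_add:
  assumes "algebra K A" "a \<in> carrier A" "p \<in> pts K V A S" "q \<in> pts K V A S"
  shows "psmult K V A a (padd K V A p q) = padd K V A (psmult K V A a p) (psmult K V A a q)"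
  unfolding pt_smult_eq_pt_map
  by (rule pt_map_add[OF assms(1,1) lin_maps_mult[OF assms(1,2)] assms(3,4)])

lemma pt_smult_smult:
  assumes "algebra K A" "a \<in> carrier A" "b \<in> carrier A" "p \<in> pts K V A S"
  shows "psmult K V A a (psmult K V A b p) = psmult K V A (a \<otimes>\<^bsub>A\<^esub> b) p"
proof -
  interpret A: algebra K A by fact
  have "psmult K V A a (psmult K V A b p) = pt_map K V A (\<lambda>c. a \<otimes>\<^bsub>A\<^esub> (b \<otimes>\<^bsub>A\<^esub> c)) p"
    unfolding pt_smult_eq_pt_map
    by (rule pt_map_comp[OF assms(1,1,1) lin_maps_mult[OF assms(1,3)]
          lin_maps_mult[OF assms(1,2)] assms(4)])
  also have "\<dots> = psmult K V A (a \<otimes>\<^bsub>A\<^esub> b) p"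
    unfolding pt_smult_eq_pt_map
    using assms lin_maps_comp[OF lin_maps_mult[OF assms(1,3)] lin_maps_mult[OF assms(1,2)]]
    by (intro pt_map_cong[where S = S and A = A]) (auto simp: A.m_assoc)
  finally show ?thesis .
qed

lemma pt_smult_one:
  assumes "algebra K A" "p \<in> pts K V A S"
  shows "psmult K V A \<one>\<^bsub>A\<^esub> p = p"
proof -
  interpret A: algebra K A by fact
  have "psmult K V A \<one>\<^bsub>A\<^esub> p = pt_map K V A (\<lambda>a. a) p"
    unfolding pt_smult_eq_pt_map using assms lin_maps_mult[OF assms(1) A.one_closed]
    by (intro pt_map_cong[where S = S and A = A]) auto
  then show ?thesis
    using assms by (simp add: pt_map_id)
qed

lemma pt_smult_zero:
  assumes "algebra K A" "a \<in> carrier A"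
  shows "psmult K V A a (pzero K V A S) = pzero K V A S"
  unfolding pt_smult_eq_pt_map by (rule pt_map_pt_zero[OF assms(1,1) lin_maps_mult[OF assms]])

text \<open>Both sides come from linear maps on \<open>A\<close>, namely
  \<open>b \<mapsto> h (a b)\<close> and \<open>b \<mapsto> h a \<cdot> h b\<close>;
  multiplicativity of \<open>h\<close> identifies them.\<close>

lemma pt_map_smult:
  assumes "algebra K A" "algebra K B" "h \<in> alg_hom A B K" "a \<in> carrier A" "p \<in> pts K V A S"
  shows "pt_map K V B h (psmult K V A a p) = psmult K V B (h a) (pt_map K V B h p)"
proof -
  note l = alg_hom_lin_maps[OF assms(3)]
  have ha: "h a \<in> carrier B" using l assms(4) by (rule lin_mapsD)
  have "pt_map K V B h (psmult K V A a p) = pt_map K V B (\<lambda>b. h (a \<otimes>\<^bsub>A\<^esub> b)) p"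
    unfolding pt_smult_eq_pt_map
    by (rule pt_map_comp[OF assms(1,1,2) lin_maps_mult[OF assms(1,4)] l assms(5)])
  also have "\<dots> = pt_map K V B (\<lambda>b. h a \<otimes>\<^bsub>B\<^esub> h b) p"
    using assms lin_maps_comp[OF lin_maps_mult[OF assms(1,4)] l]
    by (intro pt_map_cong[where S = S and A = A]) (auto simp: alg_hom_def ring_hom_def)
  also have "\<dots> = psmult K V B (h a) (pt_map K V B h p)"
    unfolding pt_smult_eq_pt_map
    by (rule pt_map_comp[OF assms(1,2,2) l lin_maps_mult[OF assms(2) ha] assms(5), symmetric])
  finally show ?thesis .
qed

end

section \<open>The algebras \<open>A[T]\<close> and \<open>A[T]/(T\<^sup>2 - tT)\<close>\<close>

lemma alg_homI:
  assumes "\<And>a. a \<in> carrier A \<Longrightarrow> h a \<in> carrier B"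
    and "\<And>a b. a \<in> carrier A \<Longrightarrow> b \<in> carrier A \<Longrightarrow> h (a \<oplus>\<^bsub>A\<^esub> b) = h a \<oplus>\<^bsub>B\<^esub> h b"
    and "\<And>a b. a \<in> carrier A \<Longrightarrow> b \<in> carrier A \<Longrightarrow> h (a \<otimes>\<^bsub>A\<^esub> b) = h a \<otimes>\<^bsub>B\<^esub> h b"
    and "h \<one>\<^bsub>A\<^esub> = \<one>\<^bsub>B\<^esub>"
    and "\<And>c a. c \<in> carrier K \<Longrightarrow> a \<in> carrier A \<Longrightarrow> h (c \<odot>\<^bsub>A\<^esub> a) = c \<odot>\<^bsub>B\<^esub> h a"
  shows "h \<in> alg_hom A B K"
  using assms by (auto simp: alg_hom_def ring_hom_def)

lemma alg_homD:
  assumes "h \<in> alg_hom A B K"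
  shows "a \<in> carrier A \<Longrightarrow> h a \<in> carrier B"
    and "a \<in> carrier A \<Longrightarrow> b \<in> carrier A \<Longrightarrow> h (a \<oplus>\<^bsub>A\<^esub> b) = h a \<oplus>\<^bsub>B\<^esub> h b"
    and "a \<in> carrier A \<Longrightarrow> b \<in> carrier A \<Longrightarrow> h (a \<otimes>\<^bsub>A\<^esub> b) = h a \<otimes>\<^bsub>B\<^esub> h b"
    and "h \<one>\<^bsub>A\<^esub> = \<one>\<^bsub>B\<^esub>"
    and "c \<in> carrier K \<Longrightarrow> a \<in> carrier A \<Longrightarrow> h (c \<odot>\<^bsub>A\<^esub> a) = c \<odot>\<^bsub>B\<^esub> h a"
  using assms by (auto simp: alg_hom_def ring_hom_def)

text \<open>\<open>Poly\<close> serves as a container here: a pair is stored in \<open>uelem\<close>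
  as a function read only at 0 and 1. The value \<open>b\<close> repeats at all later indices, so
  this is in general not a polynomial.\<close>

definition dpair :: "'k uelem \<Rightarrow> 'k uelem \<Rightarrow> 'k uelem" where
  "dpair a b = Poly (\<lambda>n. if n = 0 then a else b)"

definition dfst :: "'k uelem \<Rightarrow> 'k uelem" where
  "dfst z = unPoly z 0"

definition dsnd :: "'k uelem \<Rightarrow> 'k uelem" where
  "dsnd z = unPoly z 1"

lemma dpair_simps [simp]: "dfst (dpair a b) = a" "dsnd (dpair a b) = b"
  by (simp_all add: dpair_def dfst_def dsnd_def)

lemma dpair_eq_iff [simp]: "dpair a b = dpair c d \<longleftrightarrow> a = c \<and> b = d"
  by (metis dpair_simps)

text \<open>\<^term>\<open>dpair a b\<close> is the class of \<open>a + T b\<close> in \<open>A[T]/(T\<^sup>2 - tT)\<close>.\<close>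

definition dual :: "'k alg \<Rightarrow> 'k uelem \<Rightarrow> 'k alg" where
  "dual A t = \<lparr>carrier = {dpair a b | a b. a \<in> carrier A \<and> b \<in> carrier A},
     mult = (\<lambda>y z. dpair (dfst y \<otimes>\<^bsub>A\<^esub> dfst z)
       (dfst y \<otimes>\<^bsub>A\<^esub> dsnd z \<oplus>\<^bsub>A\<^esub> dsnd y \<otimes>\<^bsub>A\<^esub> dfst z \<oplus>\<^bsub>A\<^esub> t \<otimes>\<^bsub>A\<^esub> (dsnd y \<otimes>\<^bsub>A\<^esub> dsnd z))),
     one = dpair \<one>\<^bsub>A\<^esub> \<zero>\<^bsub>A\<^esub>, ring.zero = dpair \<zero>\<^bsub>A\<^esub> \<zero>\<^bsub>A\<^esub>,
     ring.add = (\<lambda>y z. dpair (dfst y \<oplus>\<^bsub>A\<^esub> dfst z) (dsnd y \<oplus>\<^bsub>A\<^esub> dsnd z)),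
     module.smult = (\<lambda>c z. dpair (c \<odot>\<^bsub>A\<^esub> dfst z) (c \<odot>\<^bsub>A\<^esub> dsnd z))\<rparr>"

lemma dual_simps:
  "carrier (dual A t) = {dpair a b | a b. a \<in> carrier A \<and> b \<in> carrier A}"
  "dpair a b \<otimes>\<^bsub>dual A t\<^esub> dpair c d = dpair (a \<otimes>\<^bsub>A\<^esub> c) (a \<otimes>\<^bsub>A\<^esub> d \<oplus>\<^bsub>A\<^esub> b \<otimes>\<^bsub>A\<^esub> c \<oplus>\<^bsub>A\<^esub> t \<otimes>\<^bsub>A\<^esub> (b \<otimes>\<^bsub>A\<^esub> d))"
  "\<one>\<^bsub>dual A t\<^esub> = dpair \<one>\<^bsub>A\<^esub> \<zero>\<^bsub>A\<^esub>"
  "\<zero>\<^bsub>dual A t\<^esub> = dpair \<zero>\<^bsub>A\<^esub> \<zero>\<^bsub>A\<^esub>"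
  "dpair a b \<oplus>\<^bsub>dual A t\<^esub> dpair c d = dpair (a \<oplus>\<^bsub>A\<^esub> c) (b \<oplus>\<^bsub>A\<^esub> d)"
  "r \<odot>\<^bsub>dual A t\<^esub> dpair a b = dpair (r \<odot>\<^bsub>A\<^esub> a) (r \<odot>\<^bsub>A\<^esub> b)"
  by (simp_all add: dual_def)

text \<open>Division of \<open>p - p(0)\<close> by \<open>T\<close>. This is how \<open>F\<close> is
  recovered from \<open>y + T F\<close>.\<close>

definition pshift :: "'k uelem \<Rightarrow> 'k uelem" where
  "pshift p = Poly (\<lambda>n. unPoly p (Suc n))"

text \<open>The reduction of \<open>A[T]\<close> modulo \<open>T^2 - tT\<close>: with
  \<open>p = p(0) + T q\<close> one has \<open>T q(T) = T q(t)\<close> in the quotient, because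
  there \<open>T T = t T\<close>.\<close>

definition to_dual :: "'k alg \<Rightarrow> 'k uelem \<Rightarrow> 'k uelem \<Rightarrow> 'k uelem" where
  "to_dual A t p = dpair (poly_eval A \<zero>\<^bsub>A\<^esub> p) (poly_eval A t (pshift p))"

locale kalgebra = algebra K A for K :: "'k ring" and A :: "'k alg"
begin

lemma kalg: "algebra K A"
  by (rule algebra_axioms)

lemma smult_mult:
  assumes "c \<in> carrier K" "x \<in> carrier A" "y \<in> carrier A"
  shows "x \<otimes>\<^bsub>A\<^esub> (c \<odot>\<^bsub>A\<^esub> y) = c \<odot>\<^bsub>A\<^esub> (x \<otimes>\<^bsub>A\<^esub> y)"
  using lin_mapsD(3)[OF lin_maps_mult[OF kalg assms(2)] assms(1,3)] .

lemma dual_algebra: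
  assumes t: "t \<in> carrier A"
  shows "algebra K (dual A t)"
proof -
  have ab: "abelian_group (dual A t)"
  proof (rule abelian_groupI)
    fix z assume "z \<in> carrier (dual A t)"
    then show "\<exists>y\<in>carrier (dual A t). y \<oplus>\<^bsub>dual A t\<^esub> z = \<zero>\<^bsub>dual A t\<^esub>"
      by (intro bexI[of _ "dpair (\<ominus>\<^bsub>A\<^esub> dfst z) (\<ominus>\<^bsub>A\<^esub> dsnd z)"]) (auto simp: dual_simps M.l_neg)
  qed (auto simp: dual_simps M.a_ac)
  have mon: "Group.monoid (dual A t)"
  proof (rule monoidI)
    fix x y z assume "x \<in> carrier (dual A t)" "y \<in> carrier (dual A t)" "z \<in> carrier (dual A t)"
    then obtain a b c d e f where abc: "x = dpair a b" "y = dpair c d" "z = dpair e f"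
      "a \<in> carrier A" "b \<in> carrier A" "c \<in> carrier A" "d \<in> carrier A" "e \<in> carrier A" "f \<in> carrier A"
      by (auto simp: dual_simps)
    show "x \<otimes>\<^bsub>dual A t\<^esub> y \<otimes>\<^bsub>dual A t\<^esub> z = x \<otimes>\<^bsub>dual A t\<^esub> (y \<otimes>\<^bsub>dual A t\<^esub> z)"
      using abc(4-) t unfolding abc(1-3)
      by (simp add: dual_simps l_distr r_distr M.a_ac m_ac)
  qed (use t in \<open>auto simp: dual_simps\<close>)
  have "comm_monoid (dual A t)"
    by (rule Group.monoid.monoid_comm_monoidI[OF mon])
      (use t in \<open>auto simp: dual_simps m_ac M.a_ac\<close>)
  then have cr: "cring (dual A t)"
    by (rule cringI[OF ab]) (use t in \<open>auto simp: dual_simps l_distr r_distr M.a_ac\<close>)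
  show ?thesis
  proof (rule algebraI[OF R.cring_axioms cr])
    fix c x y assume "c \<in> carrier K" "x \<in> carrier (dual A t)" "y \<in> carrier (dual A t)"
    then show "(c \<odot>\<^bsub>dual A t\<^esub> x) \<otimes>\<^bsub>dual A t\<^esub> y = c \<odot>\<^bsub>dual A t\<^esub> (x \<otimes>\<^bsub>dual A t\<^esub> y)"
      using t by (auto simp: dual_simps smult_assoc2 smult_r_distr smult_mult)
  qed (auto simp: dual_simps smult_l_distr smult_r_distr smult_assoc1)
qed

text \<open>The polynomial \<open>T^2 - tT\<close> has the roots 0 and \<open>t\<close> in
  \<open>A\<close>. Evaluation there gives the algebra maps \<open>dfst\<close> and
  \<open>dfst + t dsnd\<close>, which will yield \<open>x\<close> and \<open>x + tv\<close> from the
  point \<open>x + Tv\<close>. The inclusion of \<open>T A\<close> and the coefficient of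
  \<open>T\<close> are only linear.\<close>

lemma dual_maps:
  assumes t: "t \<in> carrier A"
  shows "(\<lambda>a. dpair a \<zero>\<^bsub>A\<^esub>) \<in> alg_hom A (dual A t) K"
    and "dpair \<zero>\<^bsub>A\<^esub> \<in> lin_maps K A (dual A t)"
    and "dfst \<in> alg_hom (dual A t) A K"
    and "dsnd \<in> lin_maps K (dual A t) A"
    and "(\<lambda>z. dfst z \<oplus>\<^bsub>A\<^esub> t \<otimes>\<^bsub>A\<^esub> dsnd z) \<in> alg_hom (dual A t) A K"
proof -
  show "(\<lambda>a. dpair a \<zero>\<^bsub>A\<^esub>) \<in> alg_hom A (dual A t) K"
    by (rule alg_homI) (use t in \<open>auto simp: dual_simps\<close>)
  show "dpair \<zero>\<^bsub>A\<^esub> \<in> lin_maps K A (dual A t)"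
    by (rule lin_mapsI) (auto simp: dual_simps)
  show "dfst \<in> alg_hom (dual A t) A K"
    by (rule alg_homI) (auto simp: dual_simps)
  show "dsnd \<in> lin_maps K (dual A t) A"
    by (rule lin_mapsI) (auto simp: dual_simps)
  show "(\<lambda>z. dfst z \<oplus>\<^bsub>A\<^esub> t \<otimes>\<^bsub>A\<^esub> dsnd z) \<in> alg_hom (dual A t) A K"
    by (rule alg_homI)
      (use t in \<open>auto simp: dual_simps l_distr r_distr M.a_ac m_ac smult_r_distr smult_mult\<close>)
qed

lemma dual_map_hom:
  assumes t: "t \<in> carrier A" and B: "algebra K B" and h: "h \<in> alg_hom A B K"
  shows "(\<lambda>z. dpair (h (dfst z)) (h (dsnd z))) \<in> alg_hom (dual A t) (dual B (h t)) K"
proof -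
  interpret B: algebra K B by fact
  \<comment> \<open>The definition \<open>alg_hom\<close> does not mention zero; \<open>h\<close>
    preserves it since zero is its own multiple by the scalar zero of \<open>K\<close>.\<close>
  have z: "h \<zero>\<^bsub>A\<^esub> = \<zero>\<^bsub>B\<^esub>"
    using alg_homD(5)[OF h, of "\<zero>\<^bsub>K\<^esub>" "\<zero>\<^bsub>A\<^esub>"] alg_homD(1)[OF h] by simp
  show ?thesis
    by (rule alg_homI) (use t alg_homD[OF h] z in \<open>auto simp: dual_simps\<close>)
qed

section \<open>The polynomial algebra \<open>A[T]\<close> and its reduction modulo
  \<open>T^2 - tT\<close>\<close>

interpretation U: UP_cring A "UP A"
  by (rule UP_cring.intro) (rule M_cring)

text \<open>Not an interpretation: \<open>hom_mult\<close> and \<open>hom_add\<close> for the identity would make the simplifier loop.\<close>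

lemma poly_univ_prop: "UP_pre_univ_prop A A (\<lambda>a. a)"
  by (rule UP_pre_univ_propI) (auto simp: M_cring ring_hom_def)

lemmas eval_hom = UP_pre_univ_prop.eval_ring_hom[OF poly_univ_prop]
  and eval_on_const = UP_pre_univ_prop.eval_const[OF poly_univ_prop]
  and eval_on_var = UP_pre_univ_prop.eval_monom1[OF poly_univ_prop]

lemma coeff_eq: "p \<in> carrier (UP A) \<Longrightarrow> coeff (UP A) p n = p n"
  by (simp add: UP_def)

lemma poly_eqI:
  assumes "p \<in> carrier (UP A)" "q \<in> carrier (UP A)" "\<And>n. coeff (UP A) p n = coeff (UP A) q n"
  shows "p = q"
  using assms by (intro U.up_eqI)

lemma poly_carrier: "carrier (poly_alg A) = Poly ` carrier (UP A)"
  by (simp add: poly_alg_def)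

lemma poly_ops:
  "Poly p \<otimes>\<^bsub>poly_alg A\<^esub> Poly q = Poly (p \<otimes>\<^bsub>UP A\<^esub> q)"
  "Poly p \<oplus>\<^bsub>poly_alg A\<^esub> Poly q = Poly (p \<oplus>\<^bsub>UP A\<^esub> q)"
  "\<one>\<^bsub>poly_alg A\<^esub> = Poly \<one>\<^bsub>UP A\<^esub>"
  "\<zero>\<^bsub>poly_alg A\<^esub> = Poly \<zero>\<^bsub>UP A\<^esub>"
  by (simp_all add: poly_alg_def)

text \<open>A scalar of \<open>K\<close> acts on \<open>A[T]\<close> as the scalar
  \<open>c 1\<close> of \<open>A\<close>. In this form the library facts on \<open>UP A\<close>, a
  module over \<open>A\<close>, become applicable.\<close>

lemma poly_smult:
  assumes "c \<in> carrier K" "p \<in> carrier (UP A)"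
  shows "c \<odot>\<^bsub>poly_alg A\<^esub> Poly p = Poly ((c \<odot>\<^bsub>A\<^esub> \<one>\<^bsub>A\<^esub>) \<odot>\<^bsub>UP A\<^esub> p)"
proof -
  have "c \<odot>\<^bsub>A\<^esub> p n = (c \<odot>\<^bsub>A\<^esub> \<one>\<^bsub>A\<^esub>) \<otimes>\<^bsub>A\<^esub> p n" for n
    using assms U.coeff_closed[of p n] by (simp add: coeff_eq smult_assoc2)
  then show ?thesis
    using assms U.coeff_smult[of "c \<odot>\<^bsub>A\<^esub> \<one>\<^bsub>A\<^esub>" p]
    by (simp add: poly_alg_def coeff_eq fun_eq_iff)
qed

lemma poly_algebra: "algebra K (poly_alg A)"
proof -
  have ab: "abelian_group (poly_alg A)"
  proof (rule abelian_groupI)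
    fix z assume "z \<in> carrier (poly_alg A)"
    then obtain p where p: "p \<in> carrier (UP A)" "z = Poly p"
      by (auto simp: poly_carrier)
    then show "\<exists>y\<in>carrier (poly_alg A). y \<oplus>\<^bsub>poly_alg A\<^esub> z = \<zero>\<^bsub>poly_alg A\<^esub>"
      by (intro bexI[of _ "Poly (\<ominus>\<^bsub>UP A\<^esub> p)"]) (auto simp: poly_ops poly_carrier U.P.l_neg)
  qed (auto simp: poly_ops poly_carrier U.P.a_ac)
  have mon: "Group.monoid (poly_alg A)"
    by (rule monoidI) (auto simp: poly_ops poly_carrier U.P.m_assoc)
  have "comm_monoid (poly_alg A)"
    by (rule Group.monoid.monoid_comm_monoidI[OF mon]) (auto simp: poly_ops poly_carrier U.P.m_comm)
  then have cr: "cring (poly_alg A)"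
    by (rule cringI[OF ab]) (auto simp: poly_ops poly_carrier U.P.l_distr)
  show ?thesis
  proof (rule algebraI[OF R.cring_axioms cr])
    fix c d x assume "c \<in> carrier K" "d \<in> carrier K" "x \<in> carrier (poly_alg A)"
    then show "(c \<oplus>\<^bsub>K\<^esub> d) \<odot>\<^bsub>poly_alg A\<^esub> x = (c \<odot>\<^bsub>poly_alg A\<^esub> x) \<oplus>\<^bsub>poly_alg A\<^esub> (d \<odot>\<^bsub>poly_alg A\<^esub> x)"
      by (auto simp: poly_carrier poly_smult poly_ops smult_l_distr U.smult_l_distr)
  next
    fix c d x assume "c \<in> carrier K" "d \<in> carrier K" "x \<in> carrier (poly_alg A)"
    moreover from this have "(c \<otimes>\<^bsub>K\<^esub> d) \<odot>\<^bsub>A\<^esub> \<one>\<^bsub>A\<^esub> = (c \<odot>\<^bsub>A\<^esub> \<one>\<^bsub>A\<^esub>) \<otimes>\<^bsub>A\<^esub> (d \<odot>\<^bsub>A\<^esub> \<one>\<^bsub>A\<^esub>)"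
      by (simp add: smult_assoc1 smult_assoc2)
    ultimately show "(c \<otimes>\<^bsub>K\<^esub> d) \<odot>\<^bsub>poly_alg A\<^esub> x = c \<odot>\<^bsub>poly_alg A\<^esub> (d \<odot>\<^bsub>poly_alg A\<^esub> x)"
      by (auto simp: poly_carrier poly_smult U.smult_assoc1)
  qed (auto simp: poly_carrier poly_smult poly_ops U.smult_r_distr U.smult_assoc2)
qed

lemma poly_const_hom: "poly_const A \<in> alg_hom A (poly_alg A) K"
proof (rule alg_homI)
  fix c a assume ca: "c \<in> carrier K" "a \<in> carrier A"
  have "monom (UP A) (c \<odot>\<^bsub>A\<^esub> a) 0 = monom (UP A) ((c \<odot>\<^bsub>A\<^esub> \<one>\<^bsub>A\<^esub>) \<otimes>\<^bsub>A\<^esub> a) 0"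
    using ca by (simp add: smult_assoc2)
  also have "\<dots> = (c \<odot>\<^bsub>A\<^esub> \<one>\<^bsub>A\<^esub>) \<odot>\<^bsub>UP A\<^esub> monom (UP A) a 0"
    using ca by (intro U.monom_mult_smult) auto
  finally show "poly_const A (c \<odot>\<^bsub>A\<^esub> a) = c \<odot>\<^bsub>poly_alg A\<^esub> poly_const A a"
    using ca by (simp add: poly_const_def poly_smult)
next
  fix a b assume "a \<in> carrier A" "b \<in> carrier A"
  then show "poly_const A (a \<otimes>\<^bsub>A\<^esub> b) = poly_const A a \<otimes>\<^bsub>poly_alg A\<^esub> poly_const A b"
    using ring_hom_mult[OF U.const_ring_hom] by (simp add: poly_const_def poly_ops)
qed (auto simp: poly_const_def poly_carrier poly_ops)

lemma poly_var_closed: "poly_var A \<in> carrier (poly_alg A)"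
  by (simp add: poly_var_def poly_carrier)

lemma poly_eval_hom:
  assumes "t \<in> carrier A"
  shows "poly_eval A t \<in> alg_hom (poly_alg A) A K"
proof -
  note h = eval_hom[OF assms]
  show ?thesis
  proof (rule alg_homI)
    fix c x assume "c \<in> carrier K" "x \<in> carrier (poly_alg A)"
    then obtain p where p: "c \<in> carrier K" "p \<in> carrier (UP A)" "x = Poly p"
      by (auto simp: poly_carrier)
    have "eval A A (\<lambda>a. a) t ((c \<odot>\<^bsub>A\<^esub> \<one>\<^bsub>A\<^esub>) \<odot>\<^bsub>UP A\<^esub> p) =
        eval A A (\<lambda>a. a) t (monom (UP A) (c \<odot>\<^bsub>A\<^esub> \<one>\<^bsub>A\<^esub>) 0 \<otimes>\<^bsub>UP A\<^esub> p)"
      using p by (simp add: U.monom_mult_is_smult)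
    also have "\<dots> = (c \<odot>\<^bsub>A\<^esub> \<one>\<^bsub>A\<^esub>) \<otimes>\<^bsub>A\<^esub> eval A A (\<lambda>a. a) t p"
      using p ring_hom_mult[OF h] assms by (simp add: eval_on_const)
    also have "\<dots> = c \<odot>\<^bsub>A\<^esub> eval A A (\<lambda>a. a) t p"
      using p ring_hom_closed[OF h] by (simp add: smult_assoc2)
    finally show "poly_eval A t (c \<odot>\<^bsub>poly_alg A\<^esub> x) = c \<odot>\<^bsub>A\<^esub> poly_eval A t x"
      using p by (simp add: poly_smult poly_eval_def)
  qed (use ring_hom_closed[OF h] ring_hom_mult[OF h] ring_hom_add[OF h] ring_hom_one[OF h]
      in \<open>auto simp: poly_eval_def poly_carrier poly_ops\<close>)
qed

lemma poly_eval_const: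
  assumes "t \<in> carrier A" "a \<in> carrier A"
  shows "poly_eval A t (poly_const A a) = a"
  using assms by (simp add: poly_eval_def poly_const_def eval_on_const)

lemma poly_eval_var:
  assumes "t \<in> carrier A"
  shows "poly_eval A t (poly_var A) = t"
  using eval_on_var[OF assms] by (simp add: poly_eval_def poly_var_def)

lemma pshift_carrier:
  assumes "p \<in> carrier (UP A)"
  shows "(\<lambda>n. p (Suc n)) \<in> carrier (UP A)"
proof -
  have p: "p \<in> up A" using assms by (simp add: UP_def)
  then obtain n where "bound \<zero>\<^bsub>A\<^esub> n p" by (auto simp: up_def)
  then have "bound \<zero>\<^bsub>A\<^esub> n (\<lambda>n. p (Suc n))" by (auto simp: bound_def)
  then show ?thesis using p by (auto simp: UP_def up_def Pi_def)
qed

lemma pshift_lin: "pshift \<in> lin_maps K (poly_alg A) (poly_alg A)"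
proof (rule lin_mapsI)
  fix x y assume "x \<in> carrier (poly_alg A)" "y \<in> carrier (poly_alg A)"
  then obtain p q where pq: "p \<in> carrier (UP A)" "x = Poly p" "q \<in> carrier (UP A)" "y = Poly q"
    by (auto simp: poly_carrier)
  then show "pshift (x \<oplus>\<^bsub>poly_alg A\<^esub> y) = pshift x \<oplus>\<^bsub>poly_alg A\<^esub> pshift y"
    using pshift_carrier[of p] pshift_carrier[of q]
    by (simp add: pshift_def poly_ops) (simp add: UP_def)
qed (auto simp: poly_carrier pshift_def pshift_carrier poly_alg_def)

lemma coeff_var_mult:
  assumes "p \<in> carrier (UP A)"
  shows "coeff (UP A) (monom (UP A) \<one>\<^bsub>A\<^esub> 1 \<otimes>\<^bsub>UP A\<^esub> p) n =
    (case n of 0 \<Rightarrow> \<zero>\<^bsub>A\<^esub> | Suc m \<Rightarrow> coeff (UP A) p m)"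
proof (cases n)
  case 0
  then show ?thesis using assms by simp
next
  case (Suc m)
  then show ?thesis
    using U.coeff_monom_mult[of "\<one>\<^bsub>A\<^esub>" p 1 m] assms by (simp del: U.coeff_mult)
qed

text \<open>Multiplication by \<open>T\<close> moves the coefficients up by one place and
  \<open>pshift\<close> moves them back. So \<open>T\<close> has a linear left inverse, the source
  of all cancellation of \<open>T\<close> below.\<close>

lemma pshift_var_mult:
  assumes "x \<in> carrier (poly_alg A)"
  shows "pshift (poly_var A \<otimes>\<^bsub>poly_alg A\<^esub> x) = x"
proof -
  obtain p where p: "p \<in> carrier (UP A)" "x = Poly p"
    using assms by (auto simp: poly_carrier)
  let ?q = "monom (UP A) \<one>\<^bsub>A\<^esub> 1 \<otimes>\<^bsub>UP A\<^esub> p"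
  have q: "?q \<in> carrier (UP A)" using p by simp
  have "?q (Suc n) = p n" for n
    using coeff_var_mult[OF p(1), of "Suc n"] coeff_eq[OF q] coeff_eq[OF p(1)] by simp
  then show ?thesis
    by (simp add: pshift_def poly_var_def poly_ops p)
qed

lemma pshift_const:
  assumes "a \<in> carrier A"
  shows "pshift (poly_const A a) = \<zero>\<^bsub>poly_alg A\<^esub>"
  using assms by (simp add: pshift_def poly_const_def poly_ops) (simp add: UP_def)

text \<open>Comparison of coefficients. Applied to points, this decomposition yields the existence
  of the \<open>F\<close> in \<open>diff_quot\<close>.\<close>

lemma poly_decomp:
  assumes "x \<in> carrier (poly_alg A)"
  shows "x = poly_const A (poly_eval A \<zero>\<^bsub>A\<^esub> x) \<oplus>\<^bsub>poly_alg A\<^esub> poly_var A \<otimes>\<^bsub>poly_alg A\<^esub> pshift x"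
proof -
  interpret B: algebra K "poly_alg A" by (rule poly_algebra)
  obtain p where p: "p \<in> carrier (UP A)" "x = Poly p"
    using assms by (auto simp: poly_carrier)
  have pn: "p n \<in> carrier A" for n
    using U.coeff_closed[OF p(1), of n] coeff_eq[OF p(1)] by simp
  note p0 = pn[of 0]
  have "p = monom (UP A) (p 0) 0 \<oplus>\<^bsub>UP A\<^esub> monom (UP A) \<one>\<^bsub>A\<^esub> 1 \<otimes>\<^bsub>UP A\<^esub> (\<lambda>n. p (Suc n))"
    using p(1) pn pshift_carrier[OF p(1)]
    by (intro poly_eqI) (auto simp: coeff_var_mult[simplified] coeff_eq[OF p(1)]
        coeff_eq[OF pshift_carrier[OF p(1)]] simp del: U.coeff_mult split: nat.split)
  then have x: "x = poly_const A (p 0) \<oplus>\<^bsub>poly_alg A\<^esub> poly_var A \<otimes>\<^bsub>poly_alg A\<^esub> pshift x"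
    by (simp add: p poly_const_def poly_var_def pshift_def poly_ops)
  note ev = poly_eval_hom[OF M.zero_closed]
  have sh: "pshift x \<in> carrier (poly_alg A)" by (rule lin_mapsD(1)[OF pshift_lin assms])
  have "poly_eval A \<zero>\<^bsub>A\<^esub> x = p 0"
    using p0 sh alg_homD(1)[OF poly_const_hom] alg_homD(1)[OF ev]
    by (subst x)
      (simp add: alg_homD(2,3)[OF ev] poly_var_closed poly_eval_var poly_eval_const)
  then show ?thesis using x by simp
qed

text \<open>For the product, write \<open>x = x0 + T x'\<close> and \<open>y = y0 + T y'\<close>.
  Then \<open>x y = x0 y0 + T (x0 y' + x' y)\<close>, so \<open>pshift\<close> of the product is
  \<open>x0 y' + x' y\<close>. Evaluating this at \<open>t\<close>, with
  \<open>y(t) = y0 + t y'(t)\<close>, gives the second component of the product in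
  \<open>dual A t\<close>.\<close>

lemma to_dual_hom:
  assumes t: "t \<in> carrier A"
  shows "to_dual A t \<in> alg_hom (poly_alg A) (dual A t) K"
proof -
  interpret B: algebra K "poly_alg A" by (rule poly_algebra)
  note ev = alg_homD[OF poly_eval_hom[OF t]] and ev0 = alg_homD[OF poly_eval_hom[OF M.zero_closed]]
    and sh = lin_mapsD[OF pshift_lin] and cs = alg_homD[OF poly_const_hom]
  show ?thesis
  proof (rule alg_homI)
    fix x y assume xy: "x \<in> carrier (poly_alg A)" "y \<in> carrier (poly_alg A)"
    let ?B = "poly_alg A" and ?T = "poly_var A" and ?c = "\<lambda>x. poly_const A (poly_eval A \<zero>\<^bsub>A\<^esub> x)"
    have cl: "?c x \<in> carrier ?B" "?c y \<in> carrier ?B" "pshift x \<in> carrier ?B" "pshift y \<in> carrier ?B"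
      "?T \<in> carrier ?B"
      using xy by (simp_all add: cs ev0 sh poly_var_closed)
    have y: "y = ?c y \<oplus>\<^bsub>?B\<^esub> ?T \<otimes>\<^bsub>?B\<^esub> pshift y" by (rule poly_decomp) fact
    have x: "x = ?c x \<oplus>\<^bsub>?B\<^esub> ?T \<otimes>\<^bsub>?B\<^esub> pshift x" by (rule poly_decomp) fact
    have "x \<otimes>\<^bsub>?B\<^esub> y = ?c x \<otimes>\<^bsub>?B\<^esub> y \<oplus>\<^bsub>?B\<^esub> ?T \<otimes>\<^bsub>?B\<^esub> (pshift x \<otimes>\<^bsub>?B\<^esub> y)"
      using cl xy by (subst x) (simp add: B.l_distr B.m_assoc)
    also have "?c x \<otimes>\<^bsub>?B\<^esub> y = ?c x \<otimes>\<^bsub>?B\<^esub> ?c y \<oplus>\<^bsub>?B\<^esub> ?T \<otimes>\<^bsub>?B\<^esub> (?c x \<otimes>\<^bsub>?B\<^esub> pshift y)"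
      using cl xy by (subst y) (simp add: B.r_distr B.m_ac)
    finally have "x \<otimes>\<^bsub>?B\<^esub> y = poly_const A (poly_eval A \<zero>\<^bsub>A\<^esub> x \<otimes>\<^bsub>A\<^esub> poly_eval A \<zero>\<^bsub>A\<^esub> y) \<oplus>\<^bsub>?B\<^esub>
        ?T \<otimes>\<^bsub>?B\<^esub> (?c x \<otimes>\<^bsub>?B\<^esub> pshift y \<oplus>\<^bsub>?B\<^esub> pshift x \<otimes>\<^bsub>?B\<^esub> y)"
      using cl xy ev0 by (simp add: B.r_distr B.M.a_assoc cs)
    then have "pshift (x \<otimes>\<^bsub>?B\<^esub> y) = ?c x \<otimes>\<^bsub>?B\<^esub> pshift y \<oplus>\<^bsub>?B\<^esub> pshift x \<otimes>\<^bsub>?B\<^esub> y"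
      using cl xy ev0 by (simp add: sh(2) pshift_var_mult pshift_const cs(1))
    moreover have "poly_eval A t y = poly_eval A \<zero>\<^bsub>A\<^esub> y \<oplus>\<^bsub>A\<^esub> t \<otimes>\<^bsub>A\<^esub> poly_eval A t (pshift y)"
      using cl xy t by (subst y) (simp add: ev ev0 poly_eval_const poly_eval_var)
    ultimately show "to_dual A t (x \<otimes>\<^bsub>?B\<^esub> y) = to_dual A t x \<otimes>\<^bsub>dual A t\<^esub> to_dual A t y"
      using cl xy t
      by (simp add: to_dual_def dual_simps ev ev0 poly_eval_const r_distr l_distr M.a_ac m_ac)
  next
    have "pshift \<one>\<^bsub>poly_alg A\<^esub> = \<zero>\<^bsub>poly_alg A\<^esub>"
      using pshift_const[of "\<one>\<^bsub>A\<^esub>"] cs(4) by simp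
    moreover have "poly_eval A t \<zero>\<^bsub>poly_alg A\<^esub> = \<zero>\<^bsub>A\<^esub>"
      using ev(5)[of "\<zero>\<^bsub>K\<^esub>" "\<zero>\<^bsub>poly_alg A\<^esub>"] ev(1) by simp
    ultimately show "to_dual A t \<one>\<^bsub>poly_alg A\<^esub> = \<one>\<^bsub>dual A t\<^esub>"
      by (simp add: to_dual_def dual_simps ev0)
  qed (auto simp: to_dual_def dual_simps ev ev0 sh)
qed

end

section \<open>Points over \<open>A[T]\<close> and over \<open>A[T]/(T^2 - tT)\<close>\<close>

context coeff_module
begin

lemma pt_map_comp':
  assumes "algebra K A" "algebra K B" "algebra K C" "h \<in> lin_maps K A B" "g \<in> lin_maps K B C"
    "p \<in> pts K V A S" "\<And>a. a \<in> carrier A \<Longrightarrow> g (h a) = k a"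
  shows "pt_map K V C g (pt_map K V B h p) = pt_map K V C k p"
  using pt_map_comp[OF assms(1-6)]
    pt_map_cong[OF assms(1,3) lin_maps_comp[OF assms(4,5)] assms(6), of k] assms(7)
  by simp

lemma pt_map_comp_id:
  assumes "algebra K A" "algebra K B" "h \<in> lin_maps K A B" "g \<in> lin_maps K B A"
    "p \<in> pts K V A S" "\<And>a. a \<in> carrier A \<Longrightarrow> g (h a) = a"
  shows "pt_map K V A g (pt_map K V B h p) = p"
  using pt_map_comp'[OF assms(1,2,1,3-6)] pt_map_id[OF assms(1,5)] by simp

lemma pt_map_comp_zero:
  assumes "algebra K A" "algebra K B" "algebra K C" "h \<in> lin_maps K A B" "g \<in> lin_maps K B C"
    "p \<in> pts K V A S" "\<And>a. a \<in> carrier A \<Longrightarrow> g (h a) = \<zero>\<^bsub>C\<^esub>"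
  shows "pt_map K V C g (pt_map K V B h p) = pzero K V C S"
  using pt_map_comp'[OF assms] pt_map_zero[OF assms(1,3,6)] by simp

end

text \<open>The point \<open>x + Tv\<close>; the summand \<open>Tv\<close> is the image of
  \<open>v\<close> under the linear map \<open>a \<mapsto> T a\<close>, so that coordinates can be
  read off by composing linear maps.\<close>

definition dual_pt :: "'k ring \<Rightarrow> ('k, 'v) module \<Rightarrow> 'k alg \<Rightarrow> 'k uelem \<Rightarrow>
    (('v, 'k) tns, 'k uelem) pt \<Rightarrow> (('v, 'k) tns, 'k uelem) pt \<Rightarrow> (('v, 'k) tns, 'k uelem) pt" where
  "dual_pt K V A t x v = padd K V (dual A t)
     (pt_map K V (dual A t) (\<lambda>a. dpair a \<zero>\<^bsub>A\<^esub>) x) (pt_map K V (dual A t) (dpair \<zero>\<^bsub>A\<^esub>) v)"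

text \<open>The point \<open>x + Tv\<close> over \<open>A[T]\<close>, in exactly the form that
  \<open>diff_quot\<close> passes to \<open>f\<close>, so that it can be folded there.\<close>

definition poly_pt :: "'k ring \<Rightarrow> ('k, 'v) module \<Rightarrow> 'k alg \<Rightarrow>
    (('v, 'k) tns, 'k uelem) pt \<Rightarrow> (('v, 'k) tns, 'k uelem) pt \<Rightarrow> (('v, 'k) tns, 'k uelem) pt" where
  "poly_pt K V A x v = padd K V (poly_alg A) (pt_map K V (poly_alg A) (poly_const A) x)
     (psmult K V (poly_alg A) (poly_var A) (pt_map K V (poly_alg A) (poly_const A) v))"

lemma dual_pt_Duo:
  "dual_pt K V A t (Duo x' x) (Duo v' v) = Duo (dual_pt K V A t x' v') (dual_pt K V A t x v)"
  by (simp add: dual_pt_def)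

context coeff_module
begin

context
  fixes A :: "'k alg"
  assumes A: "algebra K A"
begin

interpretation A: kalgebra K A
  by (rule kalgebra.intro) (rule A)

lemma poly_pt_closed:
  assumes "x \<in> pts K V A S" "v \<in> pts K V A S"
  shows "poly_pt K V A x v \<in> pts K V (poly_alg A) S"
  unfolding poly_pt_def using assms
  by (intro pt_add_closed pt_smult_closed pt_map_closed[OF A] A.poly_algebra A.poly_var_closed
      alg_hom_lin_maps[OF A.poly_const_hom])

lemma pt_map_poly_pt:
  assumes "x \<in> pts K V A S" "v \<in> pts K V A S" "algebra K B" "h \<in> alg_hom (poly_alg A) B K"
  shows "pt_map K V B h (poly_pt K V A x v) =
    padd K V B (pt_map K V B (\<lambda>a. h (poly_const A a)) x)
      (psmult K V B (h (poly_var A)) (pt_map K V B (\<lambda>a. h (poly_const A a)) v))"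
proof -
  note P = A.poly_algebra and c = alg_hom_lin_maps[OF A.poly_const_hom] and h = alg_hom_lin_maps[OF assms(4)]
  let ?c = "pt_map K V (poly_alg A) (poly_const A)"
  have cl: "?c x \<in> pts K V (poly_alg A) S" "?c v \<in> pts K V (poly_alg A) S"
    using assms by (auto intro!: pt_map_closed[OF A P c])
  have "pt_map K V B h (poly_pt K V A x v) = padd K V B (pt_map K V B h (?c x))
      (psmult K V B (h (poly_var A)) (pt_map K V B h (?c v)))"
    unfolding poly_pt_def
    using pt_map_add[OF P assms(3) h cl(1) pt_smult_closed[OF P A.poly_var_closed cl(2)]]
      pt_map_smult[OF P assms(3,4) A.poly_var_closed cl(2)] by simp
  then show ?thesis
    by (simp add: pt_map_comp[OF A P assms(3) c h assms(1)] pt_map_comp[OF A P assms(3) c h assms(2)])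
qed

text \<open>Uniqueness of \<open>F\<close>: on points \<open>pshift\<close> kills the constant part
  and undoes \<open>T\<close>, so \<open>F\<close> is determined by \<open>y + T F\<close>.\<close>

lemma poly_pt_pshift:
  assumes "y \<in> pts K V A S" "F \<in> pts K V (poly_alg A) S"
  shows "pt_map K V (poly_alg A) pshift
     (padd K V (poly_alg A) (pt_map K V (poly_alg A) (poly_const A) y) (psmult K V (poly_alg A) (poly_var A) F)) = F"
proof -
  note P = A.poly_algebra and c = alg_hom_lin_maps[OF A.poly_const_hom] and s = A.pshift_lin
    and m = lin_maps_mult[OF A.poly_algebra A.poly_var_closed]
  let ?B = "poly_alg A"
  have cy: "pt_map K V ?B (poly_const A) y \<in> pts K V ?B S"
    by (rule pt_map_closed[OF A P c assms(1)])
  have TF: "psmult K V ?B (poly_var A) F \<in> pts K V ?B S"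
    by (rule pt_smult_closed[OF P A.poly_var_closed assms(2)])
  have "pt_map K V ?B pshift (pt_map K V ?B (poly_const A) y) = pzero K V ?B S"
    by (rule pt_map_comp_zero[OF A P P c s assms(1)]) (rule A.pshift_const)
  moreover have "pt_map K V ?B pshift (psmult K V ?B (poly_var A) F) = F"
    unfolding pt_smult_eq_pt_map
    by (rule pt_map_comp_id[OF P P m s assms(2)]) (rule A.pshift_var_mult)
  ultimately show ?thesis
    using pt_add_zero[OF P assms(2)] by (simp add: pt_map_add[OF P P s cy TF])
qed

text \<open>Existence of \<open>F\<close>: by \<open>poly_decomp\<close> the identity of
  \<open>A[T]\<close> is the sum of the linear maps \<open>p \<mapsto> p(0)\<close> and
  \<open>p \<mapsto> T (pshift p)\<close>, and \<open>pt_map\<close> is additive in the map.\<close>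

lemma poly_pt_decomp:
  assumes z: "z \<in> pts K V (poly_alg A) S"
  shows "z = padd K V (poly_alg A) (pt_map K V (poly_alg A) (poly_const A) (pt_map K V A (poly_eval A \<zero>\<^bsub>A\<^esub>) z))
     (psmult K V (poly_alg A) (poly_var A) (pt_map K V (poly_alg A) pshift z))"
proof -
  note P = A.poly_algebra and c = alg_hom_lin_maps[OF A.poly_const_hom] and s = A.pshift_lin
    and m = lin_maps_mult[OF A.poly_algebra A.poly_var_closed]
    and e = alg_hom_lin_maps[OF A.poly_eval_hom[OF A.M.zero_closed]]
  let ?B = "poly_alg A"
  let ?f = "\<lambda>a. poly_const A (poly_eval A \<zero>\<^bsub>A\<^esub> a)" and ?g = "\<lambda>a. poly_var A \<otimes>\<^bsub>?B\<^esub> pshift a"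
  have "z = pt_map K V ?B (\<lambda>a. a) z"
    using pt_map_id[OF P z] by simp
  also have "\<dots> = pt_map K V ?B (\<lambda>a. ?f a \<oplus>\<^bsub>?B\<^esub> ?g a) z"
    by (rule pt_map_cong[OF P P lin_maps_id z]) (rule A.poly_decomp)
  also have "\<dots> = padd K V ?B (pt_map K V ?B ?f z) (pt_map K V ?B ?g z)"
    by (rule pt_map_plus[OF P P lin_maps_comp[OF e c] lin_maps_comp[OF s m] z])
  also have "\<dots> = padd K V ?B (pt_map K V ?B (poly_const A) (pt_map K V A (poly_eval A \<zero>\<^bsub>A\<^esub>) z))
     (psmult K V ?B (poly_var A) (pt_map K V ?B pshift z))"
    unfolding pt_smult_eq_pt_map
    by (simp add: pt_map_comp[OF P A P e c z] pt_map_comp[OF P P P s m z])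
  finally show ?thesis .
qed

text \<open>Tensoring need not preserve injectivity, but it preserves the left inverse
  \<open>pshift\<close> of multiplication by \<open>T\<close>.\<close>

lemma poly_var_cancel:
  assumes F: "F \<in> pts K V (poly_alg A) S" "F' \<in> pts K V (poly_alg A) S"
    and eq: "psmult K V (poly_alg A) (poly_var A) F = psmult K V (poly_alg A) (poly_var A) F'"
  shows "F = F'"
proof -
  note m = lin_maps_mult[OF A.poly_algebra A.poly_var_closed]
  have "pt_map K V (poly_alg A) pshift (psmult K V (poly_alg A) (poly_var A) G) = G"
    if "G \<in> pts K V (poly_alg A) S" for G
    unfolding pt_smult_eq_pt_map
    by (rule pt_map_comp_id[OF A.poly_algebra A.poly_algebra m A.pshift_lin that])
      (rule A.pshift_var_mult)
  from this[OF F(1), unfolded eq] this[OF F(2)] show ?thesis by (rule subst)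
qed

end

context
  fixes A :: "'k alg" and t :: "'k uelem"
  assumes A: "algebra K A" and t: "t \<in> carrier A"
begin

interpretation A: kalgebra K A
  by (rule kalgebra.intro) (rule A)

lemmas dual_alg = A.dual_algebra[OF t]
lemmas dual_lin = A.dual_maps(1)[OF t, THEN alg_hom_lin_maps] A.dual_maps(2)[OF t]
  A.dual_maps(3)[OF t, THEN alg_hom_lin_maps] A.dual_maps(4)[OF t]
  A.dual_maps(5)[OF t, THEN alg_hom_lin_maps]

lemma dual_pt_closed:
  assumes "x \<in> pts K V A S" "v \<in> pts K V A S"
  shows "dual_pt K V A t x v \<in> pts K V (dual A t) S"
  unfolding dual_pt_def
  using assms by (intro pt_add_closed[OF dual_alg] pt_map_closed[OF A dual_alg] dual_lin)

lemma pt_map_dual_pt: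
  assumes "x \<in> pts K V A S" "v \<in> pts K V A S" "algebra K B" "h \<in> lin_maps K (dual A t) B"
  shows "pt_map K V B h (dual_pt K V A t x v) =
    padd K V B (pt_map K V B (\<lambda>a. h (dpair a \<zero>\<^bsub>A\<^esub>)) x) (pt_map K V B (\<lambda>a. h (dpair \<zero>\<^bsub>A\<^esub> a)) v)"
proof -
  let ?i = "pt_map K V (dual A t) (\<lambda>a. dpair a \<zero>\<^bsub>A\<^esub>) x" and ?j = "pt_map K V (dual A t) (dpair \<zero>\<^bsub>A\<^esub>) v"
  have "pt_map K V B h (dual_pt K V A t x v) = padd K V B (pt_map K V B h ?i) (pt_map K V B h ?j)"
    unfolding dual_pt_def using assms(1,2)
    by (intro pt_map_add[OF dual_alg assms(3,4)] pt_map_closed[OF A dual_alg] dual_lin)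
  also have "pt_map K V B h ?i = pt_map K V B (\<lambda>a. h (dpair a \<zero>\<^bsub>A\<^esub>)) x"
    by (rule pt_map_comp[OF A dual_alg assms(3) dual_lin(1) assms(4,1)])
  also have "pt_map K V B h ?j = pt_map K V B (\<lambda>a. h (dpair \<zero>\<^bsub>A\<^esub> a)) v"
    by (rule pt_map_comp[OF A dual_alg assms(3) dual_lin(2) assms(4,2)])
  finally show ?thesis .
qed

lemma dual_pt_fst:
  assumes "x \<in> pts K V A S" "v \<in> pts K V A S"
  shows "pt_map K V A dfst (dual_pt K V A t x v) = x"
  using pt_map_dual_pt[OF assms A dual_lin(3)] assms
  by (simp add: pt_map_id[OF A] pt_map_zero[OF A A] pt_add_zero[OF A])

lemma dual_pt_snd:
  assumes "x \<in> pts K V A S" "v \<in> pts K V A S"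
  shows "pt_map K V A dsnd (dual_pt K V A t x v) = v"
  using pt_map_dual_pt[OF assms A dual_lin(4)] assms
  by (simp add: pt_map_id[OF A] pt_map_zero[OF A A] pt_add_zero[OF A])

lemma dual_pt_inj:
  assumes "x \<in> pts K V A S" "v \<in> pts K V A S" "x' \<in> pts K V A S" "v' \<in> pts K V A S"
    "dual_pt K V A t x v = dual_pt K V A t x' v'"
  shows "x = x'" "v = v'"
  using dual_pt_fst[OF assms(1,2)] dual_pt_fst[OF assms(3,4)]
    dual_pt_snd[OF assms(1,2)] dual_pt_snd[OF assms(3,4)] assms(5) by auto

text \<open>The identity of \<open>dual A t\<close> is the sum of its two coordinate projections,
  each linear.\<close>

lemma dual_pt_surj:
  assumes z: "z \<in> pts K V (dual A t) S"
  shows "z = dual_pt K V A t (pt_map K V A dfst z) (pt_map K V A dsnd z)"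
proof -
  let ?D = "dual A t"
  let ?f = "\<lambda>a. dpair (dfst a) \<zero>\<^bsub>A\<^esub>" and ?g = "\<lambda>a. dpair \<zero>\<^bsub>A\<^esub> (dsnd a)"
  have lf: "?f \<in> lin_maps K ?D ?D" using dual_lin(3,1) by (rule lin_maps_comp)
  have lg: "?g \<in> lin_maps K ?D ?D" using dual_lin(4,2) by (rule lin_maps_comp)
  have "z = pt_map K V ?D (\<lambda>a. a) z"
    using pt_map_id[OF dual_alg z] by simp
  also have "\<dots> = pt_map K V ?D (\<lambda>a. ?f a \<oplus>\<^bsub>?D\<^esub> ?g a) z"
    by (rule pt_map_cong[OF dual_alg dual_alg lin_maps_id z]) (auto simp: dual_simps)
  also have "\<dots> = padd K V ?D (pt_map K V ?D ?f z) (pt_map K V ?D ?g z)"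
    by (rule pt_map_plus[OF dual_alg dual_alg lf lg z])
  also have "\<dots> = dual_pt K V A t (pt_map K V A dfst z) (pt_map K V A dsnd z)"
    unfolding dual_pt_def
    by (simp add: pt_map_comp[OF dual_alg A dual_alg dual_lin(3) dual_lin(1) z]
        pt_map_comp[OF dual_alg A dual_alg dual_lin(4) dual_lin(2) z])
  finally show ?thesis .
qed

lemma dual_pt_target:
  assumes "x \<in> pts K V A S" "v \<in> pts K V A S"
  shows "pt_map K V A (\<lambda>z. dfst z \<oplus>\<^bsub>A\<^esub> t \<otimes>\<^bsub>A\<^esub> dsnd z) (dual_pt K V A t x v) =
    padd K V A x (psmult K V A t v)"
proof -
  have "pt_map K V A (\<lambda>z. dfst z \<oplus>\<^bsub>A\<^esub> t \<otimes>\<^bsub>A\<^esub> dsnd z) (dual_pt K V A t x v) =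
      padd K V A (pt_map K V A (\<lambda>a. a \<oplus>\<^bsub>A\<^esub> t \<otimes>\<^bsub>A\<^esub> \<zero>\<^bsub>A\<^esub>) x) (pt_map K V A (\<lambda>a. \<zero>\<^bsub>A\<^esub> \<oplus>\<^bsub>A\<^esub> t \<otimes>\<^bsub>A\<^esub> a) v)"
    using pt_map_dual_pt[OF assms A dual_lin(5)] by simp
  also have "pt_map K V A (\<lambda>a. a \<oplus>\<^bsub>A\<^esub> t \<otimes>\<^bsub>A\<^esub> \<zero>\<^bsub>A\<^esub>) x = pt_map K V A (\<lambda>a. a) x"
    by (rule pt_map_cong[OF A A lin_maps_id assms(1), symmetric]) (use t in simp)
  also have "pt_map K V A (\<lambda>a. \<zero>\<^bsub>A\<^esub> \<oplus>\<^bsub>A\<^esub> t \<otimes>\<^bsub>A\<^esub> a) v = psmult K V A t v"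
    unfolding pt_smult_eq_pt_map
    by (rule pt_map_cong[OF A A lin_maps_mult[OF A t] assms(2), symmetric]) (use t in simp)
  finally show ?thesis
    by (simp add: pt_map_id[OF A assms(1)])
qed

lemma dual_pt_natural:
  assumes "x \<in> pts K V A S" "v \<in> pts K V A S" "algebra K B" "h \<in> alg_hom A B K"
  shows "pt_map K V (dual B (h t)) (\<lambda>z. dpair (h (dfst z)) (h (dsnd z))) (dual_pt K V A t x v) =
    dual_pt K V B (h t) (pt_map K V B h x) (pt_map K V B h v)"
proof -
  interpret B: kalgebra K B by (rule kalgebra.intro) fact
  note hl = alg_hom_lin_maps[OF assms(4)]
  have ht: "h t \<in> carrier B" using assms(4) t by (rule alg_homD)
  note DB = B.dual_algebra[OF ht]
  note lb = alg_hom_lin_maps[OF B.dual_maps(1)[OF ht]] B.dual_maps(2)[OF ht]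
  have z: "h \<zero>\<^bsub>A\<^esub> = \<zero>\<^bsub>B\<^esub>"
    using alg_homD(5)[OF assms(4), of "\<zero>\<^bsub>K\<^esub>" "\<zero>\<^bsub>A\<^esub>"] alg_homD(1)[OF assms(4)] by simp
  have "pt_map K V (dual B (h t)) (\<lambda>z. dpair (h (dfst z)) (h (dsnd z))) (dual_pt K V A t x v) =
     padd K V (dual B (h t)) (pt_map K V (dual B (h t)) (\<lambda>a. dpair (h a) \<zero>\<^bsub>B\<^esub>) x)
       (pt_map K V (dual B (h t)) (\<lambda>a. dpair \<zero>\<^bsub>B\<^esub> (h a)) v)"
    using pt_map_dual_pt[OF assms(1,2) DB alg_hom_lin_maps[OF A.dual_map_hom[OF t assms(3,4)]]]
    by (simp add: z)
  also have "\<dots> = dual_pt K V B (h t) (pt_map K V B h x) (pt_map K V B h v)"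
    unfolding dual_pt_def
    by (simp add: pt_map_comp[OF A assms(3) DB hl lb(1) assms(1)]
        pt_map_comp[OF A assms(3) DB hl lb(2) assms(2)])
  finally show ?thesis .
qed

lemma poly_pt_eval:
  assumes "x \<in> pts K V A S" "v \<in> pts K V A S"
  shows "pt_map K V A (poly_eval A t) (poly_pt K V A x v) = padd K V A x (psmult K V A t v)"
proof -
  have "pt_map K V A (\<lambda>a. poly_eval A t (poly_const A a)) x = x" if "x \<in> pts K V A S" for x
    using pt_map_cong[OF A A lin_maps_id that, of "\<lambda>a. poly_eval A t (poly_const A a)"]
      pt_map_id[OF A that] A.poly_eval_const[OF t] by simp
  then show ?thesis
    using pt_map_poly_pt[OF A assms A A.poly_eval_hom[OF t]] assms by (simp add: A.poly_eval_var[OF t])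
qed

lemma poly_pt_to_dual:
  assumes "x \<in> pts K V A S" "v \<in> pts K V A S"
  shows "pt_map K V (dual A t) (to_dual A t) (poly_pt K V A x v) = dual_pt K V A t x v"
proof -
  interpret P: kalgebra K "poly_alg A"
    by (rule kalgebra.intro) (rule A.poly_algebra)
  let ?D = "dual A t"
  have ev0: "poly_eval A t \<zero>\<^bsub>poly_alg A\<^esub> = \<zero>\<^bsub>A\<^esub>"
    using alg_homD(5)[OF A.poly_eval_hom[OF t], of "\<zero>\<^bsub>K\<^esub>" "\<zero>\<^bsub>poly_alg A\<^esub>"]
      alg_homD(1)[OF A.poly_eval_hom[OF t]] by simp
  have c: "to_dual A t (poly_const A a) = dpair a \<zero>\<^bsub>A\<^esub>" if "a \<in> carrier A" for a
    using that by (simp add: to_dual_def A.poly_eval_const A.pshift_const ev0)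
  \<comment> \<open>Here \<open>T\<close> is read as \<open>T\<close> times 1, so that
    \<open>pshift_var_mult\<close> applies. Hence \<open>T\<close> reduces to
    \<open>dpair 0 1\<close>, and multiplying constants by that element is the linear map
    \<open>dpair 0\<close>.\<close>
  have "pshift (poly_var A) = \<one>\<^bsub>poly_alg A\<^esub>"
    using A.pshift_var_mult[OF P.one_closed] A.poly_var_closed by simp
  then have var: "to_dual A t (poly_var A) = dpair \<zero>\<^bsub>A\<^esub> \<one>\<^bsub>A\<^esub>"
    by (simp add: to_dual_def A.poly_eval_var alg_homD(4)[OF A.poly_eval_hom[OF t]])
  have cx: "pt_map K V ?D (\<lambda>a. to_dual A t (poly_const A a)) x = pt_map K V ?D (\<lambda>a. dpair a \<zero>\<^bsub>A\<^esub>) x"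
    if "x \<in> pts K V A S" for x
    by (rule pt_map_cong[OF A dual_alg dual_lin(1) that, symmetric]) (simp add: c)
  have "dpair \<zero>\<^bsub>A\<^esub> \<one>\<^bsub>A\<^esub> \<in> carrier ?D"
    by (simp add: dual_simps)
  then have e: "psmult K V ?D (dpair \<zero>\<^bsub>A\<^esub> \<one>\<^bsub>A\<^esub>) (pt_map K V ?D (\<lambda>a. dpair a \<zero>\<^bsub>A\<^esub>) v) =
      pt_map K V ?D (dpair \<zero>\<^bsub>A\<^esub>) v"
    unfolding pt_smult_eq_pt_map
    by (intro pt_map_comp'[OF A dual_alg dual_alg dual_lin(1) lin_maps_mult[OF dual_alg] assms(2)])
      (use t in \<open>auto simp: dual_simps\<close>)
  show ?thesis
    using pt_map_poly_pt[OF A assms dual_alg A.to_dual_hom[OF t]] cx assms e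
    by (simp add: var dual_pt_def)
qed

end

end


section \<open>The derivative of a polynomial law\<close>

text \<open>Polynomial laws between the modules described by two shapes. The tensor products of
  these modules with \<open>A\<close> are never formed; the points over \<open>A\<close> take their
  place.\<close>

definition law :: "'k ring \<Rightarrow> ('k, 'v) module \<Rightarrow> ('k, 'w) module \<Rightarrow> shape \<Rightarrow> shape \<Rightarrow>
    ('v, 'w, 'k) law \<Rightarrow> bool" where
  "law K V W X Y f \<longleftrightarrow>
     (\<forall>A. algebra K A \<longrightarrow> f A \<in> pts K V A X \<rightarrow> pts K W A Y) \<and>
     (\<forall>A B h. algebra K A \<and> algebra K B \<and> h \<in> alg_hom A B K \<longrightarrow>
        (\<forall>p\<in>pts K V A X. f B (pt_map K V B h p) = pt_map K W B h (f A p)))"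

lemma lawI:
  assumes "\<And>A p. algebra K A \<Longrightarrow> p \<in> pts K V A X \<Longrightarrow> f A p \<in> pts K W A Y"
    and "\<And>A B h p. algebra K A \<Longrightarrow> algebra K B \<Longrightarrow> h \<in> alg_hom A B K \<Longrightarrow> p \<in> pts K V A X \<Longrightarrow>
      f B (pt_map K V B h p) = pt_map K W B h (f A p)"
  shows "law K V W X Y f"
  using assms by (auto simp: law_def)

lemma law_closed: "law K V W X Y f \<Longrightarrow> algebra K A \<Longrightarrow> p \<in> pts K V A X \<Longrightarrow> f A p \<in> pts K W A Y"
  by (auto simp: law_def)

lemma law_natural:
  "law K V W X Y f \<Longrightarrow> algebra K A \<Longrightarrow> algebra K B \<Longrightarrow> h \<in> alg_hom A B K \<Longrightarrow> p \<in> pts K V A X \<Longrightarrow>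
    f B (pt_map K V B h p) = pt_map K W B h (f A p)"
  by (auto simp: law_def)

locale two_modules = V: coeff_module K V + W: coeff_module K W
  for K :: "'k ring" and V :: "('k, 'v) module" and W :: "('k, 'w) module"
begin

context
  fixes X Y :: shape and f :: "('v, 'w, 'k) law"
  assumes f: "law K V W X Y f"
begin

text \<open>This removes the description operator from the derivative. The value \<open>z\<close> of
  \<open>f\<close> at \<open>x + Tv\<close> over \<open>A[T]\<close> determines \<open>F\<close> as
  \<open>pshift z\<close>, and evaluating that at \<open>t\<close> is taking the second coordinate
  of the reduction of \<open>z\<close> to \<open>dual A t\<close>. By naturality the reduction is
  the value of \<open>f\<close> at \<open>x + Tv\<close> over \<open>dual A t\<close>.\<close>

lemma diff_quot_eq:
  assumes A: "algebra K A" and x: "x \<in> pts K V A X" and v: "v \<in> pts K V A X" and t: "t \<in> carrier A"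
  shows "diff_quot K V W Y f A x v t = pt_map K W A dsnd (f (dual A t) (dual_pt K V A t x v))"
proof -
  interpret A: kalgebra K A by (rule kalgebra.intro) (rule A)
  let ?B = "poly_alg A"
  note P = A.poly_algebra and D = A.dual_algebra[OF t]
    and e = A.poly_eval_hom[OF A.M.zero_closed] and et = alg_hom_lin_maps[OF A.poly_eval_hom[OF t]]
  define z where "z = f ?B (poly_pt K V A x v)"
  have pp: "poly_pt K V A x v \<in> pts K V ?B X"
    by (rule V.poly_pt_closed[OF A x v])
  have z: "z \<in> pts K W ?B Y"
    unfolding z_def by (rule law_closed[OF f P pp])
  have sz: "pt_map K W ?B pshift z \<in> pts K W ?B Y"
    by (rule W.pt_map_closed[OF P P A.pshift_lin z])
  \<comment> \<open>The constant part of \<open>z\<close> is \<open>f\<close> at \<open>x\<close>,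
    by naturality for the evaluation \<open>T \<mapsto> 0\<close>.\<close>
  have "pt_map K W A (poly_eval A \<zero>\<^bsub>A\<^esub>) z = f A (pt_map K V A (poly_eval A \<zero>\<^bsub>A\<^esub>) (poly_pt K V A x v))"
    unfolding z_def by (rule law_natural[OF f P A e pp, symmetric])
  also have "pt_map K V A (poly_eval A \<zero>\<^bsub>A\<^esub>) (poly_pt K V A x v) = padd K V A x (psmult K V A \<zero>\<^bsub>A\<^esub> v)"
    by (rule V.poly_pt_eval[OF A A.M.zero_closed x v])
  also have "psmult K V A \<zero>\<^bsub>A\<^esub> v = pt_map K V A (\<lambda>a. \<zero>\<^bsub>A\<^esub>) v"
    unfolding V.pt_smult_eq_pt_map
    by (rule V.pt_map_cong[OF A A lin_maps_zero[OF A] v, symmetric]) simp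
  also have "padd K V A x (pt_map K V A (\<lambda>a. \<zero>\<^bsub>A\<^esub>) v) = x"
    by (simp add: V.pt_map_zero[OF A A v] V.pt_add_zero[OF A x])
  finally have z0: "pt_map K W A (poly_eval A \<zero>\<^bsub>A\<^esub>) z = f A x" .
  \<comment> \<open>Existence is \<open>poly_pt_decomp\<close> with the constant part
    \<open>z0\<close>, uniqueness is \<open>poly_pt_pshift\<close>.\<close>
  have the: "(THE F. F \<in> pts K W ?B Y \<and>
      z = padd K W ?B (pt_map K W ?B (poly_const A) (f A x)) (psmult K W ?B (poly_var A) F)) =
      pt_map K W ?B pshift z"
  proof (rule the_equality)
    show "pt_map K W ?B pshift z \<in> pts K W ?B Y \<and>
      z = padd K W ?B (pt_map K W ?B (poly_const A) (f A x))
        (psmult K W ?B (poly_var A) (pt_map K W ?B pshift z))"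
      using sz W.poly_pt_decomp[OF A z] by (simp add: z0)
    show "F = pt_map K W ?B pshift z" if "F \<in> pts K W ?B Y \<and>
      z = padd K W ?B (pt_map K W ?B (poly_const A) (f A x)) (psmult K W ?B (poly_var A) F)" for F
      using W.poly_pt_pshift[OF A law_closed[OF f A x], of F] that by metis
  qed
  have "diff_quot K V W Y f A x v t = pt_map K W A (poly_eval A t) (pt_map K W ?B pshift z)"
    unfolding diff_quot_def Let_def poly_pt_def[symmetric] z_def[symmetric] the ..
  also have "\<dots> = pt_map K W A (\<lambda>a. dsnd (to_dual A t a)) z"
    by (rule W.pt_map_comp'[OF P P A A.pshift_lin et z]) (simp add: to_dual_def)
  also have "\<dots> = pt_map K W A dsnd (pt_map K W (dual A t) (to_dual A t) z)"
    by (rule W.pt_map_comp[OF P D A alg_hom_lin_maps[OF A.to_dual_hom[OF t]] A.dual_maps(4)[OF t] z, symmetric])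
  also have "pt_map K W (dual A t) (to_dual A t) z = f (dual A t) (dual_pt K V A t x v)"
    unfolding z_def
    using law_natural[OF f P D A.to_dual_hom[OF t] pp] V.poly_pt_to_dual[OF A t x v] by simp
  finally show ?thesis .
qed

lemma diff_quot_closed:
  assumes A: "algebra K A" and x: "x \<in> pts K V A X" and v: "v \<in> pts K V A X" and t: "t \<in> carrier A"
  shows "diff_quot K V W Y f A x v t \<in> pts K W A Y"
proof -
  interpret A: kalgebra K A by (rule kalgebra.intro) (rule A)
  note D = A.dual_algebra[OF t]
  show ?thesis
    unfolding diff_quot_eq[OF assms]
    by (rule W.pt_map_closed[OF D A A.dual_maps(4)[OF t] law_closed[OF f D V.dual_pt_closed[OF A t x v]]])
qed

text \<open>The first coordinate comes from naturality for \<open>T \<mapsto> 0\<close>, the second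
  is \<open>diff_quot_eq\<close>.\<close>

lemma law_dual_pt:
  assumes A: "algebra K A" and x: "x \<in> pts K V A X" and v: "v \<in> pts K V A X" and t: "t \<in> carrier A"
  shows "f (dual A t) (dual_pt K V A t x v) = dual_pt K W A t (f A x) (diff_quot K V W Y f A x v t)"
proof -
  interpret A: kalgebra K A by (rule kalgebra.intro) (rule A)
  note D = A.dual_algebra[OF t]
  note c = V.dual_pt_closed[OF A t x v]
  have "pt_map K W A dfst (f (dual A t) (dual_pt K V A t x v)) = f A x"
    using law_natural[OF f D A A.dual_maps(3)[OF t] c] V.dual_pt_fst[OF A t x v] by simp
  then show ?thesis
    using W.dual_pt_surj[OF A t law_closed[OF f D c]] by (simp add: diff_quot_eq[OF assms])
qed

text \<open>An algebra map \<open>h\<close> induces one from \<open>dual A t\<close> to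
  \<open>dual B (h t)\<close> that acts on both coordinates by \<open>h\<close>; \<open>f\<close> is
  natural for it.\<close>

lemma diff_quot_natural:
  assumes A: "algebra K A" and x: "x \<in> pts K V A X" and v: "v \<in> pts K V A X" and t: "t \<in> carrier A"
    and B: "algebra K B" and h: "h \<in> alg_hom A B K"
  shows "diff_quot K V W Y f B (pt_map K V B h x) (pt_map K V B h v) (h t) =
    pt_map K W B h (diff_quot K V W Y f A x v t)"
proof -
  interpret A: kalgebra K A by (rule kalgebra.intro) (rule A)
  interpret B: kalgebra K B by (rule kalgebra.intro) (rule B)
  note hl = alg_hom_lin_maps[OF h] and ht = alg_homD(1)[OF h t]
  note D = A.dual_algebra[OF t] and DB = B.dual_algebra[OF ht]
  note c = V.dual_pt_closed[OF A t x v] and H = A.dual_map_hom[OF t B h]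
  let ?z = "f (dual A t) (dual_pt K V A t x v)"
  note z = law_closed[OF f D c]
  have "diff_quot K V W Y f B (pt_map K V B h x) (pt_map K V B h v) (h t) =
      pt_map K W B dsnd (f (dual B (h t)) (dual_pt K V B (h t) (pt_map K V B h x) (pt_map K V B h v)))"
    using x v by (intro diff_quot_eq[OF B] V.pt_map_closed[OF A B hl] ht)
  also have "\<dots> = pt_map K W B dsnd (pt_map K W (dual B (h t)) (\<lambda>z. dpair (h (dfst z)) (h (dsnd z))) ?z)"
    using law_natural[OF f D DB H c] V.dual_pt_natural[OF A t x v B h] by simp
  also have "\<dots> = pt_map K W B (\<lambda>a. h (dsnd a)) ?z"
    by (rule W.pt_map_comp'[OF D DB B alg_hom_lin_maps[OF H] B.dual_maps(4)[OF ht] z]) simp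
  also have "\<dots> = pt_map K W B h (pt_map K W A dsnd ?z)"
    by (rule W.pt_map_comp[OF D A B A.dual_maps(4)[OF t] hl z, symmetric])
  finally show ?thesis
    by (simp add: diff_quot_eq[OF A x v t])
qed

text \<open>Naturality of \<open>f\<close> for the other root, \<open>T \<mapsto> t\<close>, applied
  to the point \<open>x + Tv\<close>.\<close>

lemma diff_quot_taylor:
  assumes A: "algebra K A" and x: "x \<in> pts K V A X" and v: "v \<in> pts K V A X" and t: "t \<in> carrier A"
  shows "f A (padd K V A x (psmult K V A t v)) =
    padd K W A (f A x) (psmult K W A t (diff_quot K V W Y f A x v t))"
proof -
  interpret A: kalgebra K A by (rule kalgebra.intro) (rule A)
  note D = A.dual_algebra[OF t]
  show ?thesis
    using law_natural[OF f D A A.dual_maps(5)[OF t] V.dual_pt_closed[OF A t x v]]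
    by (simp add: V.dual_pt_target[OF A t x v] law_dual_pt[OF A x v t]
      W.dual_pt_target[OF A t law_closed[OF f A x] diff_quot_closed[OF A x v t]])
qed

text \<open>The point \<open>x + T 0\<close> is the image of \<open>x\<close> under the inclusion of
  \<open>A\<close>, so by naturality the value of \<open>f\<close> there has no \<open>T\<close>
  component.\<close>

lemma diff_quot_zero:
  assumes A: "algebra K A" and x: "x \<in> pts K V A X" and t: "t \<in> carrier A"
  shows "diff_quot K V W Y f A x (pzero K V A X) t = pzero K W A Y"
proof -
  interpret A: kalgebra K A by (rule kalgebra.intro) (rule A)
  note D = A.dual_algebra[OF t] and m = A.dual_maps(1)[OF t]
  have ix: "pt_map K V (dual A t) (\<lambda>a. dpair a \<zero>\<^bsub>A\<^esub>) x \<in> pts K V (dual A t) X"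
    by (rule V.pt_map_closed[OF A D alg_hom_lin_maps[OF m] x])
  have "dual_pt K V A t x (pzero K V A X) = pt_map K V (dual A t) (\<lambda>a. dpair a \<zero>\<^bsub>A\<^esub>) x"
    by (simp add: dual_pt_def V.pt_map_pt_zero[OF A D A.dual_maps(2)[OF t]] V.pt_add_zero[OF D ix])
  then have "diff_quot K V W Y f A x (pzero K V A X) t =
      pt_map K W A dsnd (pt_map K W (dual A t) (\<lambda>a. dpair a \<zero>\<^bsub>A\<^esub>) (f A x))"
    using law_natural[OF f A D m x] by (simp add: diff_quot_eq[OF A x V.pt_zero_closed[OF A] t])
  also have "\<dots> = pzero K W A Y"
    by (rule W.pt_map_comp_zero[OF A D A alg_hom_lin_maps[OF m] A.dual_maps(4)[OF t] law_closed[OF f A x]]) simp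
  finally show ?thesis .
qed

text \<open>
  The identities below hold after multiplication with \<open>t\<close>.  Hence they hold for \<open>t = T\<close> over \<open>A[T]\<close>,
  where multiplication with \<open>T\<close> is injective, and then for all \<open>t\<close> by naturality.
\<close>

lemma diff_quot_add:
  assumes A: "algebra K A" and x: "x \<in> pts K V A X" and v: "v \<in> pts K V A X"
    and w: "w \<in> pts K V A X" and t: "t \<in> carrier A"
  shows "diff_quot K V W Y f A x (padd K V A v w) t =
    padd K W A (diff_quot K V W Y f A x v t) (diff_quot K V W Y f A (padd K V A x (psmult K V A t v)) w t)"
proof -
  interpret A: kalgebra K A by (rule kalgebra.intro) (rule A)
  let ?B = "poly_alg A" and ?T = "poly_var A" and ?q = "diff_quot K V W Y f"
  note P = A.poly_algebra and T = A.poly_var_closed and ev = A.poly_eval_hom[OF t]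
    and cst = alg_hom_lin_maps[OF A.poly_const_hom]
  let ?c = "pt_map K V ?B (poly_const A)"
  have c: "?c y \<in> pts K V ?B X" if "y \<in> pts K V A X" for y
    using that by (rule V.pt_map_closed[OF A P cst])
  have ec: "pt_map K V A (poly_eval A t) (?c y) = y" if "y \<in> pts K V A X" for y
    by (rule V.pt_map_comp_id[OF A P cst alg_hom_lin_maps[OF ev] that]) (rule A.poly_eval_const[OF t])
  note cx = c[OF x] and cv = c[OF v] and cw = c[OF w]
  let ?y = "padd K V ?B (?c x) (psmult K V ?B ?T (?c v))"
  note Tv = V.pt_smult_closed[OF P T cv] and Tw = V.pt_smult_closed[OF P T cw]
  have y: "?y \<in> pts K V ?B X" by (rule V.pt_add_closed[OF P cx Tv])
  note vw = V.pt_add_closed[OF P cv cw]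
  note q1 = diff_quot_closed[OF P cx cv T] and q2 = diff_quot_closed[OF P y cw T]
    and q3 = diff_quot_closed[OF P cx vw T]
  note fx = law_closed[OF f P cx]
  \<comment> \<open>Two Taylor expansions of \<open>f\<close> at
    \<open>x + T(v + w) = (x + Tv) + Tw\<close>: one with the increment \<open>v + w\<close>, one
    with \<open>v\<close> and then \<open>w\<close>.\<close>
  have "padd K W ?B (f ?B (?c x)) (psmult K W ?B ?T (?q ?B (?c x) (padd K V ?B (?c v) (?c w)) ?T)) =
      f ?B (padd K V ?B (?c x) (psmult K V ?B ?T (padd K V ?B (?c v) (?c w))))"
    by (rule diff_quot_taylor[OF P cx vw T, symmetric])
  also have "\<dots> = f ?B (padd K V ?B ?y (psmult K V ?B ?T (?c w)))"
    by (simp add: V.pt_smult_add[OF P T cv cw] V.pt_add_assoc[OF P cx Tv Tw])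
  also have "\<dots> = padd K W ?B (f ?B ?y) (psmult K W ?B ?T (?q ?B ?y (?c w) ?T))"
    by (rule diff_quot_taylor[OF P y cw T])
  also have "\<dots> = padd K W ?B (f ?B (?c x))
      (psmult K W ?B ?T (padd K W ?B (?q ?B (?c x) (?c v) ?T) (?q ?B ?y (?c w) ?T)))"
    by (simp add: diff_quot_taylor[OF P cx cv T] W.pt_smult_add[OF P T q1 q2]
        W.pt_add_assoc[OF P fx W.pt_smult_closed[OF P T q1] W.pt_smult_closed[OF P T q2]])
  finally have "psmult K W ?B ?T (?q ?B (?c x) (padd K V ?B (?c v) (?c w)) ?T) =
      psmult K W ?B ?T (padd K W ?B (?q ?B (?c x) (?c v) ?T) (?q ?B ?y (?c w) ?T))"
    using W.pt_add_cancel[OF P fx W.pt_smult_closed[OF P T q3]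
        W.pt_smult_closed[OF P T W.pt_add_closed[OF P q1 q2]]] by simp
  then have "?q ?B (?c x) (padd K V ?B (?c v) (?c w)) ?T =
      padd K W ?B (?q ?B (?c x) (?c v) ?T) (?q ?B ?y (?c w) ?T)"
    by (rule W.poly_var_cancel[OF A q3 W.pt_add_closed[OF P q1 q2]])
  \<comment> \<open>Specialisation of \<open>T\<close> to \<open>t\<close>; the constants introduced
    by \<open>poly_const\<close> return to \<open>x\<close>, \<open>v\<close> and
    \<open>w\<close>.\<close>
  then have "pt_map K W A (poly_eval A t) (?q ?B (?c x) (padd K V ?B (?c v) (?c w)) ?T) =
      padd K W A (pt_map K W A (poly_eval A t) (?q ?B (?c x) (?c v) ?T))
        (pt_map K W A (poly_eval A t) (?q ?B ?y (?c w) ?T))"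
    using W.pt_map_add[OF P A alg_hom_lin_maps[OF ev] q1 q2] by simp
  moreover have "pt_map K V A (poly_eval A t) ?y = padd K V A x (psmult K V A t v)"
    using V.poly_pt_eval[OF A t x v] by (simp add: poly_pt_def)
  ultimately show ?thesis
    by (simp add: diff_quot_natural[OF P cx vw T A ev, symmetric]
        diff_quot_natural[OF P cx cv T A ev, symmetric] diff_quot_natural[OF P y cw T A ev, symmetric]
        V.pt_map_add[OF P A alg_hom_lin_maps[OF ev] cv cw] ec x v w A.poly_eval_var[OF t])
qed

lemma diff_quot_smult:
  assumes A: "algebra K A" and x: "x \<in> pts K V A X" and v: "v \<in> pts K V A X"
    and s: "s \<in> carrier A" and t: "t \<in> carrier A"
  shows "diff_quot K V W Y f A x (psmult K V A s v) t =
    psmult K W A s (diff_quot K V W Y f A x v (s \<otimes>\<^bsub>A\<^esub> t))"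
proof -
  interpret A: kalgebra K A by (rule kalgebra.intro) (rule A)
  let ?B = "poly_alg A" and ?T = "poly_var A" and ?q = "diff_quot K V W Y f"
  interpret B: kalgebra K ?B by (rule kalgebra.intro) (rule A.poly_algebra)
  note P = A.poly_algebra and T = A.poly_var_closed and ev = A.poly_eval_hom[OF t]
    and cst = alg_hom_lin_maps[OF A.poly_const_hom]
  let ?c = "pt_map K V ?B (poly_const A)" and ?s = "poly_const A s"
  have cs: "?s \<in> carrier ?B" by (rule alg_homD(1)[OF A.poly_const_hom s])
  have c: "?c y \<in> pts K V ?B X" if "y \<in> pts K V A X" for y
    using that by (rule V.pt_map_closed[OF A P cst])
  have ec: "pt_map K V A (poly_eval A t) (?c y) = y" if "y \<in> pts K V A X" for y
    by (rule V.pt_map_comp_id[OF A P cst alg_hom_lin_maps[OF ev] that]) (rule A.poly_eval_const[OF t])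
  note cx = c[OF x] and cv = c[OF v]
  note sv = V.pt_smult_closed[OF P cs cv]
  have sT: "?s \<otimes>\<^bsub>?B\<^esub> ?T \<in> carrier ?B" using cs T by simp
  have comm: "?T \<otimes>\<^bsub>?B\<^esub> ?s = ?s \<otimes>\<^bsub>?B\<^esub> ?T" using cs T by (rule B.m_comm[symmetric])
  note q1 = diff_quot_closed[OF P cx sv T] and q2 = diff_quot_closed[OF P cx cv sT]
  note fx = law_closed[OF f P cx]
  \<comment> \<open>The point \<open>x + T(sv) = x + (sT)v\<close> is expanded once with increment
    \<open>sv\<close> and scalar \<open>T\<close>, once with increment \<open>v\<close> and scalar
    \<open>sT\<close>.\<close>
  have "padd K W ?B (f ?B (?c x)) (psmult K W ?B ?T (?q ?B (?c x) (psmult K V ?B ?s (?c v)) ?T)) =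
      f ?B (padd K V ?B (?c x) (psmult K V ?B ?T (psmult K V ?B ?s (?c v))))"
    by (rule diff_quot_taylor[OF P cx sv T, symmetric])
  also have "psmult K V ?B ?T (psmult K V ?B ?s (?c v)) = psmult K V ?B (?s \<otimes>\<^bsub>?B\<^esub> ?T) (?c v)"
    by (simp add: V.pt_smult_smult[OF P T cs cv] comm)
  also have "f ?B (padd K V ?B (?c x) (psmult K V ?B (?s \<otimes>\<^bsub>?B\<^esub> ?T) (?c v))) =
      padd K W ?B (f ?B (?c x)) (psmult K W ?B (?s \<otimes>\<^bsub>?B\<^esub> ?T) (?q ?B (?c x) (?c v) (?s \<otimes>\<^bsub>?B\<^esub> ?T)))"
    by (rule diff_quot_taylor[OF P cx cv sT])
  also have "psmult K W ?B (?s \<otimes>\<^bsub>?B\<^esub> ?T) (?q ?B (?c x) (?c v) (?s \<otimes>\<^bsub>?B\<^esub> ?T)) =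
      psmult K W ?B ?T (psmult K W ?B ?s (?q ?B (?c x) (?c v) (?s \<otimes>\<^bsub>?B\<^esub> ?T)))"
    by (simp add: W.pt_smult_smult[OF P T cs q2] comm)
  finally have "psmult K W ?B ?T (?q ?B (?c x) (psmult K V ?B ?s (?c v)) ?T) =
      psmult K W ?B ?T (psmult K W ?B ?s (?q ?B (?c x) (?c v) (?s \<otimes>\<^bsub>?B\<^esub> ?T)))"
    using W.pt_add_cancel[OF P fx W.pt_smult_closed[OF P T q1]
        W.pt_smult_closed[OF P T W.pt_smult_closed[OF P cs q2]]] by simp
  then have "?q ?B (?c x) (psmult K V ?B ?s (?c v)) ?T =
      psmult K W ?B ?s (?q ?B (?c x) (?c v) (?s \<otimes>\<^bsub>?B\<^esub> ?T))"
    by (rule W.poly_var_cancel[OF A q1 W.pt_smult_closed[OF P cs q2]])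
  then have "pt_map K W A (poly_eval A t) (?q ?B (?c x) (psmult K V ?B ?s (?c v)) ?T) =
      psmult K W A (poly_eval A t ?s) (pt_map K W A (poly_eval A t) (?q ?B (?c x) (?c v) (?s \<otimes>\<^bsub>?B\<^esub> ?T)))"
    using W.pt_map_smult[OF P A ev cs q2] by simp
  then show ?thesis
    by (simp add: diff_quot_natural[OF P cx sv T A ev, symmetric]
        diff_quot_natural[OF P cx cv sT A ev, symmetric] V.pt_map_smult[OF P A ev cs cv] ec x v
        A.poly_eval_var[OF t] A.poly_eval_const[OF t s] alg_homD(3)[OF ev cs T])
qed

end

end

section \<open>Jointly faithful families of functors\<close>

text \<open>
  The objects and morphisms of \<open>C\<close> are distributed by \<open>lab\<close> over the categories \<open>D l\<close>, and \<open>e\<close> is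
  injective on each part.  So equations between arrows of \<open>C\<close> may be checked in the categories \<open>D l\<close>.
\<close>

locale cat_embedding =
  fixes C :: "('x, 'x) cat" and D :: "'l \<Rightarrow> ('y, 'y) cat" and lab :: "'x \<Rightarrow> 'l" and e :: "'x \<Rightarrow> 'y"
  assumes src_closed: "g \<in> Mor C \<Longrightarrow> src C g \<in> Obj C"
    and tgt_closed: "g \<in> Mor C \<Longrightarrow> tgt C g \<in> Obj C"
    and unt_closed: "x \<in> Obj C \<Longrightarrow> unt C x \<in> Mor C"
    and cmp_closed: "g \<in> Mor C \<Longrightarrow> g' \<in> Mor C \<Longrightarrow> tgt C g = src C g' \<Longrightarrow> cmp C g' g \<in> Mor C"
    and lab_src: "g \<in> Mor C \<Longrightarrow> lab (src C g) = lab g"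
    and lab_tgt: "g \<in> Mor C \<Longrightarrow> lab (tgt C g) = lab g"
    and lab_unt: "x \<in> Obj C \<Longrightarrow> lab (unt C x) = lab x"
    and lab_cmp: "g \<in> Mor C \<Longrightarrow> g' \<in> Mor C \<Longrightarrow> tgt C g = src C g' \<Longrightarrow> lab (cmp C g' g) = lab g"
    and e_Obj: "x \<in> Obj C \<Longrightarrow> e x \<in> Obj (D (lab x))"
    and e_Mor: "g \<in> Mor C \<Longrightarrow> e g \<in> Mor (D (lab g))"
    and e_src: "g \<in> Mor C \<Longrightarrow> e (src C g) = src (D (lab g)) (e g)"
    and e_tgt: "g \<in> Mor C \<Longrightarrow> e (tgt C g) = tgt (D (lab g)) (e g)"
    and e_unt: "x \<in> Obj C \<Longrightarrow> e (unt C x) = unt (D (lab x)) (e x)"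
    and e_cmp: "g \<in> Mor C \<Longrightarrow> g' \<in> Mor C \<Longrightarrow> tgt C g = src C g' \<Longrightarrow>
      e (cmp C g' g) = cmp (D (lab g)) (e g') (e g)"
    and inj_Obj: "x \<in> Obj C \<Longrightarrow> y \<in> Obj C \<Longrightarrow> lab x = lab y \<Longrightarrow> e x = e y \<Longrightarrow> x = y"
    and inj_Mor: "g \<in> Mor C \<Longrightarrow> h \<in> Mor C \<Longrightarrow> lab g = lab h \<Longrightarrow> e g = e h \<Longrightarrow> g = h"
begin

text \<open>The target of \<open>g\<close> and the source of \<open>g'\<close> are one object, and
  both maps keep labels. So a composable pair always lies in a single part
  \<open>D l\<close>.\<close>

lemma lab_composable: "g \<in> Mor C \<Longrightarrow> g' \<in> Mor C \<Longrightarrow> tgt C g = src C g' \<Longrightarrow> lab g' = lab g"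
  using lab_src lab_tgt by metis

lemma e_composable:
  "g \<in> Mor C \<Longrightarrow> g' \<in> Mor C \<Longrightarrow> tgt C g = src C g' \<Longrightarrow>
    tgt (D (lab g)) (e g) = src (D (lab g)) (e g')"
  using e_src e_tgt lab_composable by metis

lemmas closed = src_closed tgt_closed unt_closed cmp_closed
lemmas labs = lab_src lab_tgt lab_unt lab_cmp
lemmas es = e_src e_tgt e_unt e_cmp

text \<open>Both sides of an axiom are arrows or objects of \<open>C\<close> with the same label;
  \<open>e\<close> turns the axiom into the one in \<open>D l\<close>, and injectivity of
  \<open>e\<close> on that label brings it back.\<close>

lemma small_category_reflect:
  assumes D: "\<And>x. x \<in> Obj C \<Longrightarrow> small_category (D (lab x))"
  shows "small_category C"
proof -
  have Dg: "small_category (D (lab g))" if "g \<in> Mor C" for g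
    using D[OF src_closed[OF that]] lab_src[OF that] by simp
  \<comment> \<open>Sources and targets of composites come first: without them the nested composites
    in associativity are not known to be arrows of \<open>C\<close>.\<close>
  have st: "src C (cmp C g' g) = src C g" "tgt C (cmp C g' g) = tgt C g'"
    if "g \<in> Mor C" "g' \<in> Mor C" "tgt C g = src C g'" for g g'
  proof -
    have "src (D (lab g)) (cmp (D (lab g)) (e g') (e g)) = src (D (lab g)) (e g) \<and>
        tgt (D (lab g)) (cmp (D (lab g)) (e g') (e g)) = tgt (D (lab g)) (e g')"
      using Dg[OF that(1)] e_Mor[OF that(1)] e_Mor[OF that(2)] e_composable[OF that]
        lab_composable[OF that] unfolding small_category_def by metis
    then show "src C (cmp C g' g) = src C g" "tgt C (cmp C g' g) = tgt C g'"
      using that lab_composable[OF that] by (auto intro!: inj_Obj simp: closed labs es)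
  qed
  have un: "src C (unt C x) = x" "tgt C (unt C x) = x" if "x \<in> Obj C" for x
    using D[OF that] e_Obj[OF that] that unfolding small_category_def
    by (auto intro!: inj_Obj simp: closed labs es)
  show ?thesis
    unfolding small_category_def
  proof (intro conjI ballI impI)
    fix g assume g: "g \<in> Mor C"
    have 1: "tgt C (unt C (src C g)) = src C g" "tgt C g = src C (unt C (tgt C g))"
      using un closed g by auto
    have "cmp (D (lab g)) (e g) (unt (D (lab g)) (src (D (lab g)) (e g))) = e g"
      "cmp (D (lab g)) (unt (D (lab g)) (tgt (D (lab g)) (e g))) (e g) = e g"
      using Dg[OF g] e_Mor[OF g] unfolding small_category_def by blast+
    then show "cmp C g (unt C (src C g)) = g" "cmp C (unt C (tgt C g)) g = g"
      using g 1 by (auto intro!: inj_Mor simp: closed labs es)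
  next
    fix g g' g'' assume g: "g \<in> Mor C" "g' \<in> Mor C" "g'' \<in> Mor C"
      and c: "tgt C g = src C g' \<and> tgt C g' = src C g''"
    have l: "lab g' = lab g" "lab g'' = lab g"
      using lab_composable g c by metis+
    have "cmp (D (lab g)) (e g'') (cmp (D (lab g)) (e g') (e g)) =
        cmp (D (lab g)) (cmp (D (lab g)) (e g'') (e g')) (e g)"
      using Dg[OF g(1)] e_Mor[OF g(1)] e_Mor[OF g(2)] e_Mor[OF g(3)] e_composable[OF g(1,2)]
        e_composable[OF g(2,3)] c unfolding small_category_def l by metis
    then show "cmp C g'' (cmp C g' g) = cmp C (cmp C g'' g') g"
      using g c l st by (auto intro!: inj_Mor simp: closed labs es)
  qed (use closed st un in auto)
qed

end

text \<open>Over the label \<open>l\<close> the pair \<open>f0\<close>, \<open>f1\<close> becomes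
  the functor \<open>F0 l\<close>, \<open>F1 l\<close> into the part of \<open>C'\<close> with label
  \<open>j l\<close>, so the equations follow from injectivity of \<open>e'\<close>.\<close>

lemma is_functor_reflect:
  assumes "cat_embedding C D lab e" and "cat_embedding C' D' lab' e'"
    and f0: "\<And>x. x \<in> Obj C \<Longrightarrow> f0 x \<in> Obj C'" and f1: "\<And>g. g \<in> Mor C \<Longrightarrow> f1 g \<in> Mor C'"
    and lab0: "\<And>x. x \<in> Obj C \<Longrightarrow> lab' (f0 x) = j (lab x)"
    and lab1: "\<And>g. g \<in> Mor C \<Longrightarrow> lab' (f1 g) = j (lab g)"
    and e0: "\<And>x. x \<in> Obj C \<Longrightarrow> e' (f0 x) = F0 (lab x) (e x)"
    and e1: "\<And>g. g \<in> Mor C \<Longrightarrow> e' (f1 g) = F1 (lab g) (e g)"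
    and F: "\<And>x. x \<in> Obj C \<Longrightarrow> is_functor (D (lab x)) (D' (j (lab x))) (F0 (lab x)) (F1 (lab x))"
  shows "is_functor C C' f0 f1"
proof -
  interpret C: cat_embedding C D lab e by fact
  interpret C': cat_embedding C' D' lab' e' by fact
  have Fg: "is_functor (D (lab g)) (D' (j (lab g))) (F0 (lab g)) (F1 (lab g))" if "g \<in> Mor C" for g
    using F[OF C.src_closed[OF that]] C.lab_src[OF that] by simp
  have s: "src C' (f1 g) = f0 (src C g)" "tgt C' (f1 g) = f0 (tgt C g)" if g: "g \<in> Mor C" for g
  proof -
    have "src (D' (j (lab g))) (F1 (lab g) (e g)) = F0 (lab g) (src (D (lab g)) (e g))"
      "tgt (D' (j (lab g))) (F1 (lab g) (e g)) = F0 (lab g) (tgt (D (lab g)) (e g))"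
      using Fg[OF g] C.e_Mor[OF g] unfolding is_functor_def by blast+
    then show "src C' (f1 g) = f0 (src C g)" "tgt C' (f1 g) = f0 (tgt C g)"
      using g by (auto intro!: C'.inj_Obj
          simp: f0 f1 C.closed C'.closed C.labs C'.labs C.es C'.es lab0 lab1 e0 e1)
  qed
  show ?thesis
    unfolding is_functor_def
  proof (intro conjI ballI impI)
    fix x assume x: "x \<in> Obj C"
    have "unt (D' (j (lab x))) (F0 (lab x) (e x)) = F1 (lab x) (unt (D (lab x)) (e x))"
      using F[OF x] C.e_Obj[OF x] unfolding is_functor_def by blast
    then show "unt C' (f0 x) = f1 (unt C x)"
      using x by (auto intro!: C'.inj_Mor
          simp: f0 f1 C.closed C'.closed C.labs C'.labs C.es C'.es lab0 lab1 e0 e1)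
  next
    fix g g' assume g: "g \<in> Mor C" "g' \<in> Mor C" "tgt C g = src C g'"
    have "F1 (lab g) (cmp (D (lab g)) (e g') (e g)) =
        cmp (D' (j (lab g))) (F1 (lab g) (e g')) (F1 (lab g) (e g))"
      using Fg[OF g(1)] C.e_Mor[OF g(1)] C.e_Mor[OF g(2)] C.e_composable[OF g] C.lab_composable[OF g]
      unfolding is_functor_def by metis
    moreover have "tgt C' (f1 g) = src C' (f1 g')"
      using g s by simp
    ultimately show "f1 (cmp C g' g) = cmp C' (f1 g') (f1 g)"
      using g C.lab_composable[OF g] by (auto intro!: C'.inj_Mor
          simp: f0 f1 C.closed C'.closed C.labs C'.labs C.es C'.es lab0 lab1 e0 e1)
  qed (use f0 f1 s in auto)
qed

text \<open>The two entries of a composable pair share their label, so the label of the first one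
  serves for both. That the source and target maps are functors is what keeps pairs composable under
  the operations of \<open>C1\<close>.\<close>

lemma composable_pairs_embedding:
  assumes "cat_embedding C1 C1' lab e"
    and "cat_embedding D0 D0' lab e" and "cat_embedding D1 D1' lab e"
    and obj: "Mor D0 = Obj C1" "Mor D1 = Mor C1"
    and f: "is_functor C1 C0 (src D0) (src D1)" "is_functor C1 C0 (tgt D0) (tgt D1)"
  shows "cat_embedding (composable_pairs C1 D0 D1) (\<lambda>l. composable_pairs (C1' l) (D0' l) (D1' l))
    (\<lambda>p. lab (fst p)) (map_prod e e)"
proof -
  interpret C: cat_embedding C1 C1' lab e by fact
  interpret D0: cat_embedding D0 D0' lab e by fact
  interpret D1: cat_embedding D1 D1' lab e by fact
  have fs: "src D0 (src C1 g) = src C0 (src D1 g)" "src D0 (tgt C1 g) = tgt C0 (src D1 g)"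
    "tgt D0 (src C1 g) = src C0 (tgt D1 g)" "tgt D0 (tgt C1 g) = tgt C0 (tgt D1 g)" if "g \<in> Mor C1" for g
    using f that unfolding is_functor_def by auto
  have fu: "src D1 (unt C1 x) = unt C0 (src D0 x)" "tgt D1 (unt C1 x) = unt C0 (tgt D0 x)"
    if "x \<in> Obj C1" for x
    using f that unfolding is_functor_def by auto
  have fc: "src D1 (cmp C1 g' g) = cmp C0 (src D1 g') (src D1 g)"
    "tgt D1 (cmp C1 g' g) = cmp C0 (tgt D1 g') (tgt D1 g)"
    if "g \<in> Mor C1" "g' \<in> Mor C1" "tgt C1 g = src C1 g'" for g g'
    using f that unfolding is_functor_def by auto
  have l0: "lab b' = lab b" if "b \<in> Obj C1" "b' \<in> Obj C1" "tgt D0 b = src D0 b'" for b b'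
    using D0.lab_composable that obj by metis
  have l1: "lab b' = lab b" if "b \<in> Mor C1" "b' \<in> Mor C1" "tgt D1 b = src D1 b'" for b b'
    using D1.lab_composable that obj by metis
  have e0: "tgt (D0' (lab b)) (e b) = src (D0' (lab b)) (e b')"
    if "b \<in> Obj C1" "b' \<in> Obj C1" "tgt D0 b = src D0 b'" for b b'
    using D0.e_composable that obj by metis
  have e1: "tgt (D1' (lab b)) (e b) = src (D1' (lab b)) (e b')"
    if "b \<in> Mor C1" "b' \<in> Mor C1" "tgt D1 b = src D1 b'" for b b'
    using D1.e_composable that obj by metis
  show ?thesis
  proof (unfold_locales, goal_cases)
    \<comment> \<open>Cases 9 to 16 are the conditions on \<open>e\<close>, from
      \<open>e_Obj\<close> to \<open>inj_Mor\<close>; here the label of the second entry must be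
      replaced by that of the first.\<close>
    case (9 x)
    then show ?case
      using C.e_Obj l0 e0 by (fastforce simp: composable_pairs_def)
  next
    case (10 x)
    then show ?case
      using C.e_Mor l1 e1 by (fastforce simp: composable_pairs_def)
  next
    case (11 g)
    then show ?case
      using l1 by (auto simp: composable_pairs_def C.es)
  next
    case (12 g)
    then show ?case
      using l1 by (auto simp: composable_pairs_def C.es)
  next
    case (13 g)
    then show ?case
      using l0 by (auto simp: composable_pairs_def C.es)
  next
    case (14 g g')
    then show ?case
      using l1 by (auto simp: composable_pairs_def C.es)
  next
    case (15 x y)
    then show ?case
      using l0 by (auto simp: composable_pairs_def intro!: C.inj_Obj)
  next
    case (16 x y)
    then show ?case
      using l1 by (auto simp: composable_pairs_def intro!: C.inj_Mor)
  qed (auto simp: composable_pairs_def C.closed C.labs fs fu fc)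
qed

text \<open>The functor conditions are reflected one at a time. Source and target precede the
  product, because composable pairs embed only once those are functors.\<close>

lemma double_category_reflect:
  assumes e: "cat_embedding C0 C0' lab e" "cat_embedding C1 C1' lab e"
      "cat_embedding D0 D0' lab e" "cat_embedding D1 D1' lab e"
    and obj: "Obj D0 = Obj C0" "Mor D0 = Obj C1" "Obj D1 = Mor C0" "Mor D1 = Mor C1"
    and D: "\<And>x. x \<in> Obj C0 \<Longrightarrow> double_category (C0' (lab x)) (C1' (lab x)) (D0' (lab x)) (D1' (lab x))"
  shows "double_category C0 C1 D0 D1"
proof -
  interpret C0: cat_embedding C0 C0' lab e by fact
  interpret C1: cat_embedding C1 C1' lab e by fact
  interpret D0: cat_embedding D0 D0' lab e by fact
  interpret D1: cat_embedding D1 D1' lab e by fact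
  \<comment> \<open>Source maps lead from every vertex of the square to \<open>Obj C0\<close> and
    keep labels, so each label that occurs is the label of an object of \<open>C0\<close>.\<close>
  have Dx: "double_category (C0' (lab x)) (C1' (lab x)) (D0' (lab x)) (D1' (lab x))"
    if "x \<in> Obj C0 \<or> x \<in> Obj C1 \<or> x \<in> Mor C0 \<or> x \<in> Mor C1" for x
  proof -
    have 1: "x \<in> Mor C1 \<Longrightarrow> \<exists>y\<in>Mor C0. lab y = lab x" for x
      using D1.src_closed D1.lab_src obj by metis
    have 2: "x \<in> Mor C0 \<Longrightarrow> \<exists>y\<in>Obj C0. lab y = lab x" for x
      using C0.src_closed C0.lab_src obj by metis
    have 3: "x \<in> Obj C1 \<Longrightarrow> \<exists>y\<in>Obj C0. lab y = lab x" for x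
      using D0.src_closed D0.lab_src obj by metis
    from that 1 2 3 obtain y where "y \<in> Obj C0" "lab y = lab x"
      by metis
    with D show ?thesis by metis
  qed
  note DD = Dx[unfolded double_category_def]
  have small: "small_category C0" "small_category C1" "small_category D0" "small_category D1"
    by (auto intro!: C0.small_category_reflect C1.small_category_reflect D0.small_category_reflect
        D1.small_category_reflect simp: DD obj)
  have s: "is_functor C1 C0 (src D0) (src D1)"
    by (rule is_functor_reflect[where j = "\<lambda>l. l" and ?F0.0 = "\<lambda>l. src (D0' l)" and ?F1.0 = "\<lambda>l. src (D1' l)", OF e(2,1)])
      (auto simp: obj[symmetric] D0.closed D1.closed D0.labs D1.labs D0.es D1.es DD)
  have t: "is_functor C1 C0 (tgt D0) (tgt D1)"
    by (rule is_functor_reflect[where j = "\<lambda>l. l" and ?F0.0 = "\<lambda>l. tgt (D0' l)" and ?F1.0 = "\<lambda>l. tgt (D1' l)", OF e(2,1)])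
      (auto simp: obj[symmetric] D0.closed D1.closed D0.labs D1.labs D0.es D1.es DD)
  have u: "is_functor C0 C1 (unt D0) (unt D1)"
    by (rule is_functor_reflect[where j = "\<lambda>l. l" and ?F0.0 = "\<lambda>l. unt (D0' l)" and ?F1.0 = "\<lambda>l. unt (D1' l)", OF e(1,2)])
      (auto simp: obj[symmetric] D0.closed D1.closed D0.labs D1.labs D0.es D1.es DD)
  have "is_functor (composable_pairs C1 D0 D1) C1 (case_prod (cmp D0)) (case_prod (cmp D1))"
  proof (rule is_functor_reflect[where j = "\<lambda>l. l" and ?F0.0 = "\<lambda>l. case_prod (cmp (D0' l))" and
        ?F1.0 = "\<lambda>l. case_prod (cmp (D1' l))", OF composable_pairs_embedding[OF e(2,3,4) obj(2,4) s t] e(2)],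
      goal_cases)
    case (7 x)
    then show ?case
      using DD[of "fst x"] by (auto simp: composable_pairs_def)
  qed (use D0.lab_composable D1.lab_composable in
      \<open>auto simp: composable_pairs_def obj[symmetric] D0.closed D1.closed D0.labs D1.labs D0.es D1.es\<close>)
  then show ?thesis
    unfolding double_category_def using small obj s t u by blast
qed

text \<open>The definition singles out one of the two directions, but the equations it unfolds to
  are symmetric. With this, a face of the cube needs to be treated in one order of its directions
  only.\<close>

lemma double_category_sym:
  assumes "double_category C0 C1 D0 D1"
  shows "double_category D0 D1 C0 C1"
proof -
  note d = assms[unfolded double_category_def]
  note sm = d[unfolded small_category_def]
  have s: "src C0 (src D1 g) = src D0 (src C1 g)" "tgt C0 (src D1 g) = src D0 (tgt C1 g)"
    "src C0 (tgt D1 g) = tgt D0 (src C1 g)" "tgt C0 (tgt D1 g) = tgt D0 (tgt C1 g)" if "g \<in> Mor C1" for g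
    using d that unfolding is_functor_def by auto
  have u: "src D1 (unt C1 x) = unt C0 (src D0 x)" "tgt D1 (unt C1 x) = unt C0 (tgt D0 x)"
    if "x \<in> Obj C1" for x
    using d that unfolding is_functor_def by auto
  have u': "src C1 (unt D1 x) = unt D0 (src C0 x)" "tgt C1 (unt D1 x) = unt D0 (tgt C0 x)"
    if "x \<in> Mor C0" for x
    using d that unfolding is_functor_def by auto
  have uu: "unt C1 (unt D0 x) = unt D1 (unt C0 x)" if "x \<in> Obj C0" for x
    using d that unfolding is_functor_def by auto
  have c: "src D1 (cmp C1 g' g) = cmp C0 (src D1 g') (src D1 g)"
    "tgt D1 (cmp C1 g' g) = cmp C0 (tgt D1 g') (tgt D1 g)"
    if "g \<in> Mor C1" "g' \<in> Mor C1" "tgt C1 g = src C1 g'" for g g'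
    using d that unfolding is_functor_def by auto
  have cu: "unt D1 (cmp C0 g' g) = cmp C1 (unt D1 g') (unt D1 g)"
    if "g \<in> Mor C0" "g' \<in> Mor C0" "tgt C0 g = src C0 g'" for g g'
    using d that unfolding is_functor_def by auto
  have P: "is_functor (composable_pairs C1 D0 D1) C1 (case_prod (cmp D0)) (case_prod (cmp D1))"
    using d by blast
  have P1: "src C1 (cmp D1 h' h) = cmp D0 (src C1 h') (src C1 h)"
    "tgt C1 (cmp D1 h' h) = cmp D0 (tgt C1 h') (tgt C1 h)"
    if "h \<in> Mor C1" "h' \<in> Mor C1" "tgt D1 h = src D1 h'" for h h'
    using P that unfolding is_functor_def composable_pairs_def by auto
  have P2: "unt C1 (cmp D0 b' b) = cmp D1 (unt C1 b') (unt C1 b)"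
    if "b \<in> Obj C1" "b' \<in> Obj C1" "tgt D0 b = src D0 b'" for b b'
    using P that unfolding is_functor_def composable_pairs_def by auto
  \<comment> \<open>The interchange law, read off from compatibility of the product with composition
    of pairs.\<close>
  have P3: "cmp D1 (cmp C1 g' h') (cmp C1 g h) = cmp C1 (cmp D1 g' g) (cmp D1 h' h)"
    if "g \<in> Mor C1" "g' \<in> Mor C1" "h \<in> Mor C1" "h' \<in> Mor C1" "tgt D1 g = src D1 g'" "tgt D1 h = src D1 h'"
      "tgt C1 h = src C1 g" "tgt C1 h' = src C1 g'" for g g' h h'
    using P that unfolding is_functor_def composable_pairs_def by auto
  have o: "Obj D0 = Obj C0" "Mor D0 = Obj C1" "Obj D1 = Mor C0" "Mor D1 = Mor C1"
    using d by auto
  have smC: "\<And>g. g \<in> Mor C0 \<Longrightarrow> src C0 g \<in> Obj C0 \<and> tgt C0 g \<in> Obj C0"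
    "\<And>g. g \<in> Mor C1 \<Longrightarrow> src C1 g \<in> Obj C1 \<and> tgt C1 g \<in> Obj C1"
    "\<And>g. g \<in> Obj C0 \<Longrightarrow> unt C0 g \<in> Mor C0" "\<And>g. g \<in> Obj C1 \<Longrightarrow> unt C1 g \<in> Mor C1"
    "\<And>g g'. g \<in> Mor C0 \<Longrightarrow> g' \<in> Mor C0 \<Longrightarrow> tgt C0 g = src C0 g' \<Longrightarrow> cmp C0 g' g \<in> Mor C0"
    "\<And>g g'. g \<in> Mor C1 \<Longrightarrow> g' \<in> Mor C1 \<Longrightarrow> tgt C1 g = src C1 g' \<Longrightarrow> cmp C1 g' g \<in> Mor C1"
    using sm by (auto simp: Pi_def)
  have "is_functor D1 D0 (src C0) (src C1)" "is_functor D1 D0 (tgt C0) (tgt C1)"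
    using smC by (auto simp: is_functor_def o s u' P1)
  moreover have "is_functor D0 D1 (unt C0) (unt C1)"
    using smC by (auto simp: is_functor_def o u uu P2)
  moreover have "is_functor (composable_pairs D1 C0 C1) D1 (case_prod (cmp C0)) (case_prod (cmp C1))"
    using smC by (auto simp: is_functor_def composable_pairs_def o c cu P3)
  ultimately show ?thesis
    unfolding double_category_def using d by simp
qed

lemma is_functor_comp:
  assumes "is_functor C D f0 f1" "is_functor D E g0 g1"
  shows "is_functor C E (\<lambda>x. g0 (f0 x)) (\<lambda>x. g1 (f1 x))"
  using assms unfolding is_functor_def by (auto simp: Pi_def)

section \<open>The new vertices\<close>

text \<open>The flags tell whether the new directions \<open>k\<close> and \<open>k'\<close> belong
  to the vertex, so that statements on derived laws cover all four vertices uniformly.\<close>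

definition lift :: "bool \<Rightarrow> bool \<Rightarrow> shape \<Rightarrow> shape" where
  "lift a b S = (if a then if b then SXvst S else SXvt S else if b then SXst S else SXt S)"

lemma lift_simps [simp]:
  "lift False False S = SXt S" "lift True False S = SXvt S"
  "lift False True S = SXst S" "lift True True S = SXvst S"
  by (simp_all add: lift_def)

lemma pts_liftE:
  assumes "p \<in> pts K V A (lift a b S)"
  obtains x t where "a = False" "b = False" "p = Xt x t" "x \<in> pts K V A S" "t \<in> carrier A"
  | x v t where "a = True" "b = False" "p = Xvt x v t" "x \<in> pts K V A S" "v \<in> pts K V A S" "t \<in> carrier A"
  | x s t where "a = False" "b = True" "p = Xst x s t" "x \<in> pts K V A S" "s \<in> carrier A" "t \<in> carrier A"
  | x v s t where "a = True" "b = True" "p = Xvst x v s t" "x \<in> pts K V A S" "v \<in> pts K V A S"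
      "s \<in> carrier A" "t \<in> carrier A"
  using assms by (cases a; cases b) auto

text \<open>
  A point \<open>(x, v, t)\<close> over \<open>A\<close> is a point over \<open>A[T]/(T\<^sup>2 - tT)\<close>, and \<open>(x, v, s, t)\<close> is one
  over \<open>A[T]/(T\<^sup>2 - stT)\<close>; \<open>lab\<close> records this algebra together with the scalars.
\<close>

fun lab :: "'k alg \<Rightarrow> ('m, 'k uelem) pt \<Rightarrow> 'k alg \<times> 'k uelem list" where
  "lab A (Xt x t) = (A, [t])"
| "lab A (Xvt x v t) = (dual A t, [t])"
| "lab A (Xst x s t) = (A, [s, t])"
| "lab A (Xvst x v s t) = (dual A (s \<otimes>\<^bsub>A\<^esub> t), [s, t])"
| "lab A p = (A, [])"

text \<open>The scalars dropped here are kept by \<open>lab\<close>. The last equation is a filler: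
  points of a lifted shape are built by the four constructors before it.\<close>

fun enc :: "'k ring \<Rightarrow> ('k, 'v) module \<Rightarrow> 'k alg \<Rightarrow>
    (('v, 'k) tns, 'k uelem) pt \<Rightarrow> (('v, 'k) tns, 'k uelem) pt" where
  "enc K V A (Xt x t) = x"
| "enc K V A (Xvt x v t) = dual_pt K V A t x v"
| "enc K V A (Xst x s t) = x"
| "enc K V A (Xvst x v s t) = dual_pt K V A (s \<otimes>\<^bsub>A\<^esub> t) x v"
| "enc K V A p = p"

context coeff_module
begin

lemma lab_algebra:
  assumes "algebra K A" "p \<in> pts K V A (lift a b S)"
  shows "algebra K (fst (lab A p))"
proof -
  interpret A: kalgebra K A by (rule kalgebra.intro) fact
  show ?thesis
    using assms(2) by (elim pts_liftE) (auto simp: assms(1) A.dual_algebra)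
qed

lemma enc_closed:
  assumes "algebra K A" "p \<in> pts K V A (lift a b S)"
  shows "enc K V A p \<in> pts K V (fst (lab A p)) S"
proof -
  interpret A: kalgebra K A by (rule kalgebra.intro) fact
  show ?thesis
    using assms(2) by (elim pts_liftE) (auto intro!: dual_pt_closed assms(1))
qed

text \<open>The label fixes the scalars, and the coordinates over \<open>dual\<close> recover
  \<open>x\<close> and \<open>v\<close>. The label has to list \<open>s\<close> and \<open>t\<close>
  separately, since the algebra depends on their product only.\<close>

lemma enc_inj:
  assumes "algebra K A" "p \<in> pts K V A (lift a b S)" "q \<in> pts K V A (lift a b S)"
    and "lab A p = lab A q" "enc K V A p = enc K V A q"
  shows "p = q"
proof -
  interpret A: kalgebra K A by (rule kalgebra.intro) fact
  show ?thesis
    using assms(2-)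
    by (elim pts_liftE) (auto dest: dual_pt_inj[OF assms(1), rotated -1])
qed

lemma zip_pt_closed:
  assumes "p \<in> pts K V A (lift a b S)" "q \<in> pts K V A (lift a b S')"
  shows "zip_pt (Duo p q) \<in> pts K V A (lift a b (SDuo S S'))"
  using assms by (elim pts_liftE) auto

text \<open>Under \<open>enc\<close> the regrouping disappears: a pair of points with one label is a
  pair of points over one algebra, because \<open>dual_pt\<close> works on the two entries
  separately.\<close>

lemma zip_pt_lab:
  assumes "p \<in> pts K V A (lift a b S)" "q \<in> pts K V A (lift a b S')" "lab A p = lab A q"
  shows "lab A (zip_pt (Duo p q)) = lab A q"
    and "enc K V A (zip_pt (Duo p q)) = Duo (enc K V A p) (enc K V A q)"
  using assms by (auto elim!: pts_liftE simp: dual_pt_Duo)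

text \<open>On pairs with different scalars \<open>zip_pt\<close> keeps those of the second entry.
  It is thereby natural on the whole product, so derived products are again laws.\<close>

lemma zip_pt_law:
  "law K V V (SDuo (lift a b X) (lift a b Y)) (lift a b (SDuo X Y)) (\<lambda>A. zip_pt)"
proof (rule lawI)
  fix A :: "'k alg" and p
  assume p: "p \<in> pts K V A (SDuo (lift a b X) (lift a b Y))"
  then show "zip_pt p \<in> pts K V A (lift a b (SDuo X Y))"
    using zip_pt_closed by auto
  fix B h
  show "zip_pt (pt_map K V B h p) = pt_map K V B h (zip_pt p)"
    using p by (auto elim!: pts_liftE)
qed

end

lemma law_comp:
  assumes "law K U V X Y f" "law K V W Y Z g"
  shows "law K U W X Z (\<lambda>A p. g A (f A p))"
  using assms by (auto simp: law_def Pi_def)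

context two_modules
begin

lemma derived_closed:
  assumes f: "law K V W X Y f" and A: "algebra K A" and p: "p \<in> pts K V A (lift a b X)"
  shows "derived K V W Y f A p \<in> pts K W A (lift a b Y)"
proof -
  interpret A: algebra K A by (rule A)
  show ?thesis
    using p by (elim pts_liftE) (auto intro!: law_closed[OF f A] diff_quot_closed[OF f A])
qed

text \<open>Naturality of the four replacements is that of \<open>f\<close> and of the difference
  quotient, together with \<open>h (s t) = h s \<cdot> h t\<close> at the vertex with both new
  directions.\<close>

lemma derived_law:
  assumes f: "law K V W X Y f"
  shows "law K V W (lift a b X) (lift a b Y) (derived K V W Y f)"
proof (rule lawI)
  fix A B h p
  assume A: "algebra K A" and B: "algebra K B" and h: "h \<in> alg_hom A B K"
    and p: "p \<in> pts K V A (lift a b X)"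
  interpret A: algebra K A by (rule A)
  show "derived K V W Y f B (pt_map K V B h p) = pt_map K W B h (derived K V W Y f A p)"
    using p by (elim pts_liftE)
      (auto simp: law_natural[OF f A B h] diff_quot_natural[OF f A _ _ _ B h]
        alg_homD(3)[OF h, symmetric])
qed (rule derived_closed[OF f])

lemma derived_lab:
  assumes "p \<in> pts K V A (lift a b X)"
  shows "lab A (derived K V W Y f A p) = lab A p"
    and "added_scalars (derived K V W Y f A p) = added_scalars p"
  using assms by (auto elim!: pts_liftE)

text \<open>\<open>law_dual_pt\<close> for all four vertices at once. It supplies the compatibility
  with \<open>enc\<close> required for \<open>cat_embedding\<close> and for reflecting
  functors.\<close>

lemma derived_enc:
  assumes f: "law K V W X Y f" and A: "algebra K A" and p: "p \<in> pts K V A (lift a b X)"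
  shows "enc K W A (derived K V W Y f A p) = f (fst (lab A p)) (enc K V A p)"
proof -
  interpret A: algebra K A by (rule A)
  show ?thesis
    using p by (elim pts_liftE) (auto simp: law_dual_pt[OF f A])
qed

end


section \<open>The new directions\<close>

text \<open>The edge in direction \<open>k\<close>; the flag \<open>b\<close> tells whether
  \<open>k'\<close> belongs to its two vertices. In \<open>k'_cat\<close> the roles are
  exchanged.\<close>

definition k_cat :: "'k ring \<Rightarrow> ('k, 'v) module \<Rightarrow> 'k alg \<Rightarrow> bool \<Rightarrow> shape \<Rightarrow>
    ((('v, 'k) tns, 'k uelem) pt, (('v, 'k) tns, 'k uelem) pt) cat" where
  "k_cat K V A b X = \<lparr>Obj = pts K V A (lift False b X), Mor = pts K V A (lift True b X),
     src = k_src K V A, tgt = k_tgt K V A, unt = k_unit K V X A,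
     cmp = (\<lambda>g' g. k_prod K V A (Duo g' g))\<rparr>"

definition k'_cat :: "'k ring \<Rightarrow> ('k, 'v) module \<Rightarrow> 'k alg \<Rightarrow> bool \<Rightarrow> shape \<Rightarrow>
    ((('v, 'k) tns, 'k uelem) pt, (('v, 'k) tns, 'k uelem) pt) cat" where
  "k'_cat K V A a X = \<lparr>Obj = pts K V A (lift a False X), Mor = pts K V A (lift a True X),
     src = k'_src K V A, tgt = k'_tgt K V A, unt = k'_unit K V A,
     cmp = (\<lambda>g' g. k'_prod K V A (Duo g' g))\<rparr>"

lemma k_cat_simps [simp]:
  "Obj (k_cat K V A b X) = pts K V A (lift False b X)" "Mor (k_cat K V A b X) = pts K V A (lift True b X)"
  "src (k_cat K V A b X) = k_src K V A" "tgt (k_cat K V A b X) = k_tgt K V A"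
  "unt (k_cat K V A b X) = k_unit K V X A" "cmp (k_cat K V A b X) g' g = k_prod K V A (Duo g' g)"
  "Obj (k'_cat K V A b X) = pts K V A (lift b False X)" "Mor (k'_cat K V A b X) = pts K V A (lift b True X)"
  "src (k'_cat K V A b X) = k'_src K V A" "tgt (k'_cat K V A b X) = k'_tgt K V A"
  "unt (k'_cat K V A b X) = k'_unit K V A" "cmp (k'_cat K V A b X) g' g = k'_prod K V A (Duo g' g)"
  by (simp_all add: k_cat_def k'_cat_def)

lemma composable_pairs_simps:
  "src (composable_pairs C1 D0 D1) = map_prod (src C1) (src C1)"
  "tgt (composable_pairs C1 D0 D1) = map_prod (tgt C1) (tgt C1)"
  "unt (composable_pairs C1 D0 D1) = map_prod (unt C1) (unt C1)"
  "cmp (composable_pairs C1 D0 D1) = (\<lambda>(g', g) (h', h). (cmp C1 g' h', cmp C1 g h))"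
  by (simp_all add: composable_pairs_def)

context coeff_module
begin

context
  fixes A :: "'k alg" and X :: shape
  assumes A: "algebra K A"
begin

interpretation A: kalgebra K A
  by (rule kalgebra.intro) (rule A)

lemmas pt_module_simps = pt_add_closed[OF A, where S = X] pt_smult_closed[OF A, where S = X]
  pt_zero_closed[OF A, where S = X] pt_add_zero[OF A, where S = X] pt_add_assoc[OF A, where S = X]
  pt_smult_add[OF A, where S = X] pt_smult_zero[OF A, where S = X]
  pt_smult_smult[OF A, where S = X] pt_smult_one[OF A, where S = X]

lemma small_k_cat: "small_category (k_cat K V A b X)"
  by (cases b) (auto simp: small_category_def pt_module_simps)

lemma small_k'_cat: "small_category (k'_cat K V A a X)"
  by (cases a) (auto simp: small_category_def pt_module_simps A.m_assoc A.m_ac)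

text \<open>Everything reduces to the module axioms. In the square of targets one side gives
  \<open>x + t(sv)\<close> and the other \<open>x + (st)v\<close>, so commutativity of
  \<open>A\<close> enters.\<close>

lemma double_category_new:
  "double_category (k_cat K V A False X) (k_cat K V A True X) (k'_cat K V A False X) (k'_cat K V A True X)"
  unfolding double_category_def
proof (intro conjI small_k_cat small_k'_cat)
  show "is_functor (k_cat K V A True X) (k_cat K V A False X) (src (k'_cat K V A False X)) (src (k'_cat K V A True X))"
    by (auto simp: is_functor_def pt_module_simps)
  show "is_functor (k_cat K V A True X) (k_cat K V A False X) (tgt (k'_cat K V A False X)) (tgt (k'_cat K V A True X))"
    by (auto simp: is_functor_def pt_module_simps A.m_comm)
  show "is_functor (k_cat K V A False X) (k_cat K V A True X) (unt (k'_cat K V A False X)) (unt (k'_cat K V A True X))"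
    by (auto simp: is_functor_def pt_module_simps)
  show "is_functor (composable_pairs (k_cat K V A True X) (k'_cat K V A False X) (k'_cat K V A True X))
     (k_cat K V A True X) (case_prod (cmp (k'_cat K V A False X))) (case_prod (cmp (k'_cat K V A True X)))"
    by (auto simp: is_functor_def composable_pairs_def pt_module_simps A.m_ac)
qed (simp_all)

end

text \<open>Being laws is what allows the structure maps of one step to be derived at all later
  steps.\<close>

lemma k_laws:
  "law K V V (lift True b X) (lift False b X) (k_src K V)"
  "law K V V (lift True b X) (lift False b X) (k_tgt K V)"
  "law K V V (lift False b X) (lift True b X) (k_unit K V X)"
  "law K V V (SDuo (lift True b X) (lift True b X)) (lift True b X) (k_prod K V)"
  "law K V V (lift b True X) (lift b False X) (k'_src K V)"
  "law K V V (lift b True X) (lift b False X) (k'_tgt K V)"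
  "law K V V (lift b False X) (lift b True X) (k'_unit K V)"
  "law K V V (SDuo (lift b True X) (lift b True X)) (lift b True X) (k'_prod K V)"
proof -
  show "law K V V (lift True b X) (lift False b X) (k_src K V)"
    by (rule lawI) (auto elim!: pts_liftE)
  show "law K V V (lift True b X) (lift False b X) (k_tgt K V)"
  proof (rule lawI)
    fix A p assume A: "algebra K A" and p: "p \<in> pts K V A (lift True b X)"
    interpret A: algebra K A by (rule A)
    show "k_tgt K V A p \<in> pts K V A (lift False b X)"
      using p by (auto elim!: pts_liftE simp: pt_add_closed[OF A] pt_smult_closed[OF A])
    fix B h assume B: "algebra K B" and h: "h \<in> alg_hom A B K"
    show "k_tgt K V B (pt_map K V B h p) = pt_map K V B h (k_tgt K V A p)"
      using p
      by (auto elim!: pts_liftE simp: pt_map_add[OF A B alg_hom_lin_maps[OF h], where S = X]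
          pt_map_smult[OF A B h, where S = X] pt_smult_closed[OF A] alg_homD(3)[OF h])
  qed
  show "law K V V (lift False b X) (lift True b X) (k_unit K V X)"
    by (rule lawI) (auto elim!: pts_liftE simp: pt_zero_closed pt_map_pt_zero alg_hom_lin_maps)
  show "law K V V (SDuo (lift True b X) (lift True b X)) (lift True b X) (k_prod K V)"
  proof (rule lawI)
    fix A p assume A: "algebra K A" and p: "p \<in> pts K V A (SDuo (lift True b X) (lift True b X))"
    show "k_prod K V A p \<in> pts K V A (lift True b X)"
      using p by (auto elim!: pts_liftE simp: pt_add_closed[OF A])
    fix B h assume B: "algebra K B" and h: "h \<in> alg_hom A B K"
    show "k_prod K V B (pt_map K V B h p) = pt_map K V B h (k_prod K V A p)"
      using p by (auto elim!: pts_liftE simp: pt_map_add[OF A B alg_hom_lin_maps[OF h], where S = X])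
  qed
  show "law K V V (lift b True X) (lift b False X) (k'_src K V)"
  proof (rule lawI)
    fix A p assume A: "algebra K A" and p: "p \<in> pts K V A (lift b True X)"
    interpret A: algebra K A by (rule A)
    show "k'_src K V A p \<in> pts K V A (lift b False X)"
      using p by (auto elim!: pts_liftE)
    fix B h assume B: "algebra K B" and h: "h \<in> alg_hom A B K"
    show "k'_src K V B (pt_map K V B h p) = pt_map K V B h (k'_src K V A p)"
      using p by (auto elim!: pts_liftE simp: alg_homD(3)[OF h])
  qed
  show "law K V V (lift b True X) (lift b False X) (k'_tgt K V)"
  proof (rule lawI)
    fix A p assume A: "algebra K A" and p: "p \<in> pts K V A (lift b True X)"
    show "k'_tgt K V A p \<in> pts K V A (lift b False X)"
      using p by (auto elim!: pts_liftE simp: pt_smult_closed[OF A])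
    fix B h assume B: "algebra K B" and h: "h \<in> alg_hom A B K"
    show "k'_tgt K V B (pt_map K V B h p) = pt_map K V B h (k'_tgt K V A p)"
      using p by (auto elim!: pts_liftE simp: pt_map_smult[OF A B h, where S = X])
  qed
  show "law K V V (lift b False X) (lift b True X) (k'_unit K V)"
  proof (rule lawI)
    fix A p assume A: "algebra K A" and p: "p \<in> pts K V A (lift b False X)"
    interpret A: algebra K A by (rule A)
    show "k'_unit K V A p \<in> pts K V A (lift b True X)"
      using p by (auto elim!: pts_liftE)
    fix B h assume B: "algebra K B" and h: "h \<in> alg_hom A B K"
    show "k'_unit K V B (pt_map K V B h p) = pt_map K V B h (k'_unit K V A p)"
      using p by (auto elim!: pts_liftE simp: alg_homD(4)[OF h])
  qed
  show "law K V V (SDuo (lift b True X) (lift b True X)) (lift b True X) (k'_prod K V)"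
  proof (rule lawI)
    fix A p assume A: "algebra K A" and p: "p \<in> pts K V A (SDuo (lift b True X) (lift b True X))"
    interpret A: algebra K A by (rule A)
    show "k'_prod K V A p \<in> pts K V A (lift b True X)"
      using p by (auto elim!: pts_liftE)
    fix B h assume B: "algebra K B" and h: "h \<in> alg_hom A B K"
    show "k'_prod K V B (pt_map K V B h p) = pt_map K V B h (k'_prod K V A p)"
      using p by (auto elim!: pts_liftE simp: alg_homD(3)[OF h])
  qed
qed

text \<open>When scalars agree, the operations of direction \<open>k\<close> act on the two entries
  separately, hence on the regrouped pair. A derived product is this functor followed by a derived
  law.\<close>

lemma zip_k_functor:
  assumes "\<And>g g'. g \<in> pts K V A (lift False b X) \<Longrightarrow> g' \<in> pts K V A (lift False b X) \<Longrightarrow>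
      tgt D0 g = src D0 g' \<Longrightarrow> added_scalars g' = added_scalars g"
    and "\<And>g g'. g \<in> pts K V A (lift True b X) \<Longrightarrow> g' \<in> pts K V A (lift True b X) \<Longrightarrow>
      tgt D1 g = src D1 g' \<Longrightarrow> added_scalars g' = added_scalars g"
  shows "is_functor (composable_pairs (k_cat K V A b X) D0 D1) (k_cat K V A b (SDuo X X))
    (\<lambda>(g', g). zip_pt (Duo g' g)) (\<lambda>(g', g). zip_pt (Duo g' g))"
proof -
  let ?C = "composable_pairs (k_cat K V A b X) D0 D1"
  have ob: "\<exists>g g'. p = (g', g) \<and> g \<in> pts K V A (lift False b X) \<and> g' \<in> pts K V A (lift False b X) \<and>
      added_scalars g' = added_scalars g" if "p \<in> Obj ?C" for p
    using that assms(1) by (cases p) (auto simp: composable_pairs_def)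
  have mo: "\<exists>g g'. p = (g', g) \<and> g \<in> pts K V A (lift True b X) \<and> g' \<in> pts K V A (lift True b X) \<and>
      added_scalars g' = added_scalars g" if "p \<in> Mor ?C" for p
    using that assms(2) by (cases p) (auto simp: composable_pairs_def)
  show ?thesis
    unfolding is_functor_def composable_pairs_simps
    by (intro conjI ballI impI funcsetI) (auto dest!: ob mo elim!: pts_liftE)
qed

lemma zip_k'_functor:
  assumes "\<And>g g'. g \<in> pts K V A (lift a False X) \<Longrightarrow> g' \<in> pts K V A (lift a False X) \<Longrightarrow>
      tgt D0 g = src D0 g' \<Longrightarrow> added_scalars g' = added_scalars g"
    and "\<And>g g'. g \<in> pts K V A (lift a True X) \<Longrightarrow> g' \<in> pts K V A (lift a True X) \<Longrightarrow>
      tgt D1 g = src D1 g' \<Longrightarrow> added_scalars g' = added_scalars g"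
  shows "is_functor (composable_pairs (k'_cat K V A a X) D0 D1) (k'_cat K V A a (SDuo X X))
    (\<lambda>(g', g). zip_pt (Duo g' g)) (\<lambda>(g', g). zip_pt (Duo g' g))"
proof -
  let ?C = "composable_pairs (k'_cat K V A a X) D0 D1"
  have ob: "\<exists>g g'. p = (g', g) \<and> g \<in> pts K V A (lift a False X) \<and> g' \<in> pts K V A (lift a False X) \<and>
      added_scalars g' = added_scalars g" if "p \<in> Obj ?C" for p
    using that assms(1) by (cases p) (auto simp: composable_pairs_def)
  have mo: "\<exists>g g'. p = (g', g) \<and> g \<in> pts K V A (lift a True X) \<and> g' \<in> pts K V A (lift a True X) \<and>
      added_scalars g' = added_scalars g" if "p \<in> Mor ?C" for p
    using that assms(2) by (cases p) (auto simp: composable_pairs_def)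
  show ?thesis
    unfolding is_functor_def composable_pairs_simps
    by (intro conjI ballI impI funcsetI) (auto dest!: ob mo elim!: pts_liftE)
qed

end

context two_modules
begin

text \<open>Compatibility with targets is the Taylor formula, with units
  \<open>diff_quot_zero\<close>, with products \<open>diff_quot_add\<close>; for \<open>b\<close>
  true the same holds with \<open>st\<close> in place of \<open>t\<close>.\<close>

lemma derived_k_functor:
  assumes f: "law K V W X Y f" and A: "algebra K A"
  shows "is_functor (k_cat K V A b X) (k_cat K W A b Y) (derived K V W Y f A) (derived K V W Y f A)"
proof -
  interpret A: algebra K A by (rule A)
  show ?thesis
    using derived_closed[OF f A, of _ False b] derived_closed[OF f A, of _ True b]
    by (cases b) (auto simp: is_functor_def diff_quot_taylor[OF f A] diff_quot_zero[OF f A]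
        diff_quot_add[OF f A])
qed

text \<open>The condition on targets is the homogeneity \<open>diff_quot_smult\<close>. For sources
  and products the scalar at which the difference quotient is taken stays the same: for composable
  points \<open>(ss')t' = s(s't') = st\<close>.\<close>

lemma derived_k'_functor:
  assumes f: "law K V W X Y f" and A: "algebra K A"
  shows "is_functor (k'_cat K V A a X) (k'_cat K W A a Y) (derived K V W Y f A) (derived K V W Y f A)"
proof -
  interpret A: algebra K A by (rule A)
  show ?thesis
    using derived_closed[OF f A, of _ a False] derived_closed[OF f A, of _ a True]
    by (cases a) (auto simp: is_functor_def diff_quot_smult[OF f A] A.m_assoc)
qed

end

section \<open>The iterated categories over an arbitrary algebra\<close>

text \<open>The recursion evaluated at any algebra and without the passage to
  \<open>K\<close>-points, which is the form that the induction over varying algebras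
  requires.\<close>

definition G_over :: "'k ring \<Rightarrow> ('k, 'v) module \<Rightarrow> nat \<Rightarrow> 'k alg \<Rightarrow> (dir, (('v, 'k) tns, 'k uelem) pt) mfold" where
  "G_over K V n A =
     \<lparr>vert = (\<lambda>\<alpha>. pts K V A (G_shape n \<alpha>)),
      esrc = (\<lambda>\<beta> i. G_src K V n \<beta> i A),
      etgt = (\<lambda>\<beta> i. G_tgt K V n \<beta> i A),
      eunt = (\<lambda>\<beta> i. G_unit K V n \<beta> i A),
      ecmp = (\<lambda>\<beta> i g' g. G_prod K V n \<beta> i A (Duo g' g))\<rparr>"

lemma edge_G_over [simp]:
  "Obj (edge (G_over K V n A) \<beta> i) = pts K V A (G_shape n \<beta>)"
  "Mor (edge (G_over K V n A) \<beta> i) = pts K V A (G_shape n (insert i \<beta>))"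
  "src (edge (G_over K V n A) \<beta> i) = G_src K V n \<beta> i A"
  "tgt (edge (G_over K V n A) \<beta> i) = G_tgt K V n \<beta> i A"
  "unt (edge (G_over K V n A) \<beta> i) = G_unit K V n \<beta> i A"
  "cmp (edge (G_over K V n A) \<beta> i) = (\<lambda>g' g. G_prod K V n \<beta> i A (Duo g' g))"
  by (simp_all add: edge_def G_over_def)

lemma dirs_Suc: "dirs (Suc n) = insert (Unprimed (Suc n)) (insert (Primed (Suc n)) (dirs n))"
  by (auto simp: dirs_def atLeastAtMostSuc_conv)

lemma dirs_old:
  assumes "i \<in> dirs n" "n < m"
  shows "i \<noteq> Unprimed m" "i \<noteq> Primed m" "Unprimed m \<noteq> i" "Primed m \<noteq> i"
  using assms by (auto simp: dirs_def)

lemma G_shape_lift: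
  "G_shape (Suc n) \<alpha> = lift (Unprimed (Suc n) \<in> \<alpha>) (Primed (Suc n) \<in> \<alpha>) (G_shape n \<alpha>)"
  by (simp add: lift_def)

text \<open>The data of step \<open>n\<close> look only at directions up to \<open>n\<close>. So the
  old structure maps at the four new vertices are derived from one and the same law.\<close>

lemma insert_new:
  assumes "n < m" "j = Unprimed m \<or> j = Primed m"
  shows "G_shape n (insert j \<beta>) = G_shape n \<beta>"
    and "G_src K V n (insert j \<beta>) i = G_src K V n \<beta> i"
    and "G_tgt K V n (insert j \<beta>) i = G_tgt K V n \<beta> i"
    and "G_unit K V n (insert j \<beta>) i = G_unit K V n \<beta> i"
    and "G_prod K V n (insert j \<beta>) i = G_prod K V n \<beta> i"
    and "G_law K V W P n (insert j \<beta>) = G_law K V W P n \<beta>"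
proof -
  have sh: "G_shape n (insert j \<beta>) = G_shape n \<beta>" if "n < m" for n \<beta>
    using that assms(2) by (induction n) auto
  then show "G_shape n (insert j \<beta>) = G_shape n \<beta>"
    using assms(1) by simp
  show "G_src K V n (insert j \<beta>) i = G_src K V n \<beta> i" "G_tgt K V n (insert j \<beta>) i = G_tgt K V n \<beta> i"
    "G_law K V W P n (insert j \<beta>) = G_law K V W P n \<beta>"
    using assms(1) by (induction n) (auto simp: sh)
  show "G_unit K V n (insert j \<beta>) i = G_unit K V n \<beta> i" "G_prod K V n (insert j \<beta>) i = G_prod K V n \<beta> i"
    using assms(1) by (induction n) (auto simp: sh insert_commute[of i j])
qed

lemmas insert_Suc = insert_new[OF lessI disjI1[OF refl]] insert_new[OF lessI disjI2[OF refl]]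

declare G_shape.simps(2) [simp del] G_src.simps(2) [simp del] G_tgt.simps(2) [simp del]
  G_unit.simps(2) [simp del] G_prod.simps(2) [simp del] derived.simps [simp del]

lemma G_new:
  "G_src K V (Suc n) \<beta> (Unprimed (Suc n)) = k_src K V"
  "G_src K V (Suc n) \<beta> (Primed (Suc n)) = k'_src K V"
  "G_tgt K V (Suc n) \<beta> (Unprimed (Suc n)) = k_tgt K V"
  "G_tgt K V (Suc n) \<beta> (Primed (Suc n)) = k'_tgt K V"
  "G_unit K V (Suc n) \<beta> (Unprimed (Suc n)) = k_unit K V (G_shape n \<beta>)"
  "G_unit K V (Suc n) \<beta> (Primed (Suc n)) = k'_unit K V"
  "G_prod K V (Suc n) \<beta> (Unprimed (Suc n)) = k_prod K V"
  "G_prod K V (Suc n) \<beta> (Primed (Suc n)) = k'_prod K V"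
  by (simp_all add: G_src.simps G_tgt.simps G_unit.simps G_prod.simps)

lemma G_old:
  assumes "i \<in> dirs n"
  shows "G_src K V (Suc n) \<beta> i = derived K V V (G_shape n \<beta>) (G_src K V n \<beta> i)"
    and "G_tgt K V (Suc n) \<beta> i = derived K V V (G_shape n \<beta>) (G_tgt K V n \<beta> i)"
    and "G_unit K V (Suc n) \<beta> i = derived K V V (G_shape n (insert i \<beta>)) (G_unit K V n \<beta> i)"
    and "G_prod K V (Suc n) \<beta> i =
      (\<lambda>A p. derived K V V (G_shape n (insert i \<beta>)) (G_prod K V n \<beta> i) A (zip_pt p))"
    and "G_shape (Suc n) (insert i \<beta>) =
      lift (Unprimed (Suc n) \<in> \<beta>) (Primed (Suc n) \<in> \<beta>) (G_shape n (insert i \<beta>))"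
  using dirs_old[OF assms, of "Suc n"]
  by (simp_all add: G_src.simps G_tgt.simps G_unit.simps G_prod.simps G_shape_lift)

lemma edge_G_over_new:
  "Unprimed (Suc n) \<notin> \<beta> \<Longrightarrow> edge (G_over K V (Suc n) A) \<beta> (Unprimed (Suc n)) =
    k_cat K V A (Primed (Suc n) \<in> \<beta>) (G_shape n \<beta>)"
  "Primed (Suc n) \<notin> \<beta> \<Longrightarrow> edge (G_over K V (Suc n) A) \<beta> (Primed (Suc n)) =
    k'_cat K V A (Unprimed (Suc n) \<in> \<beta>) (G_shape n \<beta>)"
  by (simp_all add: edge_def G_over_def k_cat_def k'_cat_def G_shape_lift G_new insert_Suc)

context coeff_module
begin

interpretation two_modules K V V
  by unfold_locales

lemma G_laws:
  assumes "i \<in> dirs n" "i \<notin> \<beta>"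
  shows "law K V V (G_shape n (insert i \<beta>)) (G_shape n \<beta>) (G_src K V n \<beta> i) \<and>
    law K V V (G_shape n (insert i \<beta>)) (G_shape n \<beta>) (G_tgt K V n \<beta> i) \<and>
    law K V V (G_shape n \<beta>) (G_shape n (insert i \<beta>)) (G_unit K V n \<beta> i) \<and>
    law K V V (SDuo (G_shape n (insert i \<beta>)) (G_shape n (insert i \<beta>))) (G_shape n (insert i \<beta>))
      (G_prod K V n \<beta> i)"
  using assms
proof (induction n)
  case 0
  then show ?case by (simp add: dirs_def)
next
  case (Suc n)
  consider (1) "i = Unprimed (Suc n)" | (2) "i = Primed (Suc n)" | (3) "i \<in> dirs n"
    using Suc.prems by (auto simp: dirs_Suc)
  then show ?case
  proof cases
    case 1
    then show ?thesis
      using Suc.prems k_laws by (simp add: G_new G_shape_lift insert_Suc)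
  next
    case 2
    then show ?thesis
      using Suc.prems k_laws by (simp add: G_new G_shape_lift insert_Suc)
  next
    case 3
    note IH = Suc.IH[OF 3 Suc.prems(2)]
    show ?thesis
      unfolding G_old[OF 3] G_shape_lift[of n \<beta>]
      using IH by (auto intro!: derived_law law_comp[OF zip_pt_law derived_law])
  qed
qed

text \<open>An old edge of step \<open>n + 1\<close> over \<open>A\<close> lies over the same edge
  of step \<open>n\<close> over the algebras in the labels. Derived laws keep labels and become the
  original laws under \<open>enc\<close>.\<close>

lemma G_old_embedding:
  assumes A: "algebra K A" and i: "i \<in> dirs n" "i \<notin> \<beta>"
  shows "cat_embedding (edge (G_over K V (Suc n) A) \<beta> i) (\<lambda>l. edge (G_over K V n (fst l)) \<beta> i) (lab A) (enc K V A)"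
proof -
  define a b where "a = (Unprimed (Suc n) \<in> \<beta>)" and "b = (Primed (Suc n) \<in> \<beta>)"
  define X Y where "X = G_shape n (insert i \<beta>)" and "Y = G_shape n \<beta>"
  have sh: "G_shape (Suc n) \<beta> = lift a b Y" "G_shape (Suc n) (insert i \<beta>) = lift a b X"
    unfolding a_def b_def X_def Y_def by (rule G_shape_lift, rule G_old(5)[OF i(1)])
  note L = G_laws[OF i, folded X_def Y_def]
  from L have s: "law K V V X Y (G_src K V n \<beta> i)" and t: "law K V V X Y (G_tgt K V n \<beta> i)"
    and u: "law K V V Y X (G_unit K V n \<beta> i)" and c: "law K V V (SDuo X X) X (G_prod K V n \<beta> i)"
    by auto
  \<comment> \<open>Composability for the derived projections forces equal labels, hence equal
    scalars, and so \<open>zip_pt\<close> loses nothing.\<close>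
  have z: "lab A g' = lab A g \<and> zip_pt (Duo g' g) \<in> pts K V A (lift a b (SDuo X X)) \<and>
      lab A (zip_pt (Duo g' g)) = lab A g \<and> enc K V A (zip_pt (Duo g' g)) = Duo (enc K V A g') (enc K V A g)"
    if g: "g \<in> pts K V A (lift a b X)" "g' \<in> pts K V A (lift a b X)"
      and eq: "derived K V V Y (G_tgt K V n \<beta> i) A g = derived K V V Y (G_src K V n \<beta> i) A g'" for g g'
  proof -
    have l: "lab A g' = lab A g"
      using derived_lab(1)[OF g(1)] derived_lab(1)[OF g(2)] eq by metis
    then show ?thesis
      using zip_pt_closed[OF g(2,1)] zip_pt_lab[OF g(2,1) l] by simp
  qed
  show ?thesis
    by unfold_locales
      (auto simp: sh G_old(1-4)[OF i(1)] X_def[symmetric] Y_def[symmetric] derived_closed[OF s A]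
        derived_closed[OF t A] derived_closed[OF u A] derived_closed[OF c A] derived_lab
        derived_enc[OF s A] derived_enc[OF t A] derived_enc[OF u A] derived_enc[OF c A]
        derived_lab(1)[where X = "SDuo X X" and a = a and b = b] derived_enc[OF c A, where a = a and b = b]
        enc_closed[OF A] z intro: enc_inj[OF A])
qed

section \<open>The faces of the iterated categories\<close>

lemma composable_scalars:
  assumes "g \<in> pts K V A (lift a b X)" "g' \<in> pts K V A (lift a b X)"
    and "derived K V V Y f A g = derived K V V Y f' A g'"
  shows "added_scalars g' = added_scalars g"
  using derived_lab(2)[OF assms(1)] derived_lab(2)[OF assms(2)] assms(3) by metis

text \<open>The old direction is taken as the category object: its source, target and unit are
  derived laws, hence functors for direction \<open>k\<close> by
  \<open>derived_k_functor\<close>.\<close>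

lemma double_category_k_old:
  assumes A: "algebra K A" and i: "i \<in> dirs n" "i \<notin> \<beta>" and k: "Unprimed (Suc n) \<notin> \<beta>"
    and small: "small_category (edge (G_over K V (Suc n) A) \<beta> i)"
      "small_category (edge (G_over K V (Suc n) A) (insert (Unprimed (Suc n)) \<beta>) i)"
  shows "double_category (edge (G_over K V (Suc n) A) \<beta> (Unprimed (Suc n)))
    (edge (G_over K V (Suc n) A) (insert i \<beta>) (Unprimed (Suc n)))
    (edge (G_over K V (Suc n) A) \<beta> i) (edge (G_over K V (Suc n) A) (insert (Unprimed (Suc n)) \<beta>) i)"
proof -
  let ?k = "Unprimed (Suc n)" and ?G = "\<lambda>\<beta> i. edge (G_over K V (Suc n) A) \<beta> i"
  define b where "b = (Primed (Suc n) \<in> \<beta>)"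
  define X Y where "X = G_shape n (insert i \<beta>)" and "Y = G_shape n \<beta>"
  have ne: "i \<noteq> ?k" "i \<noteq> Primed (Suc n)"
    using dirs_old[OF i(1) lessI] by auto
  have C: "?G \<beta> ?k = k_cat K V A b Y" "?G (insert i \<beta>) ?k = k_cat K V A b X"
    using k ne by (auto simp: edge_G_over_new b_def X_def Y_def)
  note old = G_old[OF i(1)] insert_commute[of i ?k] insert_Suc
  have O: "Obj (?G \<beta> i) = pts K V A (lift False b Y)" "Mor (?G \<beta> i) = pts K V A (lift False b X)"
    "Obj (?G (insert ?k \<beta>) i) = pts K V A (lift True b Y)" "Mor (?G (insert ?k \<beta>) i) = pts K V A (lift True b X)"
    using k ne unfolding edge_G_over G_old(5)[OF i(1)] G_shape_lift[of n \<beta>] G_shape_lift[of n "insert ?k \<beta>"]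
    by (simp_all add: b_def X_def Y_def old)
  have S: "src (?G \<beta> i) = derived K V V Y (G_src K V n \<beta> i) A"
      "src (?G (insert ?k \<beta>) i) = derived K V V Y (G_src K V n \<beta> i) A"
      "tgt (?G \<beta> i) = derived K V V Y (G_tgt K V n \<beta> i) A"
      "tgt (?G (insert ?k \<beta>) i) = derived K V V Y (G_tgt K V n \<beta> i) A"
      "unt (?G \<beta> i) = derived K V V X (G_unit K V n \<beta> i) A"
      "unt (?G (insert ?k \<beta>) i) = derived K V V X (G_unit K V n \<beta> i) A"
      "cmp (?G \<beta> i) = (\<lambda>g' g. derived K V V X (G_prod K V n \<beta> i) A (zip_pt (Duo g' g)))"
      "cmp (?G (insert ?k \<beta>) i) = (\<lambda>g' g. derived K V V X (G_prod K V n \<beta> i) A (zip_pt (Duo g' g)))"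
    by (simp_all add: X_def Y_def old)
  note L = G_laws[OF i, folded X_def Y_def]
  \<comment> \<open>The derived product is regrouping followed by a derived law, a composite of two
    functors.\<close>
  have "is_functor (composable_pairs (k_cat K V A b X) (?G \<beta> i) (?G (insert ?k \<beta>) i)) (k_cat K V A b X)
      (\<lambda>p. derived K V V X (G_prod K V n \<beta> i) A ((\<lambda>(g', g). zip_pt (Duo g' g)) p))
      (\<lambda>p. derived K V V X (G_prod K V n \<beta> i) A ((\<lambda>(g', g). zip_pt (Duo g' g)) p))"
    by (rule is_functor_comp[OF zip_k_functor derived_k_functor[OF _ A]])
      (use L in \<open>auto simp: S simp del: edge_G_over intro: composable_scalars\<close>)
  then have P: "is_functor (composable_pairs (k_cat K V A b X) (?G \<beta> i) (?G (insert ?k \<beta>) i)) (k_cat K V A b X)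
      (case_prod (cmp (?G \<beta> i))) (case_prod (cmp (?G (insert ?k \<beta>) i)))"
    unfolding S by (simp add: case_prod_beta' split_def)
  show ?thesis
    unfolding double_category_def C
    using small L P by (simp add: O S small_k_cat[OF A] derived_k_functor[OF _ A] del: edge_G_over)
qed

text \<open>As for direction \<open>k\<close>, but with homogeneity of the difference quotient in
  place of the Taylor formula and additivity.\<close>

lemma double_category_k'_old:
  assumes A: "algebra K A" and i: "i \<in> dirs n" "i \<notin> \<beta>" and k: "Primed (Suc n) \<notin> \<beta>"
    and small: "small_category (edge (G_over K V (Suc n) A) \<beta> i)"
      "small_category (edge (G_over K V (Suc n) A) (insert (Primed (Suc n)) \<beta>) i)"
  shows "double_category (edge (G_over K V (Suc n) A) \<beta> (Primed (Suc n)))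
    (edge (G_over K V (Suc n) A) (insert i \<beta>) (Primed (Suc n)))
    (edge (G_over K V (Suc n) A) \<beta> i) (edge (G_over K V (Suc n) A) (insert (Primed (Suc n)) \<beta>) i)"
proof -
  let ?k = "Primed (Suc n)" and ?G = "\<lambda>\<beta> i. edge (G_over K V (Suc n) A) \<beta> i"
  define a where "a = (Unprimed (Suc n) \<in> \<beta>)"
  define X Y where "X = G_shape n (insert i \<beta>)" and "Y = G_shape n \<beta>"
  have ne: "i \<noteq> ?k" "i \<noteq> Unprimed (Suc n)"
    using dirs_old[OF i(1) lessI] by auto
  have C: "?G \<beta> ?k = k'_cat K V A a Y" "?G (insert i \<beta>) ?k = k'_cat K V A a X"
    using k ne by (auto simp: edge_G_over_new a_def X_def Y_def)
  note old = G_old[OF i(1)] insert_commute[of i ?k] insert_Suc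
  have O: "Obj (?G \<beta> i) = pts K V A (lift a False Y)" "Mor (?G \<beta> i) = pts K V A (lift a False X)"
    "Obj (?G (insert ?k \<beta>) i) = pts K V A (lift a True Y)" "Mor (?G (insert ?k \<beta>) i) = pts K V A (lift a True X)"
    using k ne unfolding edge_G_over G_old(5)[OF i(1)] G_shape_lift[of n \<beta>] G_shape_lift[of n "insert ?k \<beta>"]
    by (simp_all add: a_def X_def Y_def old)
  have S: "src (?G \<beta> i) = derived K V V Y (G_src K V n \<beta> i) A"
      "src (?G (insert ?k \<beta>) i) = derived K V V Y (G_src K V n \<beta> i) A"
      "tgt (?G \<beta> i) = derived K V V Y (G_tgt K V n \<beta> i) A"
      "tgt (?G (insert ?k \<beta>) i) = derived K V V Y (G_tgt K V n \<beta> i) A"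
      "unt (?G \<beta> i) = derived K V V X (G_unit K V n \<beta> i) A"
      "unt (?G (insert ?k \<beta>) i) = derived K V V X (G_unit K V n \<beta> i) A"
      "cmp (?G \<beta> i) = (\<lambda>g' g. derived K V V X (G_prod K V n \<beta> i) A (zip_pt (Duo g' g)))"
      "cmp (?G (insert ?k \<beta>) i) = (\<lambda>g' g. derived K V V X (G_prod K V n \<beta> i) A (zip_pt (Duo g' g)))"
    by (simp_all add: X_def Y_def old)
  note L = G_laws[OF i, folded X_def Y_def]
  have "is_functor (composable_pairs (k'_cat K V A a X) (?G \<beta> i) (?G (insert ?k \<beta>) i)) (k'_cat K V A a X)
      (\<lambda>p. derived K V V X (G_prod K V n \<beta> i) A ((\<lambda>(g', g). zip_pt (Duo g' g)) p))
      (\<lambda>p. derived K V V X (G_prod K V n \<beta> i) A ((\<lambda>(g', g). zip_pt (Duo g' g)) p))"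
    by (rule is_functor_comp[OF zip_k'_functor derived_k'_functor[OF _ A]])
      (use L in \<open>auto simp: S simp del: edge_G_over intro: composable_scalars\<close>)
  then have P: "is_functor (composable_pairs (k'_cat K V A a X) (?G \<beta> i) (?G (insert ?k \<beta>) i)) (k'_cat K V A a X)
      (case_prod (cmp (?G \<beta> i))) (case_prod (cmp (?G (insert ?k \<beta>) i)))"
    unfolding S by (simp add: case_prod_beta' split_def)
  show ?thesis
    unfolding double_category_def C
    using small L P by (simp add: O S small_k'_cat[OF A] derived_k'_functor[OF _ A] del: edge_G_over)
qed

text \<open>Faces with two old directions are reflected from step \<open>n\<close>; the others
  contain a new direction and are settled directly, the reverse orders by
  \<open>double_category_sym\<close>.\<close>

lemma G_over_category:
  assumes "algebra K A"
  shows "(\<forall>\<beta> i. i \<in> dirs n - \<beta> \<longrightarrow> small_category (edge (G_over K V n A) \<beta> i)) \<and>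
    (\<forall>\<beta> i j. i \<in> dirs n - \<beta> \<and> j \<in> dirs n - \<beta> \<and> i \<noteq> j \<longrightarrow>
      double_category (edge (G_over K V n A) \<beta> i) (edge (G_over K V n A) (insert j \<beta>) i)
        (edge (G_over K V n A) \<beta> j) (edge (G_over K V n A) (insert i \<beta>) j))"
  using assms
proof (induction n arbitrary: A)
  case 0
  then show ?case by (simp add: dirs_def)
next
  case (Suc n)
  note A = Suc.prems
  let ?k = "Unprimed (Suc n)" and ?k' = "Primed (Suc n)"
  let ?G = "\<lambda>\<beta> i. edge (G_over K V (Suc n) A) \<beta> i"
  let ?double = "\<lambda>\<beta> i j. double_category (?G \<beta> i) (?G (insert j \<beta>) i) (?G \<beta> j) (?G (insert i \<beta>) j)"
  have alg: "algebra K (fst (lab A x))" if "x \<in> pts K V A (G_shape (Suc n) \<beta>)" for x \<beta>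
    using lab_algebra[OF A] that by (simp add: G_shape_lift)
  have old: "small_category (?G \<beta> i)" if "i \<in> dirs n" "i \<notin> \<beta>" for \<beta> i
    by (rule cat_embedding.small_category_reflect[OF G_old_embedding[OF A that]])
      (use Suc.IH alg that in auto)
  have small: "small_category (?G \<beta> i)" if i: "i \<in> dirs (Suc n)" "i \<notin> \<beta>" for \<beta> i
    using i old small_k_cat[OF A] small_k'_cat[OF A] by (auto simp: dirs_Suc edge_G_over_new)
  \<comment> \<open>All four edges embed with the same \<open>lab\<close> and \<open>enc\<close>, so
    the face lies over faces of step \<open>n\<close> over the algebras in the labels.\<close>
  have old_old: "?double \<beta> i j" if ij: "i \<in> dirs n" "i \<notin> \<beta>" "j \<in> dirs n" "j \<notin> \<beta>" "i \<noteq> j" for \<beta> i j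
  proof (rule double_category_reflect)
    show "cat_embedding (?G \<beta> i) (\<lambda>l. edge (G_over K V n (fst l)) \<beta> i) (lab A) (enc K V A)"
      "cat_embedding (?G (insert j \<beta>) i) (\<lambda>l. edge (G_over K V n (fst l)) (insert j \<beta>) i) (lab A) (enc K V A)"
      "cat_embedding (?G \<beta> j) (\<lambda>l. edge (G_over K V n (fst l)) \<beta> j) (lab A) (enc K V A)"
      "cat_embedding (?G (insert i \<beta>) j) (\<lambda>l. edge (G_over K V n (fst l)) (insert i \<beta>) j) (lab A) (enc K V A)"
      using ij by (auto intro!: G_old_embedding A)
  qed (use Suc.IH alg ij in \<open>auto simp: insert_commute[of i j]\<close>)
  have new_new: "?double \<beta> ?k ?k'" if "?k \<notin> \<beta>" "?k' \<notin> \<beta>" for \<beta>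
    using double_category_new[OF A, of "G_shape n \<beta>"] that by (simp add: edge_G_over_new insert_Suc)
  have k_old: "?double \<beta> ?k i" if i: "i \<in> dirs n" "i \<notin> \<beta>" and k: "?k \<notin> \<beta>" for \<beta> i
    by (rule double_category_k_old[OF A i k old[OF i] old[OF i(1)]]) (use i dirs_old in auto)
  have k'_old: "?double \<beta> ?k' i" if i: "i \<in> dirs n" "i \<notin> \<beta>" and k': "?k' \<notin> \<beta>" for \<beta> i
    by (rule double_category_k'_old[OF A i k' old[OF i] old[OF i(1)]]) (use i dirs_old in auto)
  have double: "?double \<beta> i j"
    if ij: "i \<in> dirs (Suc n) - \<beta>" "j \<in> dirs (Suc n) - \<beta>" "i \<noteq> j" for \<beta> i j
  proof -
    consider "i \<in> dirs n" "j \<in> dirs n" | "i = ?k" "j = ?k'" | "i = ?k'" "j = ?k"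
      | "i = ?k" "j \<in> dirs n" | "i = ?k'" "j \<in> dirs n" | "j = ?k" "i \<in> dirs n" | "j = ?k'" "i \<in> dirs n"
      using ij by (auto simp: dirs_Suc)
    then show ?thesis
    proof cases
      case 1
      then show ?thesis using ij by (intro old_old) auto
    next
      case 2
      then show ?thesis using new_new[of \<beta>] ij by simp
    next
      case 3
      then show ?thesis using new_new[THEN double_category_sym, of \<beta>] ij by simp
    next
      case 4
      then show ?thesis using k_old[of j \<beta>] ij by simp
    next
      case 5
      then show ?thesis using k'_old[of j \<beta>] ij by simp
    next
      case 6
      then show ?thesis using k_old[THEN double_category_sym, of i \<beta>] ij by simp
    next
      case 7
      then show ?thesis using k'_old[THEN double_category_sym, of i \<beta>] ij by simp
    qed
  qed
  show ?case
    using small double by blast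
qed

end


section \<open>The iterated derivatives as morphisms\<close>

lemma base_law_law:
  assumes "polynomial_law K V W P"
  shows "law K V W SBase SBase (base_law P)"
  using assms unfolding polynomial_law_def by (intro lawI) (auto simp: Pi_def)

context two_modules
begin

context
  fixes P :: "'k alg \<Rightarrow> ('v, 'k) tns \<Rightarrow> ('w, 'k) tns"
  assumes P: "polynomial_law K V W P"
begin

lemma G_law_law: "law K V W (G_shape n \<alpha>) (G_shape n \<alpha>) (G_law K V W P n \<alpha>)"
  by (induction n) (simp_all add: base_law_law[OF P] G_shape_lift derived_law)

text \<open>For a new direction every derived law is a functor. For an old one the map lies over the
  functor of step \<open>n\<close>, taken over the algebra in the label.\<close>

lemma G_law_functor:
  assumes "algebra K A" "i \<in> dirs n" "i \<notin> \<beta>"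
  shows "is_functor (edge (G_over K V n A) \<beta> i) (edge (G_over K W n A) \<beta> i)
    (G_law K V W P n \<beta> A) (G_law K V W P n (insert i \<beta>) A)"
  using assms
proof (induction n arbitrary: A)
  case 0
  then show ?case by (simp add: dirs_def)
next
  case (Suc n)
  note A = Suc.prems(1)
  consider (1) "i = Unprimed (Suc n)" | (2) "i = Primed (Suc n)" | (3) "i \<in> dirs n"
    using Suc.prems by (auto simp: dirs_Suc)
  then show ?case
  proof cases
    case 1
    then show ?thesis
      using Suc.prems derived_k_functor[OF G_law_law A] by (simp add: edge_G_over_new insert_Suc)
  next
    case 2
    then show ?thesis
      using Suc.prems derived_k'_functor[OF G_law_law A] by (simp add: edge_G_over_new insert_Suc)
  next
    case 3
    note i = 3 Suc.prems(3)
    note sh = G_shape_lift[of n \<beta>] G_old(5)[OF i(1), of \<beta>]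
    show ?thesis
    \<comment> \<open>The relabelling \<open>j\<close> is the identity since derived laws preserve
      labels.\<close>
    proof (rule is_functor_reflect[where j = "\<lambda>l. l" and ?F0.0 = "\<lambda>l. G_law K V W P n \<beta> (fst l)"
          and ?F1.0 = "\<lambda>l. G_law K V W P n (insert i \<beta>) (fst l)",
          OF V.G_old_embedding[OF A i] W.G_old_embedding[OF A i]], unfold edge_G_over sh, goal_cases)
      case (1 x)
      then show ?case by (simp add: derived_closed[OF G_law_law A])
    next
      case (2 x)
      then show ?case by (simp add: derived_closed[OF G_law_law A])
    next
      case (3 x)
      then show ?case by (simp add: derived_lab)
    next
      case (4 x)
      then show ?case by (simp add: derived_lab)
    next
      case (5 x)
      then show ?case by (simp add: derived_enc[OF G_law_law A])
    next
      case (6 x)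
      then show ?case by (simp add: derived_enc[OF G_law_law A])
    next
      case (7 x)
      then show ?case by (intro Suc.IH i V.lab_algebra[OF A])
    qed
  qed
qed

end

end


section \<open>Restriction to \<open>K\<close>-points\<close>

lemma pt_embed_simps [simp]:
  "pt_embed K V (Vec w) = Vec (pure_tensor K V (scal_alg K) w (Scal \<one>\<^bsub>K\<^esub>))"
  "pt_embed K V (Xt x t) = Xt (pt_embed K V x) (Scal t)"
  "pt_embed K V (Xvt x v t) = Xvt (pt_embed K V x) (pt_embed K V v) (Scal t)"
  "pt_embed K V (Xst x s t) = Xst (pt_embed K V x) (Scal s) (Scal t)"
  "pt_embed K V (Xvst x v s t) = Xvst (pt_embed K V x) (pt_embed K V v) (Scal s) (Scal t)"
  "pt_embed K V (Duo x y) = Duo (pt_embed K V x) (pt_embed K V y)"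
  by (simp_all add: pt_embed_def)

lemma added_scalars_pt_embed:
  assumes "p \<in> pt_carrier K V (lift a b S)"
  shows "added_scalars (pt_embed K V p) = map Scal (added_scalars p)"
  using assms by (cases a; cases b) auto

context coeff_module
begin

lemma carrier_scal_alg: "carrier (scal_alg K) = Scal ` carrier K"
  by (simp add: scal_alg_def)

lemma K_algebra: "algebra K (scal_alg K)"
  by (rule scal_alg_algebra) (rule R.cring_axioms)

lemma pt_embed_closed: "p \<in> pt_carrier K V S \<Longrightarrow> pt_embed K V p \<in> pts K V (scal_alg K) S"
  by (induction S arbitrary: p) (auto simp: carrier_scal_alg intro!: pure_tensor_closed)

lemma pt_embed_inj:
  "p \<in> pt_carrier K V S \<Longrightarrow> q \<in> pt_carrier K V S \<Longrightarrow> pt_embed K V p = pt_embed K V q \<Longrightarrow> p = q"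
  by (induction S arbitrary: p q) (auto dest: pure_tensor_scal_inj)

lemma pt_embed_surj: "z \<in> pts K V (scal_alg K) S \<Longrightarrow> z \<in> pt_embed K V ` pt_carrier K V S"
proof (induction S arbitrary: z)
  case SBase
  then show ?case by (auto elim!: pure_tensor_scal_surj simp: image_image)
next
  case (SXt S)
  then obtain x t where z: "z = Xt x (Scal t)" "x \<in> pts K V (scal_alg K) S" "t \<in> carrier K"
    by (auto simp: carrier_scal_alg)
  from SXt.IH[OF z(2)] show ?case
    using z(1,3) by (auto intro!: image_eqI[of _ _ "Xt _ t"])
next
  case (SXvt S)
  then obtain x v t where z: "z = Xvt x v (Scal t)" "x \<in> pts K V (scal_alg K) S"
    "v \<in> pts K V (scal_alg K) S" "t \<in> carrier K"
    by (auto simp: carrier_scal_alg)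
  from SXvt.IH[OF z(2)] SXvt.IH[OF z(3)] show ?case
    using z(1,4) by (auto intro!: image_eqI[of _ _ "Xvt _ _ t"])
next
  case (SXst S)
  then obtain x s t where z: "z = Xst x (Scal s) (Scal t)" "x \<in> pts K V (scal_alg K) S"
    "s \<in> carrier K" "t \<in> carrier K"
    by (auto simp: carrier_scal_alg)
  from SXst.IH[OF z(2)] show ?case
    using z(1,3,4) by (auto intro!: image_eqI[of _ _ "Xst _ s t"])
next
  case (SXvst S)
  then obtain x v s t where z: "z = Xvst x v (Scal s) (Scal t)" "x \<in> pts K V (scal_alg K) S"
    "v \<in> pts K V (scal_alg K) S" "s \<in> carrier K" "t \<in> carrier K"
    by (auto simp: carrier_scal_alg)
  from SXvst.IH[OF z(2)] SXvst.IH[OF z(3)] show ?case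
    using z(1,4,5) by (auto intro!: image_eqI[of _ _ "Xvst _ _ s t"])
next
  case (SDuo S S')
  then obtain x y where z: "z = Duo x y" "x \<in> pts K V (scal_alg K) S" "y \<in> pts K V (scal_alg K) S'"
    by auto
  from SDuo.IH(1)[OF z(2)] SDuo.IH(2)[OF z(3)] show ?case
    using z(1) by (auto intro!: image_eqI[of _ _ "Duo _ _"])
qed

end

context two_modules
begin

text \<open>Since \<open>pt_embed\<close> maps onto the points over \<open>scal_alg K\<close>, the
  \<open>inv_into\<close> in \<open>law_at_K\<close> picks a genuine preimage.\<close>

lemma law_at_K:
  assumes "law K V W X Y f" "p \<in> pt_carrier K V X"
  shows "law_at_K K V W Y f p \<in> pt_carrier K W Y"
    and "pt_embed K W (law_at_K K V W Y f p) = f (scal_alg K) (pt_embed K V p)"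
proof -
  have "f (scal_alg K) (pt_embed K V p) \<in> pt_embed K W ` pt_carrier K W Y"
    using assms by (intro W.pt_embed_surj law_closed[OF assms(1) V.K_algebra] V.pt_embed_closed)
  then show "law_at_K K V W Y f p \<in> pt_carrier K W Y"
    and "pt_embed K W (law_at_K K V W Y f p) = f (scal_alg K) (pt_embed K V p)"
    unfolding law_at_K_def by (auto intro: inv_into_into f_inv_into_f)
qed

end

lemma edge_G [simp]:
  "Obj (edge (G K V n) \<beta> i) = pt_carrier K V (G_shape n \<beta>)"
  "Mor (edge (G K V n) \<beta> i) = pt_carrier K V (G_shape n (insert i \<beta>))"
  "src (edge (G K V n) \<beta> i) = law_at_K K V V (G_shape n \<beta>) (G_src K V n \<beta> i)"
  "tgt (edge (G K V n) \<beta> i) = law_at_K K V V (G_shape n \<beta>) (G_tgt K V n \<beta> i)"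
  "unt (edge (G K V n) \<beta> i) = law_at_K K V V (G_shape n (insert i \<beta>)) (G_unit K V n \<beta> i)"
  "cmp (edge (G K V n) \<beta> i) =
    (\<lambda>g' g. law_at_K K V V (G_shape n (insert i \<beta>)) (G_prod K V n \<beta> i) (Duo g' g))"
  by (simp_all add: edge_def G_def)

context coeff_module
begin

interpretation S: two_modules K V V
  by unfold_locales

text \<open>With a single label, the transport used for derivation also passes from the categories
  over \<open>scal_alg K\<close> to those of \<open>K\<close>-points.\<close>

lemma G_embedding:
  assumes i: "i \<in> dirs n" "i \<notin> \<beta>"
  shows "cat_embedding (edge (G K V n) \<beta> i) (\<lambda>l. edge (G_over K V n (scal_alg K)) \<beta> i) (\<lambda>_. ()) (pt_embed K V)"
proof -
  from G_laws[OF i] have s: "law K V V (G_shape n (insert i \<beta>)) (G_shape n \<beta>) (G_src K V n \<beta> i)"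
    and t: "law K V V (G_shape n (insert i \<beta>)) (G_shape n \<beta>) (G_tgt K V n \<beta> i)"
    and u: "law K V V (G_shape n \<beta>) (G_shape n (insert i \<beta>)) (G_unit K V n \<beta> i)"
    and c: "law K V V (SDuo (G_shape n (insert i \<beta>)) (G_shape n (insert i \<beta>))) (G_shape n (insert i \<beta>))
      (G_prod K V n \<beta> i)"
    by auto
  show ?thesis
    by unfold_locales
      (auto simp: S.law_at_K[OF s] S.law_at_K[OF t] S.law_at_K[OF u] S.law_at_K[OF c] pt_embed_closed
        intro: pt_embed_inj)
qed

lemma G_category: "mfold_category (dirs n) (G K V n)"
  unfolding mfold_category_def
proof (intro conjI allI impI)
  note G_over = G_over_category[OF K_algebra, of n]
  show "finite (dirs n)"
    by (simp add: dirs_def)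
  show "small_category (edge (G K V n) \<beta> i)" if "\<beta> \<subseteq> dirs n \<and> i \<in> dirs n - \<beta>" for \<beta> i
    by (rule cat_embedding.small_category_reflect[OF G_embedding]) (use that G_over in auto)
  show "double_category (edge (G K V n) \<beta> i) (edge (G K V n) (insert j \<beta>) i)
      (edge (G K V n) \<beta> j) (edge (G K V n) (insert i \<beta>) j)"
    if ij: "\<beta> \<subseteq> dirs n \<and> i \<in> dirs n - \<beta> \<and> j \<in> dirs n - \<beta> \<and> i \<noteq> j" for \<beta> i j
    by (rule double_category_reflect[OF G_embedding G_embedding G_embedding G_embedding])
      (use ij G_over in \<open>auto simp: insert_commute[of i j]\<close>)
qed

end

lemma (in two_modules) G_map_morphism:
  assumes P: "polynomial_law K V W P"
  shows "mfold_morphism (dirs n) (G K V n) (G K W n) (G_map K V W P n)"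
  unfolding mfold_morphism_def
proof (intro conjI allI impI V.G_category W.G_category)
  note m = law_at_K[OF G_law_law[OF P], folded G_map_def]
  show "G_map K V W P n \<alpha> \<in> vert (G K V n) \<alpha> \<rightarrow> vert (G K W n) \<alpha>" if "\<alpha> \<subseteq> dirs n" for \<alpha>
    by (auto simp: G_def m)
  show "is_functor (edge (G K V n) \<beta> i) (edge (G K W n) \<beta> i) (G_map K V W P n \<beta>)
      (G_map K V W P n (insert i \<beta>))" if i: "\<beta> \<subseteq> dirs n \<and> i \<in> dirs n - \<beta>" for \<beta> i
    by (rule is_functor_reflect[where j = "\<lambda>l. l" and ?F0.0 = "\<lambda>l. G_law K V W P n \<beta> (scal_alg K)"
          and ?F1.0 = "\<lambda>l. G_law K V W P n (insert i \<beta>) (scal_alg K)",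
          OF V.G_embedding W.G_embedding])
      (use i G_law_functor[OF P V.K_algebra] in \<open>auto simp: m\<close>)
qed

theorem theorem3p14:
  fixes K :: "'k ring"
    and V :: "('k, 'v) module"
    and W :: "('k, 'w) module"
    and P :: "'k alg \<Rightarrow> ('v, 'k) tns \<Rightarrow> ('w, 'k) tns"
  assumes "cring K" and "module K V" and "module K W"
    and "polynomial_law K V W P"
  shows "homogeneous_smooth_law K V W (G_map K V W P) \<and>
         has_base_map V (G_map K V W P) (underlying_map K V W P)"
proof -
  interpret two_modules K V W
    using assms(2,3) by (simp add: two_modules_def coeff_module_def)
  note m = law_at_K[OF G_law_law[OF assms(4)], folded G_map_def]
  have inj: "inj (Scal :: 'k \<Rightarrow> 'k uelem)"
    by (simp add: inj_on_def)
  \<comment> \<open>The sides are compared after \<open>pt_embed\<close>, where \<open>G_map\<close>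
    turns into \<open>G_law\<close> over \<open>scal_alg K\<close> and the formula for
    \<open>derived\<close> on \<open>Xt\<close> applies.\<close>
  have "G_map K V W P (Suc n) \<alpha> (Xt x t) = Xt (G_map K V W P n \<alpha> x) t"
    if "Xt x t \<in> pt_carrier K V (G_shape (Suc n) \<alpha>)" "Unprimed (Suc n) \<notin> \<alpha>" "Primed (Suc n) \<notin> \<alpha>" for n \<alpha> x t
  proof (rule W.pt_embed_inj)
    have x: "x \<in> pt_carrier K V (G_shape n \<alpha>)" "t \<in> carrier K"
      using that by (auto simp: G_shape_lift)
    show "G_map K V W P (Suc n) \<alpha> (Xt x t) \<in> pt_carrier K W (G_shape (Suc n) \<alpha>)"
      using that(1) by (rule m)
    show "Xt (G_map K V W P n \<alpha> x) t \<in> pt_carrier K W (G_shape (Suc n) \<alpha>)"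
      using x that m(1) by (simp add: G_shape_lift)
    show "pt_embed K W (G_map K V W P (Suc n) \<alpha> (Xt x t)) = pt_embed K W (Xt (G_map K V W P n \<alpha> x) t)"
      using x by (simp add: m(2)[OF that(1)] m(2) derived.simps)
  qed
  moreover have "added_scalars (G_map K V W P (Suc n) \<alpha> p) = added_scalars p"
    if p: "p \<in> pt_carrier K V (G_shape (Suc n) \<alpha>)" for n \<alpha> p
  proof -
    \<comment> \<open>Embedding wraps each scalar in \<open>Scal\<close>; derived laws keep the
      wrapped scalars, and \<open>Scal\<close> is injective.\<close>
    have "map Scal (added_scalars (G_map K V W P (Suc n) \<alpha> p)) =
        added_scalars (derived K V W (G_shape n \<alpha>) (G_law K V W P n \<alpha>) (scal_alg K) (pt_embed K V p))"
      using m[OF p] by (simp add: G_shape_lift added_scalars_pt_embed[symmetric])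
    also have "\<dots> = map Scal (added_scalars p)"
      using p V.pt_embed_closed[OF p] by (simp add: G_shape_lift derived_lab(2) added_scalars_pt_embed)
    finally show ?thesis
      by (simp add: inj_map_eq_map[OF inj])
  qed
  ultimately have "homogeneous_smooth_law K V W (G_map K V W P)"
    unfolding homogeneous_smooth_law_def using G_map_morphism[OF assms(4)]
    by (auto simp: G_def Suc_le_eq gr0_conv_Suc)
  moreover have "G_map K V W P 0 {} (Vec v) = Vec (underlying_map K V W P v)" if v: "v \<in> carrier V" for v
  proof (rule W.pt_embed_inj)
    let ?e = "\<lambda>w. pure_tensor K W (scal_alg K) w (Scal \<one>\<^bsub>K\<^esub>)"
    have Vv: "Vec v \<in> pt_carrier K V (G_shape 0 {})"
      using v by simp
    obtain w where w: "w \<in> carrier W" "G_map K V W P 0 {} (Vec v) = Vec w"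
      using m(1)[OF Vv] by auto
    then have Pw: "P (scal_alg K) (pure_tensor K V (scal_alg K) v (Scal \<one>\<^bsub>K\<^esub>)) = ?e w"
      using m(2)[OF Vv] by simp
    have "?e w \<in> ?e ` carrier W"
      using w(1) by (rule imageI)
    \<comment> \<open>By \<open>Pw\<close> the value of \<open>P\<close> lies in the image of
      \<open>?e\<close>, so the inverse chosen in \<open>underlying_map\<close> is a preimage of the
      same tensor.\<close>
    then have "underlying_map K V W P v \<in> carrier W \<and> ?e (underlying_map K V W P v) = ?e w"
      unfolding underlying_map_def Pw by (intro conjI inv_into_into f_inv_into_f)
    then show "Vec (underlying_map K V W P v) \<in> pt_carrier K W (G_shape 0 {})"
      and "pt_embed K W (G_map K V W P 0 {} (Vec v)) = pt_embed K W (Vec (underlying_map K V W P v))"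
      using w by auto
    show "G_map K V W P 0 {} (Vec v) \<in> pt_carrier K W (G_shape 0 {})"
      using m(1)[OF Vv] .
  qed
  ultimately show ?thesis
    by (simp add: has_base_map_def)
qed

end
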